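(* Let $\mathcal{F}$ be a family of pairs $(f,g)$ of non-negative measurable functions on $\mathbb{R}^n$. Given $\delta$, $0<\delta\le1$, suppose that for every $w\in A_2$, $$\int_{\mathbb{R}^n}f(x)^2w(x)^\delta\,dx\le C\int_{\mathbb{R}^n}g(x)^2w(x)^\delta\,dx,\qquad(f,g)\in\mathcal{F}.$$ Then for every $p(\cdot)\in LH$ such that $$\frac{2}{1+\delta}<p_-\le p_+<\frac{2}{1-\delta}$$ (with $2/(1-\delta)=\infty$ if $\delta=1$), we have $$\|f\|_{p(\cdot)}\le C\|g\|_{p(\cdot)},\qquad(f,g)\in\mathcal{F}.$$ More generally, for every such $p(\cdot)$, setting $q_-=\frac2{1+\delta}$ and $q_+=\frac2{1-\delta}$, there exists $p_*$, $q_-<p_*<q_+$, such that if $\sigma=\frac{p_*q_-}{p_*-q_-}$, then there exists a constant $c\in(0,1)$ so that for every weight $w$ with $w^\sigma\in A_{p(\cdot)/(c\sigma)}$, $$\|fw\|_{p(\cdot)}\le C\|gw\|_{p(\cdot)},\qquad(f,g)\in\mathcal{F}.$$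
   Context: $\mathcal{P}$ is the set of measurable $p(\cdot):\mathbb{R}^n\to[1,\infty]$; $p_-=\operatorname{ess\,inf}p$, $p_+=\operatorname{ess\,sup}p$. The conjugate exponent is defined pointwise by $1/p(x)+1/p'(x)=1$, $1/\infty=0$. With $\mathbb{R}^n_\infty=\{x:p(x)=\infty\}$, $$\|f\|_{p(\cdot)}=\inf\Big\{\lambda>0:\int_{\mathbb{R}^n\setminus\mathbb{R}^n_\infty}\Big(\frac{|f(x)|}{\lambda}\Big)^{p(x)}dx+\lambda^{-1}\|f\|_{L^\infty(\mathbb{R}^n_\infty)}\le1\Big\}.$$ $p(\cdot)\in LH$ means $p(\cdot)\in\mathcal{P}$ and there are constants $C_0$, $C_\infty>0$ and $p_\infty$ with $|p(x)-p(y)|\le\frac{C_0}{-\log|x-y|}$ for all $|x-y|<1/2$, and $|p(x)-p_\infty|\le\frac{C_\infty}{\log(e+|x|)}$ for all $x$. A weight is a non-negative measurable function. For $r(\cdot)\in\mathcal{P}$, $w\in A_{r(\cdot)}$ iff $0<w<\infty$ a.e. and $\sup_B|B|^{-1}\|w\chi_B\|_{r(\cdot)}\|w^{-1}\chi_B\|_{r'(\cdot)}<\infty$. The class $A_2$ in the hypothesis is the classical one: $w\in A_2$ iff $\sup_B\big(\frac1{|B|}\int_Bw\big)\big(\frac1{|B|}\int_Bw^{-1}\big)<\infty$. Suprema are over balls $B\subset\mathbb{R}^n$. Convention: an inequality over $(f,g)\in\mathcal{F}$ (norm or weighted integral) means that it holds, with constant independent of the pair, for every pair $(f,g)\in\mathcal{F}$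 for which the left-hand side is finite. *)

theory Defs
  imports "HOL-Probability.Essential_Supremum"
begin

text \<open>
  Functions, weights and exponents on the Euclidean space \<open>'a\<close> take values in \<open>[0,\<infinity>]\<close>
  (type \<^typ>\<open>ennreal\<close>), so that \<open>1/0 = \<infinity>\<close> and \<open>1/\<infinity> = 0\<close>; all measure theory is with respect to
  the completed Lebesgue measure.
\<close>

text \<open>\<open>x ^ a\<close> on \<open>[0,\<infinity>]\<close>. Only meaningful for \<open>a > 0\<close>, which is the only case in which it is used.\<close>
definition ennpowr :: "ennreal \<Rightarrow> real \<Rightarrow> ennreal" where
  "ennpowr x a = (if x = \<infinity> then \<infinity> else ennreal (enn2real x powr a))"

text \<open>Dual to the library's \<^const>\<open>esssup\<close>, including its convention for non-measurable functions.\<close>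
definition essinf :: "'a measure \<Rightarrow> ('a \<Rightarrow> ennreal) \<Rightarrow> ennreal" where
  "essinf M f = (if f \<in> borel_measurable M then Liminf (ae_filter M) f else bot)"

lemma essinf_eq_AE:
  assumes f: "f \<in> borel_measurable M"
  shows "essinf M f = Sup {z. AE x in M. z \<le> f x}"
  unfolding essinf_def if_P[OF f] Liminf_def
proof (intro antisym SUP_least Sup_least; clarsimp)
  fix y assume "AE x in M. y \<le> f x"
  then have "(\<lambda>x. y \<le> f x) \<in> {P. AE x in M. P x}"
    by simp
  then show "y \<le> (SUP P\<in>{P. AE x in M. P x}. INF x\<in>Collect P. f x)"
    by (rule SUP_upper2) (auto intro: INF_greatest)
next
  fix P assume P: "AE x in M. P x"
  show "(INF x\<in>Collect P. f x) \<le> Sup {z. AE x in M. z \<le> f x}"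
  proof (rule Sup_upper; clarsimp)
    show "AE x in M. (INF x\<in>Collect P. f x) \<le> f x"
      using P by (auto elim: eventually_mono simp: INF_lower)
  qed
qed

definition exponents :: "('a::euclidean_space \<Rightarrow> ennreal) set" where
  "exponents = {p. p \<in> borel_measurable lebesgue \<and> (\<forall>x. 1 \<le> p x)}"

definition conj_exponent :: "('a \<Rightarrow> ennreal) \<Rightarrow> 'a \<Rightarrow> ennreal" where
  "conj_exponent p x = inverse (1 - inverse (p x))"

lemma conj_exponent_eq:
  assumes "1 \<le> p x"
  shows "inverse (p x) + inverse (conj_exponent p x) = 1"
proof -
  have le: "inverse (p x) \<le> 1"
    using assms
    by (cases "p x") (auto simp: ennreal_1[symmetric] inverse_ennreal inverse_le_1_iff simp del: ennreal_1)
  have inv: "inverse (inverse a) = a" for a :: ennreal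
    by (cases a; cases "a = 0") (auto simp: inverse_ennreal ennreal_zero_less_top less_le)
  show ?thesis
    using le by (simp add: conj_exponent_def inv)
qed

text \<open>In the first summand the exponent is finite, so \<^const>\<open>enn2real\<close> is harmless. The second
  summand is the \<open>L\<^sup>\<infinity>\<close> norm over \<open>{p = \<infinity>}\<close>; for a \<open>[0,\<infinity>]\<close>-valued function this is the
  essential supremum of its extension by zero.\<close>
definition modular :: "('a::euclidean_space \<Rightarrow> ennreal) \<Rightarrow> ('a \<Rightarrow> ennreal) \<Rightarrow> real \<Rightarrow> ennreal" where
  "modular p f t =
     (\<integral>\<^sup>+x\<in>{x. p x \<noteq> \<infinity>}. ennpowr (f x / ennreal t) (enn2real (p x)) \<partial>lebesgue)
     + inverse (ennreal t) * esssup lebesgue (\<lambda>x. f x * indicator {x. p x = \<infinity>} x)"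

text \<open>The infimum of the empty set is \<open>\<infinity>\<close>, so this is finite exactly on the variable Lebesgue space.\<close>
definition var_norm :: "('a::euclidean_space \<Rightarrow> ennreal) \<Rightarrow> ('a \<Rightarrow> ennreal) \<Rightarrow> ennreal" where
  "var_norm p f = Inf {ennreal t | t. t > 0 \<and> modular p f t \<le> 1}"

text \<open>Since \<open>p_inf\<close> and the right-hand side of the decay condition are finite, an exponent satisfying
  it is finite everywhere; this is recorded explicitly because \<^const>\<open>enn2real\<close> would hide it.
  The local condition is void at \<open>x = y\<close>.\<close>
definition LH :: "('a::euclidean_space \<Rightarrow> ennreal) set" where
  "LH = {p \<in> exponents. (\<forall>x. p x \<noteq> \<infinity>) \<and>
     (\<exists>C_0>0. \<forall>x y. 0 < norm (x - y) \<and> norm (x - y) < 1/2 \<longrightarrow>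
        \<bar>enn2real (p x) - enn2real (p y)\<bar> \<le> C_0 / (- ln (norm (x - y)))) \<and>
     (\<exists>C_inf>0. \<exists>p_inf::real. \<forall>x. \<bar>enn2real (p x) - p_inf\<bar> \<le> C_inf / ln (exp 1 + norm x))}"

definition weights :: "('a::euclidean_space \<Rightarrow> ennreal) set" where
  "weights = borel_measurable lebesgue"

text \<open>The condition \<open>0 < w < \<infinity>\<close> a.e. follows from the finiteness of the supremum, except for
  \<open>w = 0\<close> a.e. and \<open>w = \<infinity>\<close> a.e., which would be admitted through \<open>0 \<cdot> \<infinity> = 0\<close>.\<close>
definition A2 :: "('a::euclidean_space \<Rightarrow> ennreal) set" where
  "A2 = {w \<in> weights. (AE x in lebesgue. 0 < w x \<and> w x < \<infinity>) \<and>
     (SUP (z, r)\<in>UNIV \<times> {0<..}.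
        ((\<integral>\<^sup>+x\<in>ball z r. w x \<partial>lebesgue) / emeasure lebesgue (ball z r)) *
        ((\<integral>\<^sup>+x\<in>ball z r. inverse (w x) \<partial>lebesgue) / emeasure lebesgue (ball z r))) < \<infinity>}"

text \<open>For a constant exponent \<open>r\<close> this is not the classical \<open>A\<^sub>r\<close>: \<open>w\<close> belongs to it iff \<open>w ^ r\<close>
  is in the classical class. It is meant for \<open>r \<in> exponents\<close> only.\<close>
definition A_var :: "('a::euclidean_space \<Rightarrow> ennreal) \<Rightarrow> ('a \<Rightarrow> ennreal) set" where
  "A_var r = {w \<in> weights. (AE x in lebesgue. 0 < w x \<and> w x < \<infinity>) \<and>
     (SUP (z, \<rho>)\<in>UNIV \<times> {0<..}.
        inverse (emeasure lebesgue (ball z \<rho>)) *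
        var_norm r (\<lambda>x. w x * indicator (ball z \<rho>) x) *
        var_norm (conj_exponent r) (\<lambda>x. inverse (w x) * indicator (ball z \<rho>) x)) < \<infinity>}"

text \<open>\<open>L f \<le> C R g\<close> for all pairs of the family with finite left-hand side, with \<open>C\<close> independent
  of the pair.\<close>
definition family_le ::
    "('b \<times> 'b) set \<Rightarrow> ('b \<Rightarrow> ennreal) \<Rightarrow> ('b \<Rightarrow> ennreal) \<Rightarrow> bool" where
  "family_le F L R \<longleftrightarrow> (\<exists>C::real. C > 0 \<and> (\<forall>(f, g)\<in>F. L f < \<infinity> \<longrightarrow> L f \<le> ennreal C * R g))"

end

theory Submission
  imports Defs
begin

text \<open>
  For a constant exponent \<open>p\<close>, if \<open>f w\<close> has norm one and \<open>\<Phi> = (f w) powr p\<close>, then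
  \<open>\<integral> f\<^sup>2 w\<^sup>2 \<Phi> powr (1 - 2 / p) = \<integral> \<Phi> = 1\<close>. The norm inequality thus is a weighted inequality with exponent
  two, for a weight that depends on the functions. This remains true for variable \<open>p\<close>: if \<open>\<Psi>\<close> is
  integrable and dominates \<open>(f w) powr p(x)\<close> and \<open>(g w) powr p(x)\<close>, where now \<open>g\<close> is normalised by
  its own norm, then \<open>f\<^sup>2 V\<close> and \<open>g\<^sup>2 V\<close> with \<open>V = w\<^sup>2 \<Psi> powr (1 - 2 / p(x))\<close> are dominated by \<open>\<Psi>\<close>, and
  the integral of \<open>(f w) powr p(x)\<close> is controlled by that of \<open>f\<^sup>2 V\<close> (\<open>powr_split\<close>). The hypothesis
  applies when \<open>V = W powr \<delta>\<close> with \<open>W = w powr (2 / \<delta>) * \<Psi> powr ((1 - 2 / p(x)) / \<delta>)\<close> in \<open>A\<^sub>2\<close>. The range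
  of \<open>p\<close> means precisely that the exponent of \<open>\<Psi>\<close> stays strictly between \<open>-1\<close> and \<open>1\<close>.

  To reach \<open>A\<^sub>2\<close>, take for \<open>\<Psi>\<close> an integrable majorant of the form \<open>u powr (1 / \<rho>)\<close> with \<open>u\<close> in \<open>A\<^sub>1\<close> and
  \<open>\<rho> < 1\<close> close to one. The Rubio de Francia algorithm provides it (\<open>A1_majorant\<close>), and it only
  involves the classical maximal theorem in \<open>L powr (1 / \<rho>)\<close>. The variable exponent enters
  in \<open>variable_power_A2\<close>: \<open>u powr b(x)\<close> is in \<open>A\<^sub>2\<close> for a log-Hoelder function \<open>b\<close>
  with \<open>|b| \<le> \<rho>\<close>. Indeed on a ball the exponent of the average of \<open>u\<close> may be frozen, because \<open>u\<close> is
  neither too large, being a power of an integrable function, nor too small, once a polynomial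
  tail has been added to the function that is majorised.

  The weight \<open>w\<close> is separated from \<open>u\<close> by Hoelder's inequality (\<open>A2_log_convex\<close>), since \<open>W\<close> is
  \<open>(w powr \<sigma>) powr (1 - \<rho>) * (u powr b(x)) powr \<rho>\<close> with \<open>\<sigma> = 2 / (\<delta> (1 - \<rho>))\<close>. So \<open>w powr \<sigma>\<close> only has
  to be in the classical \<open>A\<^sub>2\<close>. This \<open>\<sigma>\<close> belongs to \<open>p_* = 2 / (1 + \<delta> \<rho>)\<close>, and with \<open>c = 1 / \<sigma>\<close> the
  assumption on the weight reads \<open>w powr \<sigma>\<close> in \<open>A\<^sub>p\<close> for the variable exponent \<open>p\<close>, a class
  contained in \<open>A\<^sub>2\<close> by Hoelder's inequality and log-Hoelder continuity (\<open>A_var_imp_A2\<close>). The choice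
  \<open>w = 1\<close> gives the unweighted inequality.

  The constant in the hypothesis may depend on \<open>W\<close> in an arbitrary way, while the construction of \<open>W\<close>
  depends on the pair. Therefore \<open>limited_range_extrapolation\<close> argues by contradiction, with one weight
  for a whole sequence of pairs.
\<close>

section \<open>Powers and balls\<close>

lemma ennpowr_ennreal: "0 \<le> x \<Longrightarrow> ennpowr (ennreal x) a = ennreal (x powr a)"
  by (simp add: ennpowr_def)

lemma ennpowr_mono: "x \<le> y \<Longrightarrow> 0 \<le> a \<Longrightarrow> ennpowr x a \<le> ennpowr y a"
  by (cases x; cases y) (auto simp: ennpowr_def powr_mono2 ennreal_leI top_unique)

lemma ennpowr_measurable [measurable]:
  assumes [measurable]: "f \<in> borel_measurable M" "a \<in> borel_measurable M"
  shows "(\<lambda>x. ennpowr (f x) (a x)) \<in> borel_measurable M"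
  unfolding ennpowr_def by measurable

lemma mult_ennpowr: "0 < s \<Longrightarrow> x * ennpowr x s = ennpowr x (1 + s)"
  by (cases x) (auto simp: ennpowr_ennreal ennpowr_def powr_add ennreal_mult' ennreal_top_mult)

lemma ennpowr_cmult: "0 < c \<Longrightarrow> ennpowr (ennreal c * x) a = ennreal (c powr a) * ennpowr x a"
  by (cases x) (auto simp: ennpowr_def powr_mult ennreal_mult' ennreal_mult_top enn2real_mult ennreal_mult_eq_top_iff)

lemma term_le_suminf: "f k \<le> (\<Sum>k. f k :: ennreal)"
  using sum_le_suminf[OF summableI, of "{k}" f] by simp

text \<open>
  The type argument carries the dimension.
\<close>
abbreviation vol :: "'a::euclidean_space itself \<Rightarrow> real \<Rightarrow> real" where
  "vol _ r \<equiv> unit_ball_vol DIM('a) * r ^ DIM('a)"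

lemma vol_pos: "0 < r \<Longrightarrow> 0 < vol TYPE('a::euclidean_space) r"
  by simp

lemma emeasure_lebesgue_ball:
  fixes z :: "'a::euclidean_space"
  shows "0 \<le> r \<Longrightarrow> emeasure lebesgue (ball z r) = ennreal (vol TYPE('a) r)"
  by (simp add: emeasure_ball)

lemma open_sets_lebesgue: "open S \<Longrightarrow> S \<in> sets lebesgue"
  by (simp add: borel_open sets_completionI_sets)

lemma ball_sets_lebesgue [measurable]: "ball z r \<in> sets lebesgue" "Measurable.pred lebesgue (\<lambda>x. x \<in> ball z r)"
  by (simp_all add: open_sets_lebesgue pred_def)

lemma superlevel_sets_lebesgue:
  fixes f :: "'a::euclidean_space \<Rightarrow> ennreal"
  assumes "f \<in> borel_measurable lebesgue"
  shows "{x. t < f x} \<in> sets lebesgue"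
proof -
  note [measurable] = assms
  have "{x \<in> space lebesgue. t < f x} \<in> sets lebesgue" by measurable
  then show ?thesis by simp
qed

section \<open>The Hardy--Littlewood maximal operator\<close>

text \<open>
  The uncentred maximal function. Its superlevel sets are unions of balls, hence open, and it
  dominates the average over a ball at \<^emph>\<open>every\<close> point of the ball.
\<close>
definition hl_max :: "('a::euclidean_space \<Rightarrow> ennreal) \<Rightarrow> 'a \<Rightarrow> ennreal" where
  "hl_max f x = (SUP (z, r)\<in>{(z, r). 0 < r \<and> x \<in> ball z r}.
     (\<integral>\<^sup>+y\<in>ball z r. f y \<partial>lebesgue) / emeasure lebesgue (ball z r))"

lemma less_hl_max_iff:
  fixes f :: "'a::euclidean_space \<Rightarrow> ennreal"
  shows "t < hl_max f x \<longleftrightarrow> (\<exists>z r. 0 < r \<and> x \<in> ball z r \<and> t < (\<integral>\<^sup>+y\<in>ball z r. f y \<partial>lebesgue) / emeasure lebesgue (ball z r))"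
  unfolding hl_max_def less_SUP_iff by auto

lemma hl_max_superlevel:
  "{x. t < hl_max f x} = (\<Union>(z, r)\<in>{(z, r). 0 < r \<and> t < (\<integral>\<^sup>+y\<in>ball z r. f y \<partial>lebesgue) / emeasure lebesgue (ball z r)}. ball z r)"
  unfolding less_hl_max_iff by blast

lemma hl_max_borel: "hl_max f \<in> borel_measurable borel"
proof (rule borel_measurableI_greater)
  fix t
  have "open {x. t < hl_max f x}" unfolding hl_max_superlevel by auto
  then show "{x \<in> space borel. t < hl_max f x} \<in> sets borel" by simp
qed

lemma hl_max_measurable [measurable]: "hl_max f \<in> borel_measurable lebesgue"
  using hl_max_borel[of f] by (intro measurable_completion) simp

lemma ennreal_divide_times_self: "0 < v \<Longrightarrow> a / ennreal v * ennreal v = a"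
  by (simp add: ennreal_divide_times)

lemma set_integral_le_hl_max:
  fixes z :: "'a::euclidean_space"
  assumes "x \<in> ball z r"
  shows "(\<integral>\<^sup>+y\<in>ball z r. f y \<partial>lebesgue) \<le> hl_max f x * ennreal (vol TYPE('a) r)"
proof -
  have r: "0 < r" using assms by (metis mem_ball zero_le_dist le_less_trans)
  have "(\<integral>\<^sup>+y\<in>ball z r. f y \<partial>lebesgue) / emeasure lebesgue (ball z r) \<le> hl_max f x"
    unfolding hl_max_def by (rule SUP_upper2[of "(z, r)"]) (use assms r in auto)
  moreover have "emeasure lebesgue (ball z r) = ennreal (vol TYPE('a) r)"
    using r by (simp add: emeasure_ball)
  moreover have "0 < vol TYPE('a) r" using r by simp
  ultimately have "(\<integral>\<^sup>+y\<in>ball z r. f y \<partial>lebesgue) / ennreal (vol TYPE('a) r) * ennreal (vol TYPE('a) r)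
      \<le> hl_max f x * ennreal (vol TYPE('a) r)"
    by (simp add: mult_right_mono)
  then show ?thesis
    by (simp only: ennreal_divide_times_self[OF \<open>0 < vol TYPE('a) r\<close>])
qed

lemma hl_max_leI:
  assumes "\<And>z r. 0 < r \<Longrightarrow> x \<in> ball z r \<Longrightarrow> (\<integral>\<^sup>+y\<in>ball z r. f y \<partial>lebesgue) \<le> c * emeasure lebesgue (ball z r)"
  shows "hl_max f x \<le> c"
  unfolding hl_max_def
proof (rule SUP_least, clarsimp)
  fix z :: 'a and r :: real assume r: "0 < r" "dist z x < r"
  have "emeasure lebesgue (ball z r) = ennreal (vol TYPE('a) r)" "0 < vol TYPE('a) r"
    using r by (simp_all add: emeasure_ball)
  then show "(\<integral>\<^sup>+y\<in>ball z r. f y \<partial>lebesgue) / emeasure lborel (ball z r) \<le> c"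
    using assms[of r z] r by (simp add: divide_le_posI_ennreal mult.commute)
qed

text \<open>
  The weak type (1,1) bound: the superlevel set is covered by balls on which the average of \<open>f\<close>
  exceeds \<open>t\<close>, and Vitali's lemma extracts disjoint ones whose fivefold dilations still cover.
\<close>
lemma hl_weak_type:
  fixes f :: "'a::euclidean_space \<Rightarrow> ennreal"
  assumes f [measurable]: "f \<in> borel_measurable lebesgue" and t: "0 < t"
  shows "ennreal t * emeasure lebesgue {x. ennreal t < hl_max f x} \<le> 5 ^ DIM('a) * (\<integral>\<^sup>+x. f x \<partial>lebesgue)"
proof (cases "(\<integral>\<^sup>+x. f x \<partial>lebesgue) = \<infinity>")
  case True
  then show ?thesis by (simp add: ennreal_mult_top)
next
  case False
  then obtain I where I: "(\<integral>\<^sup>+x. f x \<partial>lebesgue) = ennreal I" "0 \<le> I"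
    by (cases "(\<integral>\<^sup>+x. f x \<partial>lebesgue)") auto
  let ?\<omega> = "unit_ball_vol (DIM('a))"
  define K where "K = {(z::'a, r). 0 < r \<and> ennreal t < (\<integral>\<^sup>+y\<in>ball z r. f y \<partial>lebesgue) / emeasure lebesgue (ball z r)}"
  have ball_meas: "emeasure lebesgue (ball z r) = ennreal (vol TYPE('a) r)" if "0 < r" for z :: 'a and r
    using that by (simp add: emeasure_ball)
  have K1: "ennreal t * ennreal (vol TYPE('a) r) \<le> (\<integral>\<^sup>+y\<in>ball z r. f y \<partial>lebesgue)" if "(z, r) \<in> K" for z r
  proof (rule ccontr)
    assume "\<not> ?thesis"
    then have "(\<integral>\<^sup>+y\<in>ball z r. f y \<partial>lebesgue) \<le> ennreal (vol TYPE('a) r) * ennreal t" by (simp add: mult.commute)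
    moreover have "0 < r" using that by (simp add: K_def)
    ultimately have "(\<integral>\<^sup>+y\<in>ball z r. f y \<partial>lebesgue) / emeasure lebesgue (ball z r) \<le> ennreal t"
      unfolding ball_meas[OF \<open>0 < r\<close>] by (intro divide_le_posI_ennreal) auto
    then show False using that by (auto simp: K_def)
  qed
  have bnd: "r \<le> 1 + I / (t * ?\<omega>)" if "(z, r) \<in> K" for z r
  proof -
    have r: "0 < r" using that by (simp add: K_def)
    have "ennreal (t * vol TYPE('a) r) \<le> (\<integral>\<^sup>+y\<in>ball z r. f y \<partial>lebesgue)"
      using K1[OF that] r t by (simp add: ennreal_mult')
    also have "\<dots> \<le> (\<integral>\<^sup>+x. f x \<partial>lebesgue)"
      by (intro nn_integral_mono) (auto simp: indicator_def)
    finally have "t * (?\<omega> * r ^ DIM('a)) \<le> I" using I by (simp add: ennreal_le_iff)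
    then have le: "r ^ DIM('a) \<le> I / (t * ?\<omega>)" using t by (simp add: field_simps)
    show ?thesis
    proof (cases "r \<le> 1")
      case True then show ?thesis using I t by (smt (verit) divide_nonneg_pos mult_pos_pos unit_ball_vol_pos of_nat_0_le_iff)
    next
      case False
      then have "r \<le> r ^ DIM('a)" using DIM_positive by (intro self_le_power) auto
      then show ?thesis using le by linarith
    qed
  qed
  obtain C where C: "countable C" "C \<subseteq> K"
     "pairwise (\<lambda>i j. disjnt (ball (fst i) (snd i)) (ball (fst j) (snd j))) C"
     "{x. ennreal t < hl_max f x} \<subseteq> (\<Union>i\<in>C. ball (fst i) (5 * snd i))"
  proof (rule Vitali_covering_lemma_balls[where S = "{x. ennreal t < hl_max f x}" and K = K and a = fst and r = snd and B = "1 + I / (t * ?\<omega>)"])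
    show "{x. ennreal t < hl_max f x} \<subseteq> (\<Union>i\<in>K. ball (fst i) (snd i))"
      unfolding hl_max_superlevel K_def by fastforce
  next
    fix i assume "i \<in> K"
    then show "0 < snd i \<and> snd i \<le> 1 + I / (t * ?\<omega>)"
      using bnd[of "fst i" "snd i"] by (auto simp: K_def)
  qed auto
  have pos: "0 < snd i" if "i \<in> C" for i using that C(2) by (auto simp: K_def)
  have disj: "disjoint_family_on (\<lambda>i. ball (fst i) (snd i)) C"
    using C(3) by (auto simp: disjoint_family_on_def pairwise_def disjnt_def)
  have "emeasure lebesgue {x. ennreal t < hl_max f x} \<le> emeasure lebesgue (\<Union>i\<in>C. ball (fst i) (5 * snd i))"
    by (rule emeasure_mono[OF C(4)]) (intro open_sets_lebesgue open_UN ballI open_ball)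
  also have "\<dots> = (\<integral>\<^sup>+x. indicator (\<Union>i\<in>C. ball (fst i) (5 * snd i)) x \<partial>lebesgue)"
    by (rule nn_integral_indicator[symmetric]) (intro open_sets_lebesgue open_UN ballI open_ball)
  also have "\<dots> \<le> (\<integral>\<^sup>+x. (\<integral>\<^sup>+i. indicator (ball (fst i) (5 * snd i)) x \<partial>count_space C) \<partial>lebesgue)"
  proof (rule nn_integral_mono)
    fix x :: 'a
    show "indicator (\<Union>i\<in>C. ball (fst i) (5 * snd i)) x \<le> (\<integral>\<^sup>+i. indicator (ball (fst i) (5 * snd i)) x \<partial>count_space C)"
    proof (cases "\<exists>i\<in>C. x \<in> ball (fst i) (5 * snd i)")
      case True
      then obtain i where i: "i \<in> C" "x \<in> ball (fst i) (5 * snd i)" by blast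
      have "(1::ennreal) = indicator (ball (fst i) (5 * snd i)) x" using i by simp
      also have "\<dots> \<le> (\<integral>\<^sup>+i. indicator (ball (fst i) (5 * snd i)) x \<partial>count_space C)"
        using nn_integral_ge_point[OF i(1), of "\<lambda>i. indicator (ball (fst i) (5 * snd i)) x"] by simp
      finally show ?thesis using i by (auto simp: indicator_def)
    qed (auto simp: indicator_def)
  qed
  also have "\<dots> = (\<integral>\<^sup>+i. (\<integral>\<^sup>+x. indicator (ball (fst i) (5 * snd i)) x \<partial>lebesgue) \<partial>count_space C)"
    by (rule nn_integral_count_space_nn_integral) (use C in auto)
  also have "\<dots> = (\<integral>\<^sup>+i. 5 ^ DIM('a) * ennreal (vol TYPE('a) (snd i)) \<partial>count_space C)"
  proof (rule nn_integral_cong)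
    fix i assume "i \<in> space (count_space C)"
    then have p: "0 < snd i" using pos by simp
    have "(\<integral>\<^sup>+x. indicator (ball (fst i) (5 * snd i)) x \<partial>lebesgue) = emeasure lebesgue (ball (fst i) (5 * snd i))"
      by (rule nn_integral_indicator) auto
    also have "\<dots> = ennreal (5 ^ DIM('a) * vol TYPE('a) (snd i))"
      using p by (subst ball_meas) (auto simp: power_mult_distrib mult_ac)
    also have "\<dots> = 5 ^ DIM('a) * ennreal (vol TYPE('a) (snd i))"
      by (subst ennreal_mult') (auto simp: ennreal_power[symmetric])
    finally show "(\<integral>\<^sup>+x. indicator (ball (fst i) (5 * snd i)) x \<partial>lebesgue) = 5 ^ DIM('a) * ennreal (vol TYPE('a) (snd i))" .
  qed
  finally have 1: "emeasure lebesgue {x. ennreal t < hl_max f x} \<le> 5 ^ DIM('a) * (\<integral>\<^sup>+i. ennreal (vol TYPE('a) (snd i)) \<partial>count_space C)"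
    by (simp add: nn_integral_cmult)
  have "ennreal t * (\<integral>\<^sup>+i. ennreal (vol TYPE('a) (snd i)) \<partial>count_space C)
      = (\<integral>\<^sup>+i. ennreal t * ennreal (vol TYPE('a) (snd i)) \<partial>count_space C)"
    by (simp add: nn_integral_cmult)
  also have "\<dots> \<le> (\<integral>\<^sup>+i. emeasure (density lebesgue f) (ball (fst i) (snd i)) \<partial>count_space C)"
    by (intro nn_integral_mono) (use K1 C(2) in \<open>auto simp: emeasure_density\<close>)
  also have "\<dots> = emeasure (density lebesgue f) (\<Union>i\<in>C. ball (fst i) (snd i))"
    by (rule emeasure_UN_countable[symmetric]) (use C disj in auto)
  also have "\<dots> \<le> emeasure (density lebesgue f) (space (density lebesgue f))"
    by (rule emeasure_space)
  also have "\<dots> = (\<integral>\<^sup>+x. f x \<partial>lebesgue)" by (simp add: emeasure_density)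
  finally have 2: "ennreal t * (\<integral>\<^sup>+i. ennreal (vol TYPE('a) (snd i)) \<partial>count_space C) \<le> (\<integral>\<^sup>+x. f x \<partial>lebesgue)" .
  have "ennreal t * emeasure lebesgue {x. ennreal t < hl_max f x}
      \<le> ennreal t * (5 ^ DIM('a) * (\<integral>\<^sup>+i. ennreal (vol TYPE('a) (snd i)) \<partial>count_space C))"
    by (rule mult_left_mono[OF 1]) simp
  also have "\<dots> = 5 ^ DIM('a) * (ennreal t * (\<integral>\<^sup>+i. ennreal (vol TYPE('a) (snd i)) \<partial>count_space C))"
    by (simp add: mult_ac)
  also have "\<dots> \<le> 5 ^ DIM('a) * (\<integral>\<^sup>+x. f x \<partial>lebesgue)"
    by (rule mult_left_mono[OF 2]) simp
  finally show ?thesis .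
qed

text \<open>
  Two dyadic versions of the layer cake formula. They turn the weak type bound, used
  at the levels \<open>2 powr k\<close>, into a strong one.
\<close>
lemma dyadic_upper:
  assumes q: "0 < q"
  shows "ennpowr x q \<le> (\<integral>\<^sup>+k. ennreal (2 powr ((of_int k + 1) * q)) * indicator {ennreal (2 powr of_int k)<..} x \<partial>count_space (UNIV::int set))"
    (is "_ \<le> (\<integral>\<^sup>+k. ?g k \<partial>_)")
proof (cases x)
  case (real r)
  show ?thesis
  proof (cases "r = 0")
    case True then show ?thesis using real by (simp add: ennpowr_def)
  next
    case False
    then have r: "0 < r" using real by simp
    define k where "k = \<lceil>log 2 r\<rceil> - 1"
    have k: "of_int k < log 2 r" "log 2 r \<le> of_int k + 1" unfolding k_def by linarith+
    have "2 powr of_int k < r" using k r by (simp add: less_log_iff)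
    have "r \<le> 2 powr (of_int k + 1)" using k r by (simp add: log_le_iff)
    then have "r powr q \<le> (2 powr (of_int k + 1)) powr q" using r q by (intro powr_mono2) auto
    then have "ennpowr x q \<le> ?g k"
      using real \<open>2 powr of_int k < r\<close> by (auto simp: ennpowr_ennreal powr_powr ennreal_less_iff intro!: ennreal_leI)
    also have "\<dots> \<le> (\<integral>\<^sup>+k. ?g k \<partial>count_space UNIV)" by (rule nn_integral_ge_point) simp
    finally show ?thesis .
  qed
next
  case top
  have "of_nat n \<le> (\<integral>\<^sup>+k. ?g k \<partial>count_space UNIV)" for n
  proof -
    define k :: int where "k = \<lceil>log 2 (real n + 1) / q\<rceil>"
    have "log 2 (real n + 1) \<le> (of_int k + 1) * q"
      using q unfolding k_def by (metis add.commute add_increasing ceiling_correct mult.commute pos_divide_le_eq zero_le_one)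
    then have "real n + 1 \<le> 2 powr ((of_int k + 1) * q)" by (simp add: log_le_iff)
    then have "of_nat n \<le> ?g k" using top by (auto simp: ennreal_of_nat_eq_real_of_nat intro!: ennreal_leI)
    also have "\<dots> \<le> (\<integral>\<^sup>+k. ?g k \<partial>count_space UNIV)" by (rule nn_integral_ge_point) simp
    finally show ?thesis .
  qed
  then have "(\<integral>\<^sup>+k. ?g k \<partial>count_space UNIV) = top"
    by (subst top_unique[symmetric], subst ennreal_SUP_of_nat_eq_top[symmetric]) (intro SUP_least)
  then show ?thesis by simp
qed

lemma dyadic_lower:
  assumes s: "0 < s"
  shows "(\<integral>\<^sup>+k. ennreal (2 powr (of_int k * s)) * indicator {ennreal (2 powr (of_int k - 1))<..} x \<partial>count_space (UNIV::int set))
     \<le> ennreal (2 powr s / (1 - 2 powr - s)) * ennpowr x s"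
    (is "(\<integral>\<^sup>+k. ?g k \<partial>_) \<le> _")
proof -
  have lt: "2 powr - s < 1" using s by (simp add: powr_less_one)
  show ?thesis
  proof (cases x)
    case top
    have "0 < 2 powr s / (1 - 2 powr - s)" using lt by simp
    then show ?thesis using top s by (simp add: ennpowr_def ennreal_mult_top)
  next
    case (real r)
    show ?thesis
    proof (cases "r = 0")
      case True then show ?thesis using real by simp
    next
      case False
      then have r: "0 < r" using real by simp
      define K where "K = \<lceil>log 2 r\<rceil>"
      have K: "2 powr of_int K \<le> 2 * r"
      proof -
        have "of_int K \<le> log 2 r + 1" unfolding K_def by linarith
        then have "2 powr of_int K \<le> 2 powr (log 2 r + 1)" by simp
        also have "\<dots> = 2 * r" using r by (simp add: powr_add)
        finally show ?thesis .
      qed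
      have inj: "bij_betw (\<lambda>j::nat. K - int j) UNIV {..K}"
        by (rule bij_betwI[where g = "\<lambda>k. nat (K - k)"]) auto
      have "(\<integral>\<^sup>+k. ?g k \<partial>count_space UNIV) \<le> (\<integral>\<^sup>+k. ennreal (2 powr (of_int k * s)) * indicator {..K} k \<partial>count_space UNIV)"
      proof (intro nn_integral_mono mult_left_mono)
        fix k :: int
        show "indicator {ennreal (2 powr (of_int k - 1))<..} x \<le> (indicator {..K} k :: ennreal)"
        proof (cases "ennreal (2 powr (of_int k - 1)) < x")
          case True
          then have "2 powr (of_int k - 1) < r" using real by (simp add: ennreal_less_iff)
          then have "of_int k - 1 < log 2 r" using r by (simp add: less_log_iff)
          then have "k \<le> K" unfolding K_def by linarith
          then show ?thesis by (simp add: indicator_def)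
        qed auto
      qed simp
      also have "\<dots> = (\<integral>\<^sup>+k. ennreal (2 powr (of_int k * s)) \<partial>count_space {..K})"
        by (simp add: nn_integral_count_space_indicator)
      also have "\<dots> = (\<integral>\<^sup>+j. ennreal (2 powr (of_int (K - int j) * s)) \<partial>count_space UNIV)"
        by (rule nn_integral_bij_count_space[OF inj, symmetric])
      also have "\<dots> = (\<Sum>j. ennreal (2 powr (of_int K * s) * (2 powr - s) ^ j))"
        unfolding nn_integral_count_space_nat
        by (intro suminf_cong arg_cong[where f=ennreal]) (simp add: powr_realpow[symmetric] powr_powr powr_add[symmetric] algebra_simps)
      also have "\<dots> = ennreal (2 powr (of_int K * s) * (1 / (1 - 2 powr - s)))"
        using lt by (intro suminf_ennreal_eq sums_mult geometric_sums) auto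
      also have "\<dots> \<le> ennreal (2 powr s / (1 - 2 powr - s) * r powr s)"
      proof (rule ennreal_leI)
        have "2 powr (of_int K * s) = (2 powr of_int K) powr s" by (simp add: powr_powr)
        also have "\<dots> \<le> (2 * r) powr s" using K s by (intro powr_mono2) auto
        also have "\<dots> = 2 powr s * r powr s" using r by (simp add: powr_mult)
        finally show "2 powr (of_int K * s) * (1 / (1 - 2 powr - s)) \<le> 2 powr s / (1 - 2 powr - s) * r powr s"
          using lt by (simp add: divide_right_mono)
      qed
      also have "\<dots> = ennreal (2 powr s / (1 - 2 powr - s)) * ennpowr x s"
        using real lt by (simp only: ennpowr_ennreal) (rule ennreal_mult', simp)
      finally show ?thesis .
    qed
  qed
qed

text \<open>
  Values of \<open>f\<close> up to \<open>t\<close> contribute at most \<open>t\<close> to every average. The weak type bound therefore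
  only sees the part of \<open>f\<close> that exceeds half the level.
\<close>
lemma hl_max_truncate:
  fixes f :: "'a::euclidean_space \<Rightarrow> ennreal"
  assumes f [measurable]: "f \<in> borel_measurable lebesgue"
  shows "hl_max f x \<le> t + hl_max (\<lambda>y. f y * indicator {t<..} (f y)) x"
proof (rule hl_max_leI)
  fix z :: 'a and r :: real assume r: "0 < r" "x \<in> ball z r"
  have "(\<integral>\<^sup>+y\<in>ball z r. f y \<partial>lebesgue)
      \<le> (\<integral>\<^sup>+y. t * indicator (ball z r) y + f y * indicator {t<..} (f y) * indicator (ball z r) y \<partial>lebesgue)"
    by (intro nn_integral_mono) (auto simp: indicator_def)
  also have "\<dots> = (\<integral>\<^sup>+y. t * indicator (ball z r) y \<partial>lebesgue)
      + (\<integral>\<^sup>+y\<in>ball z r. f y * indicator {t<..} (f y) \<partial>lebesgue)"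
    by (rule nn_integral_add) measurable
  also have "(\<integral>\<^sup>+y. t * indicator (ball z r) y \<partial>lebesgue) = t * emeasure lebesgue (ball z r)"
    by (rule nn_integral_cmult_indicator) measurable
  also have "t * emeasure lebesgue (ball z r) + (\<integral>\<^sup>+y\<in>ball z r. f y * indicator {t<..} (f y) \<partial>lebesgue)
     \<le> t * emeasure lebesgue (ball z r)
     + hl_max (\<lambda>y. f y * indicator {t<..} (f y)) x * emeasure lebesgue (ball z r)"
    using set_integral_le_hl_max[OF r(2), of "\<lambda>y. f y * indicator {t<..} (f y)"] r
    by (intro add_left_mono) (simp add: emeasure_ball)
  finally show "(\<integral>\<^sup>+y\<in>ball z r. f y \<partial>lebesgue)
     \<le> (t + hl_max (\<lambda>y. f y * indicator {t<..} (f y)) x) * emeasure lebesgue (ball z r)"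
    by (simp add: ring_distribs)
qed

lemma hl_weak_type_truncated:
  fixes f :: "'a::euclidean_space \<Rightarrow> ennreal"
  assumes f [measurable]: "f \<in> borel_measurable lebesgue" and t: "0 < t"
  shows "ennreal t * emeasure lebesgue {x. ennreal t < hl_max f x}
     \<le> 2 * 5 ^ DIM('a) * (\<integral>\<^sup>+x. f x * indicator {ennreal (t / 2)<..} (f x) \<partial>lebesgue)"
proof -
  let ?g = "\<lambda>x. f x * indicator {ennreal (t / 2)<..} (f x)"
  have "{x. ennreal t < hl_max f x} \<subseteq> {x. ennreal (t / 2) < hl_max ?g x}"
  proof safe
    fix x assume "ennreal t < hl_max f x"
    also have "\<dots> \<le> ennreal (t / 2) + hl_max ?g x" by (rule hl_max_truncate) simp
    finally have "ennreal (t / 2) + ennreal (t / 2) < ennreal (t / 2) + hl_max ?g x"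
      using t by (simp flip: ennreal_plus)
    then show "ennreal (t / 2) < hl_max ?g x" by (simp add: ennreal_add_left_cancel_less)
  qed
  note sub = this
  have e2: "ennreal t = 2 * ennreal (t / 2)"
    using ennreal_mult'[of 2 "t / 2"] by simp
  from sub have "ennreal t * emeasure lebesgue {x. ennreal t < hl_max f x}
     \<le> ennreal t * emeasure lebesgue {x. ennreal (t / 2) < hl_max ?g x}"
    by (intro mult_left_mono emeasure_mono superlevel_sets_lebesgue hl_max_measurable) auto
  also have "\<dots> = 2 * (ennreal (t / 2) * emeasure lebesgue {x. ennreal (t / 2) < hl_max ?g x})"
    by (simp only: e2 mult.assoc)
  also have "\<dots> \<le> 2 * (5 ^ DIM('a) * (\<integral>\<^sup>+x. ?g x \<partial>lebesgue))"
    by (intro mult_left_mono hl_weak_type) (use t in auto)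
  finally show ?thesis by (simp add: mult.assoc)
qed

text \<open>
  Marcinkiewicz interpolation between the weak type bound and the trivial bound in \<open>L\<^sup>\<infinity>\<close>, summed
  over dyadic levels. The geometric series converges because \<open>q > 1\<close>.
\<close>
theorem hl_strong_type:
  assumes q: "1 < q"
  obtains N :: real where "0 < N"
    "\<And>f :: 'a::euclidean_space \<Rightarrow> ennreal. f \<in> borel_measurable lebesgue \<Longrightarrow>
      (\<integral>\<^sup>+x. ennpowr (hl_max f x) q \<partial>lebesgue) \<le> ennreal N * (\<integral>\<^sup>+x. ennpowr (f x) q \<partial>lebesgue)"
proof
  define s where "s = q - 1"
  have s: "0 < s" using q by (simp add: s_def)
  have lt: "2 powr - s < 1" using s by (simp add: powr_less_one)
  let ?c = "2 powr s / (1 - 2 powr - s)" and ?d = "2 powr q * (2 * 5 ^ DIM('a)) :: real"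
  show "0 < ?d * ?c" using lt by simp
  fix f :: "'a \<Rightarrow> ennreal"
  assume f [measurable]: "f \<in> borel_measurable lebesgue"
  have "(\<integral>\<^sup>+x. ennpowr (hl_max f x) q \<partial>lebesgue) \<le>
     (\<integral>\<^sup>+x. (\<integral>\<^sup>+k. ennreal (2 powr ((of_int k + 1) * q)) * indicator {ennreal (2 powr of_int k)<..} (hl_max f x) \<partial>count_space (UNIV::int set)) \<partial>lebesgue)"
    using q by (intro nn_integral_mono dyadic_upper) simp
  also have "\<dots> = (\<integral>\<^sup>+k. (\<integral>\<^sup>+x. ennreal (2 powr ((of_int k + 1) * q)) * indicator {ennreal (2 powr of_int k)<..} (hl_max f x) \<partial>lebesgue) \<partial>count_space (UNIV::int set))"
    by (rule nn_integral_count_space_nn_integral) auto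
  also have "\<dots> = (\<integral>\<^sup>+k. ennreal (2 powr ((of_int k + 1) * q)) * emeasure lebesgue {x. ennreal (2 powr of_int k) < hl_max f x} \<partial>count_space (UNIV::int set))"
  proof (rule nn_integral_cong)
    fix k :: int
    have "indicator {ennreal (2 powr of_int k)<..} (hl_max f x) = (indicator {x. ennreal (2 powr of_int k) < hl_max f x} x :: ennreal)" for x
      by (simp add: indicator_def)
    then show "(\<integral>\<^sup>+x. ennreal (2 powr ((of_int k + 1) * q)) * indicator {ennreal (2 powr of_int k)<..} (hl_max f x) \<partial>lebesgue)
      = ennreal (2 powr ((of_int k + 1) * q)) * emeasure lebesgue {x. ennreal (2 powr of_int k) < hl_max f x}"
      by (simp only:) (intro nn_integral_cmult_indicator superlevel_sets_lebesgue hl_max_measurable)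
  qed
  also have "\<dots> \<le> (\<integral>\<^sup>+k. ennreal (?d * 2 powr (of_int k * s)) * (\<integral>\<^sup>+x. f x * indicator {ennreal (2 powr (of_int k - 1))<..} (f x) \<partial>lebesgue) \<partial>count_space (UNIV::int set))"
  proof (rule nn_integral_mono)
    fix k :: int
    have "2 powr ((of_int k + 1) * q) = (2 powr q * 2 powr (of_int k * s)) * 2 powr of_int k"
    proof -
      have "(of_int k + 1) * q = q + of_int k * s + of_int k" by (simp add: s_def algebra_simps)
      then show ?thesis by (simp only: powr_add)
    qed
    then have "ennreal (2 powr ((of_int k + 1) * q)) * emeasure lebesgue {x. ennreal (2 powr of_int k) < hl_max f x}
      = ennreal (2 powr q * 2 powr (of_int k * s)) * (ennreal (2 powr of_int k) * emeasure lebesgue {x. ennreal (2 powr of_int k) < hl_max f x})"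
      by (simp only: ennreal_mult'[OF powr_ge_zero] mult.assoc)
    also have "\<dots> \<le> ennreal (2 powr q * 2 powr (of_int k * s)) *
        (2 * 5 ^ DIM('a) * (\<integral>\<^sup>+x. f x * indicator {ennreal (2 powr of_int k / 2)<..} (f x) \<partial>lebesgue))"
      by (intro mult_left_mono hl_weak_type_truncated) auto
    also have "2 powr of_int k / 2 = (2::real) powr (of_int k - 1)" by (simp add: powr_diff)
    also have "ennreal (2 powr q * 2 powr (of_int k * s)) *
        (2 * 5 ^ DIM('a) * (\<integral>\<^sup>+x. f x * indicator {ennreal (2 powr (of_int k - 1))<..} (f x) \<partial>lebesgue))
      = ennreal (2 powr q * 2 powr (of_int k * s)) * ennreal (2 * 5 ^ DIM('a)) * (\<integral>\<^sup>+x. f x * indicator {ennreal (2 powr (of_int k - 1))<..} (f x) \<partial>lebesgue)"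
      by (simp add: ennreal_mult' mult.assoc flip: ennreal_power)
    also have "ennreal (2 powr q * 2 powr (of_int k * s)) * ennreal (2 * 5 ^ DIM('a)) = ennreal (?d * 2 powr (of_int k * s))"
      by (subst ennreal_mult'[symmetric]) (simp_all add: mult_ac)
    finally show "ennreal (2 powr ((of_int k + 1) * q)) * emeasure lebesgue {x. ennreal (2 powr of_int k) < hl_max f x}
      \<le> ennreal (?d * 2 powr (of_int k * s)) * (\<integral>\<^sup>+x. f x * indicator {ennreal (2 powr (of_int k - 1))<..} (f x) \<partial>lebesgue)" .
  qed
  also have "\<dots> = (\<integral>\<^sup>+k. (\<integral>\<^sup>+x. ennreal (?d * 2 powr (of_int k * s)) * (f x * indicator {ennreal (2 powr (of_int k - 1))<..} (f x)) \<partial>lebesgue) \<partial>count_space (UNIV::int set))"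
    by (intro nn_integral_cong nn_integral_cmult[symmetric]) auto
  also have "\<dots> = (\<integral>\<^sup>+x. (\<integral>\<^sup>+k. ennreal (?d * 2 powr (of_int k * s)) * (f x * indicator {ennreal (2 powr (of_int k - 1))<..} (f x)) \<partial>count_space (UNIV::int set)) \<partial>lebesgue)"
    by (rule nn_integral_count_space_nn_integral[symmetric]) auto
  also have "\<dots> = (\<integral>\<^sup>+x. ennreal ?d * f x * (\<integral>\<^sup>+k. ennreal (2 powr (of_int k * s)) * indicator {ennreal (2 powr (of_int k - 1))<..} (f x) \<partial>count_space (UNIV::int set)) \<partial>lebesgue)"
  proof (rule nn_integral_cong)
    fix x :: 'a
    have "ennreal (?d * 2 powr (of_int k * s)) * (f x * indicator {ennreal (2 powr (of_int k - 1))<..} (f x))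
       = ennreal ?d * f x * (ennreal (2 powr (of_int k * s)) * indicator {ennreal (2 powr (of_int k - 1))<..} (f x))" for k :: int
      by (subst ennreal_mult') (simp_all add: mult_ac)
    then show "(\<integral>\<^sup>+k. ennreal (?d * 2 powr (of_int k * s)) * (f x * indicator {ennreal (2 powr (of_int k - 1))<..} (f x)) \<partial>count_space (UNIV::int set))
      = ennreal ?d * f x * (\<integral>\<^sup>+k. ennreal (2 powr (of_int k * s)) * indicator {ennreal (2 powr (of_int k - 1))<..} (f x) \<partial>count_space (UNIV::int set))"
      by (simp only:) (rule nn_integral_cmult, simp)
  qed
  also have "\<dots> \<le> (\<integral>\<^sup>+x. ennreal ?d * f x * (ennreal ?c * ennpowr (f x) s) \<partial>lebesgue)"
    by (intro nn_integral_mono mult_left_mono dyadic_lower s) simp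
  also have "\<dots> = (\<integral>\<^sup>+x. ennreal (?d * ?c) * ennpowr (f x) q \<partial>lebesgue)"
  proof (rule nn_integral_cong)
    fix x
    have "ennpowr (f x) q = f x * ennpowr (f x) s" using mult_ennpowr[OF s, of "f x"] by (simp add: s_def)
    then show "ennreal ?d * f x * (ennreal ?c * ennpowr (f x) s) = ennreal (?d * ?c) * ennpowr (f x) q"
      by (subst ennreal_mult') (auto simp: mult_ac)
  qed
  also have "\<dots> = ennreal (?d * ?c) * (\<integral>\<^sup>+x. ennpowr (f x) q \<partial>lebesgue)"
    by (rule nn_integral_cmult) auto
  finally show "(\<integral>\<^sup>+x. ennpowr (hl_max f x) q \<partial>lebesgue) \<le> ennreal (?d * ?c) * (\<integral>\<^sup>+x. ennpowr (f x) q \<partial>lebesgue)" .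
qed

section \<open>Majorants in the Muckenhoupt class of index one\<close>

lemma ennpowr_ennpowr: "0 < b \<Longrightarrow> ennpowr (ennpowr x a) b = ennpowr x (a * b)"
  by (cases x) (auto simp: ennpowr_def powr_powr)

lemma ennpowr_1 [simp]: "ennpowr x 1 = x"
  by (cases x) (auto simp: ennpowr_def)

lemma suminf_half_powers: "(\<Sum>k. ennreal ((1 / 2) ^ k) * s) = 2 * s"
proof -
  have "(\<Sum>k. ennreal ((1 / 2) ^ k)) = ennreal (1 / (1 - 1 / 2))"
    using geometric_sums[of "1 / 2 :: real"] by (intro suminf_ennreal_eq) auto
  then show ?thesis by simp
qed

text \<open>
  The Rubio de Francia algorithm. With \<open>\<phi> = \<Phi> powr \<rho>\<close> and \<open>q = 1 / \<rho>\<close>, put \<open>u = \<Sum>k. M^k \<phi> / (2 D)^k\<close>, where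
  \<open>D\<close> exceeds the norm of the maximal operator \<open>M\<close> on \<open>L^q\<close>. The term \<open>k = 0\<close> gives the majorant
  property, the series converges in \<open>L^q\<close>, and applying \<open>M\<close> shifts the series, so that
  \<open>M u \<le> 2 D u\<close>, which is the \<open>A\<^sub>1\<close> condition.
\<close>
theorem A1_majorant:
  fixes \<Phi> :: "'a::euclidean_space \<Rightarrow> ennreal"
  assumes \<rho>: "0 < \<rho>" "\<rho> < 1"
    and \<Phi> [measurable]: "\<Phi> \<in> borel_measurable lebesgue" and fin: "(\<integral>\<^sup>+x. \<Phi> x \<partial>lebesgue) < \<infinity>"
  obtains u :: "'a \<Rightarrow> ennreal" and N :: real
  where "u \<in> borel_measurable lebesgue" "0 < N"
    "(\<integral>\<^sup>+x. ennpowr (u x) (1 / \<rho>) \<partial>lebesgue) < \<infinity>"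
    "\<And>x. ennpowr (\<Phi> x) \<rho> \<le> u x"
    "\<And>z r x. x \<in> ball z r \<Longrightarrow> (\<integral>\<^sup>+y\<in>ball z r. u y \<partial>lebesgue) \<le> ennreal (N * vol TYPE('a) r) * u x"
proof -
  define q where "q = 1 / \<rho>"
  have q: "1 < q" using \<rho> by (simp add: q_def)
  obtain N1 :: real where N1: "0 < N1" and strong:
    "\<And>f :: 'a \<Rightarrow> ennreal. f \<in> borel_measurable lebesgue \<Longrightarrow>
      (\<integral>\<^sup>+x. ennpowr (hl_max f x) q \<partial>lebesgue) \<le> ennreal N1 * (\<integral>\<^sup>+x. ennpowr (f x) q \<partial>lebesgue)"
    using hl_strong_type[OF q] by metis
  define D where "D = (2 * N1) powr \<rho>"
  have D: "0 < D" using N1 by (simp add: D_def)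
  have Dq: "D powr q = 2 * N1" using N1 \<rho> by (simp add: D_def q_def powr_powr)
  define a where "a k = (hl_max ^^ k) (\<lambda>x. ennpowr (\<Phi> x) \<rho>)" for k
  have a_Suc: "a (Suc k) = hl_max (a k)" for k by (simp add: a_def)
  have a_meas [measurable]: "a k \<in> borel_measurable lebesgue" for k
    by (cases k) (auto simp: a_Suc, simp add: a_def)
  define b where "b k x = ennreal ((1 / D) ^ k) * a k x" for k x
  have b_meas [measurable]: "b k \<in> borel_measurable lebesgue" for k unfolding b_def by measurable
  define u where "u x = (\<Sum>k. ennreal ((1 / 2) ^ k) * b k x)" for x
  have u_meas [measurable]: "u \<in> borel_measurable lebesgue" unfolding u_def by measurable
  have int_a: "(\<integral>\<^sup>+x. ennpowr (a k x) q \<partial>lebesgue) \<le> ennreal (N1 ^ k) * (\<integral>\<^sup>+x. \<Phi> x \<partial>lebesgue)" for k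
  proof (induction k)
    case 0
    then show ?case using \<rho> by (simp add: a_def ennpowr_ennpowr q_def)
  next
    case (Suc k)
    have "(\<integral>\<^sup>+x. ennpowr (a (Suc k) x) q \<partial>lebesgue) \<le> ennreal N1 * (\<integral>\<^sup>+x. ennpowr (a k x) q \<partial>lebesgue)"
      unfolding a_Suc by (rule strong) measurable
    also have "\<dots> \<le> ennreal N1 * (ennreal (N1 ^ k) * (\<integral>\<^sup>+x. \<Phi> x \<partial>lebesgue))"
      by (rule mult_left_mono[OF Suc]) simp
    also have "\<dots> = ennreal (N1 ^ Suc k) * (\<integral>\<^sup>+x. \<Phi> x \<partial>lebesgue)"
      using N1 by (simp add: ennreal_mult' mult.assoc)
    finally show ?case .
  qed
  have int_b: "(\<integral>\<^sup>+x. ennpowr (b k x) q \<partial>lebesgue) \<le> ennreal ((1 / 2) ^ k) * (\<integral>\<^sup>+x. \<Phi> x \<partial>lebesgue)" for k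
  proof -
    have Dk: "((1 / D) ^ k) powr q = (1 / (2 * N1)) ^ k"
    proof -
      have "((1 / D) ^ k) powr q = ((1 / D) powr q) ^ k"
        using D by (simp add: powr_realpow[symmetric] powr_powr mult.commute)
      also have "(1 / D) powr q = 1 / (2 * N1)" using D Dq by (simp add: powr_divide)
      finally show ?thesis .
    qed
    have "(\<integral>\<^sup>+x. ennpowr (b k x) q \<partial>lebesgue) = (\<integral>\<^sup>+x. ennreal ((1 / (2 * N1)) ^ k) * ennpowr (a k x) q \<partial>lebesgue)"
      unfolding b_def using D by (intro nn_integral_cong) (subst ennpowr_cmult, auto simp: Dk)
    also have "\<dots> = ennreal ((1 / (2 * N1)) ^ k) * (\<integral>\<^sup>+x. ennpowr (a k x) q \<partial>lebesgue)"
      by (rule nn_integral_cmult) measurable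
    also have "\<dots> \<le> ennreal ((1 / (2 * N1)) ^ k) * (ennreal (N1 ^ k) * (\<integral>\<^sup>+x. \<Phi> x \<partial>lebesgue))"
      by (rule mult_left_mono[OF int_a]) simp
    also have "\<dots> = ennreal ((1 / 2) ^ k) * (\<integral>\<^sup>+x. \<Phi> x \<partial>lebesgue)"
    proof -
      have "(1 / (2 * N1)) ^ k * N1 ^ k = (1 / 2) ^ k" using N1 by (simp add: power_mult_distrib[symmetric])
      then show ?thesis using N1 by (simp add: mult.assoc[symmetric] ennreal_mult'[symmetric])
    qed
    finally show ?thesis .
  qed
  have u_pow: "ennpowr (u x) q \<le> ennreal (2 powr q) * (\<Sum>k. ennpowr (b k x) q)" for x
  proof -
    define S where "S = (\<Sum>k. ennpowr (b k x) q)"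
    have "b k x \<le> ennpowr S (1 / q)" for k
    proof -
      have "ennpowr (b k x) q \<le> S" unfolding S_def
        by (rule term_le_suminf)
      then have "ennpowr (ennpowr (b k x) q) (1 / q) \<le> ennpowr S (1 / q)" using q by (intro ennpowr_mono) auto
      then show ?thesis using q by (simp add: ennpowr_ennpowr)
    qed
    then have "u x \<le> (\<Sum>k. ennreal ((1 / 2) ^ k) * ennpowr S (1 / q))"
      unfolding u_def by (intro suminf_le mult_left_mono) auto
    also have "\<dots> = ennreal 2 * ennpowr S (1 / q)" by (simp add: suminf_half_powers del: ennreal_suminf_multc)
    finally have "ennpowr (u x) q \<le> ennpowr (ennreal 2 * ennpowr S (1 / q)) q"
      using q by (intro ennpowr_mono) auto
    also have "\<dots> = ennreal (2 powr q) * S" using q by (subst ennpowr_cmult) (auto simp: ennpowr_ennpowr)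
    finally show ?thesis unfolding S_def .
  qed
  show ?thesis
  proof (rule that[of u "2 * D"])
    have "(\<integral>\<^sup>+x. ennpowr (u x) (1 / \<rho>) \<partial>lebesgue) \<le> (\<integral>\<^sup>+x. ennreal (2 powr q) * (\<Sum>k. ennpowr (b k x) q) \<partial>lebesgue)"
      unfolding q_def[symmetric] by (intro nn_integral_mono u_pow)
    also have "\<dots> = ennreal (2 powr q) * (\<Sum>k. \<integral>\<^sup>+x. ennpowr (b k x) q \<partial>lebesgue)"
      by (subst nn_integral_cmult, measurable) (subst nn_integral_suminf, auto)
    also have "\<dots> \<le> ennreal (2 powr q) * (\<Sum>k. ennreal ((1 / 2) ^ k) * (\<integral>\<^sup>+x. \<Phi> x \<partial>lebesgue))"
      by (intro mult_left_mono suminf_le int_b) auto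
    also have "\<dots> = ennreal (2 powr q) * (2 * (\<integral>\<^sup>+x. \<Phi> x \<partial>lebesgue))"
      by (simp add: suminf_half_powers del: ennreal_suminf_multc)
    also have "\<dots> < \<infinity>" using fin by (simp add: ennreal_mult_less_top)
    finally show "(\<integral>\<^sup>+x. ennpowr (u x) (1 / \<rho>) \<partial>lebesgue) < \<infinity>" .
    show "ennpowr (\<Phi> x) \<rho> \<le> u x" for x
    proof -
      have "ennpowr (\<Phi> x) \<rho> = ennreal ((1 / 2) ^ 0) * b 0 x" by (simp add: b_def a_def)
      also have "\<dots> \<le> u x" unfolding u_def
        by (rule term_le_suminf)
      finally show ?thesis .
    qed
    fix z r and x :: 'a assume x: "x \<in> ball z r"
    let ?v = "ennreal (vol TYPE('a) r)"
    have step: "ennreal ((1 / 2) ^ k) * (\<integral>\<^sup>+y\<in>ball z r. b k y \<partial>lebesgue)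
        \<le> ennreal (2 * D) * ?v * (ennreal ((1 / 2) ^ Suc k) * b (Suc k) x)" for k
    proof -
      have "(\<integral>\<^sup>+y\<in>ball z r. b k y \<partial>lebesgue) = ennreal ((1 / D) ^ k) * (\<integral>\<^sup>+y\<in>ball z r. a k y \<partial>lebesgue)"
        unfolding b_def mult.assoc by (rule nn_integral_cmult) measurable
      also have "\<dots> \<le> ennreal ((1 / D) ^ k) * (a (Suc k) x * ?v)"
        unfolding a_Suc by (intro mult_left_mono set_integral_le_hl_max x) simp
      finally have "ennreal ((1 / 2) ^ k) * (\<integral>\<^sup>+y\<in>ball z r. b k y \<partial>lebesgue)
        \<le> ennreal ((1 / 2) ^ k) * (ennreal ((1 / D) ^ k) * (a (Suc k) x * ?v))"
        by (rule mult_left_mono) simp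
      also have "\<dots> = (ennreal ((1 / 2) ^ k) * ennreal ((1 / D) ^ k)) * (a (Suc k) x * ?v)"
        by (simp only: mult.assoc)
      also have "ennreal ((1 / 2) ^ k) * ennreal ((1 / D) ^ k) = ennreal (2 * D * (1 / 2) ^ Suc k * (1 / D) ^ Suc k)"
      proof -
        have "2 * D * (1 / 2) ^ Suc k * (1 / D) ^ Suc k = (1 / 2) ^ k * (1 / D) ^ k"
          using D by simp
        then show ?thesis by (simp only: ennreal_mult'[OF zero_le_power[of "1 / 2 :: real"]])
      qed
      also have "\<dots> = ennreal (2 * D) * ennreal ((1 / 2) ^ Suc k) * ennreal ((1 / D) ^ Suc k)"
        using D by (subst ennreal_mult', simp)+ simp
      also have "\<dots> * (a (Suc k) x * ?v) = ennreal (2 * D) * ?v * (ennreal ((1 / 2) ^ Suc k) * b (Suc k) x)"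
        unfolding b_def by (simp only: mult_ac)
      finally show ?thesis .
    qed
    have "(\<integral>\<^sup>+y\<in>ball z r. u y \<partial>lebesgue) = (\<integral>\<^sup>+y. (\<Sum>k. ennreal ((1 / 2) ^ k) * (b k y * indicator (ball z r) y)) \<partial>lebesgue)"
      unfolding u_def by (intro nn_integral_cong) (simp flip: ennreal_suminf_multc add: mult.assoc)
    also have "\<dots> = (\<Sum>k. \<integral>\<^sup>+y. ennreal ((1 / 2) ^ k) * (b k y * indicator (ball z r) y) \<partial>lebesgue)"
      by (rule nn_integral_suminf) measurable
    also have "\<dots> = (\<Sum>k. ennreal ((1 / 2) ^ k) * (\<integral>\<^sup>+y\<in>ball z r. b k y \<partial>lebesgue))"
      by (intro suminf_cong nn_integral_cmult) measurable
    also have "\<dots> \<le> (\<Sum>k. ennreal (2 * D) * ?v * (ennreal ((1 / 2) ^ Suc k) * b (Suc k) x))"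
      by (intro suminf_le step) auto
    also have "\<dots> = ennreal (2 * D) * ?v * (\<Sum>k. ennreal ((1 / 2) ^ Suc k) * b (Suc k) x)"
      by (rule ennreal_suminf_cmult)
    also have "\<dots> \<le> ennreal (2 * D) * ?v * u x"
    proof (rule mult_left_mono)
      let ?f = "\<lambda>k. ennreal ((1 / 2) ^ k) * b k x"
      have "(\<Sum>k. ?f (k + 1)) \<le> (\<Sum>k. ?f (k + 1)) + sum ?f {..<1}" by simp
      also have "\<dots> = u x" unfolding u_def by (rule suminf_offset[symmetric]) simp
      finally show "(\<Sum>k. ?f (Suc k)) \<le> u x" by simp
    qed simp
    finally show "(\<integral>\<^sup>+y\<in>ball z r. u y \<partial>lebesgue) \<le> ennreal (2 * D * vol TYPE('a) r) * u x"
      using D by (simp add: ennreal_mult' mult.assoc)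
  qed (use D in simp_all)
qed

section \<open>Log-Hoelder continuity\<close>

lemma inverse_polynomial_integrable:
  assumes m: "real DIM('a) < m"
  shows "(\<integral>\<^sup>+x. ennreal ((exp 1 + norm x) powr - m) \<partial>(lebesgue :: 'a::euclidean_space measure)) < \<infinity>"
proof -
  let ?n = "DIM('a)" and ?w = "unit_ball_vol DIM('a)"
  have m0: "0 < m" using m by (smt (verit) of_nat_0_le_iff)
  \<comment> \<open>The point lies in the dyadic shell with index \<open>k\<close>, the integer part of \<open>log 2 (e + norm x)\<close>.\<close>
  have pt: "ennreal ((exp 1 + norm x) powr - m) \<le> (\<Sum>k. ennreal (2 powr (- m * real k)) * indicator (ball 0 (2 ^ Suc k)) x)" (is "_ \<le> (\<Sum>k. ?g k)") for x :: 'a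
  proof -
    have "\<exists>k. 2 powr real k \<le> exp 1 + norm x \<and> norm x < 2 ^ Suc k"
    proof -
      define k where "k = nat \<lfloor>log 2 (exp 1 + norm x)\<rfloor>"
      have e: "(1::real) \<le> exp 1" by simp
      have ge1: "1 \<le> exp 1 + norm x" using e norm_ge_zero[of x] by linarith
      then have l0: "0 \<le> log 2 (exp 1 + norm x)" by simp
      then have k: "real k \<le> log 2 (exp 1 + norm x)" "log 2 (exp 1 + norm x) < real k + 1"
        unfolding k_def by linarith+
      have "2 powr real k \<le> exp 1 + norm x" using k(1) ge1 by (simp add: le_log_iff)
      moreover have "exp 1 + norm x < 2 powr (real k + 1)" using k(2) ge1 by (simp add: log_less_iff)
      then have "norm x < 2 powr real (Suc k)" by (smt (verit) exp_gt_zero of_nat_Suc)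
      ultimately show ?thesis by (auto simp: powr_realpow simp del: power_Suc of_nat_Suc)
    qed
    then obtain k where k: "2 powr real k \<le> exp 1 + norm x" "norm x < 2 ^ Suc k" by blast
    have "(exp 1 + norm x) powr - m \<le> (2 powr real k) powr - m"
      using k m0 by (intro powr_mono2') auto
    also have "\<dots> = 2 powr (- m * real k)" by (simp add: powr_powr mult.commute)
    finally have "ennreal ((exp 1 + norm x) powr - m) \<le> ?g k" using k(2) by (simp add: ennreal_leI)
    also have "\<dots> \<le> (\<Sum>k. ?g k)" by (rule term_le_suminf)
    finally show ?thesis .
  qed
  have "(\<integral>\<^sup>+x. ennreal ((exp 1 + norm x) powr - m) \<partial>(lebesgue :: 'a measure))
      \<le> (\<integral>\<^sup>+x. (\<Sum>k. ennreal (2 powr (- m * real k)) * indicator (ball 0 (2 ^ Suc k)) x) \<partial>(lebesgue :: 'a measure))"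
    by (intro nn_integral_mono pt)
  also have "\<dots> = (\<Sum>k. \<integral>\<^sup>+x. ennreal (2 powr (- m * real k)) * indicator (ball 0 (2 ^ Suc k)) x \<partial>(lebesgue :: 'a measure))"
    by (rule nn_integral_suminf) measurable
  also have "\<dots> = (\<Sum>k. ennreal (2 powr (- m * real k)) * emeasure lebesgue (ball (0::'a) (2 ^ Suc k)))"
    by (intro suminf_cong nn_integral_cmult_indicator) measurable
  also have "\<dots> = (\<Sum>k. ennreal (?w * 2 ^ ?n * (2 powr (real ?n - m)) ^ k))"
  proof (rule suminf_cong)
    fix k
    have "2 powr (- m * real k) * (?w * (2 ^ Suc k) ^ ?n) = ?w * 2 ^ ?n * (2 powr (real ?n - m)) ^ k"
    proof -
      have "((2::real) ^ Suc k) ^ ?n = 2 ^ ?n * 2 powr (real ?n * real k)"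
        by (simp add: power_mult_distrib powr_realpow[symmetric] powr_powr mult.commute)
      moreover have "((2::real) powr (real ?n - m)) ^ k = 2 powr (- m * real k) * 2 powr (real ?n * real k)"
        by (simp add: powr_realpow[symmetric] powr_powr powr_add[symmetric] algebra_simps)
      ultimately show ?thesis by simp
    qed
    then show "ennreal (2 powr (- m * real k)) * emeasure lebesgue (ball (0::'a) (2 ^ Suc k))
      = ennreal (?w * 2 ^ ?n * (2 powr (real ?n - m)) ^ k)"
      by (subst emeasure_lebesgue_ball, simp) (simp only: ennreal_mult'[OF powr_ge_zero, symmetric])
  qed
  also have "\<dots> = ennreal (?w * 2 ^ ?n * (1 / (1 - 2 powr (real ?n - m))))"
    using m by (intro suminf_ennreal_eq sums_mult geometric_sums) (auto simp: powr_less_one)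
  also have "\<dots> < \<infinity>" by simp
  finally show ?thesis .
qed

text \<open>
  Stated for real functions of either sign, because it is needed not only for \<open>p\<close> and \<open>1 / p\<close> but
  also for affine functions of \<open>1 / p\<close>. One constant serves both conditions.
\<close>
definition log_holder :: "('a::euclidean_space \<Rightarrow> real) \<Rightarrow> real \<Rightarrow> real \<Rightarrow> bool" where
  "log_holder b b_inf C \<longleftrightarrow>
     (\<forall>x y. 0 < norm (x - y) \<and> norm (x - y) < 1/2 \<longrightarrow> \<bar>b x - b y\<bar> \<le> C / (- ln (norm (x - y)))) \<and>
     (\<forall>x. \<bar>b x - b_inf\<bar> \<le> C / ln (exp 1 + norm x))"

lemma exp_minus_one_less_half: "exp (-1) < (1/2 :: real)"
proof -
  have "(3/2) * (3/2) \<le> exp (1/2 :: real) * exp (1/2)"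
    using exp_ge_add_one_self[of "1/2"] by (intro mult_mono) auto
  also have "\<dots> = exp 1" by (simp flip: exp_add)
  finally have "(2::real) < exp 1" by simp
  then show ?thesis by (simp add: exp_minus field_simps)
qed

text \<open>
  The radius \<open>1 / e\<close> separates small from large balls throughout: it is less than \<open>1/2\<close>, where the
  local condition is available, and \<open>- ln r > 1\<close> below it.
\<close>
lemma log_holder_small_ball:
  assumes lh: "log_holder b b_inf C" and C: "0 \<le> C" and x: "x \<in> ball z r" and r: "r < exp (-1)"
  shows "\<bar>b x - b z\<bar> * \<bar>ln r\<bar> \<le> C"
proof -
  have r0: "0 < r" using x by (metis mem_ball zero_le_dist le_less_trans)
  have lnr: "ln r < -1" using r r0 by (metis ln_exp ln_less_cancel_iff exp_gt_zero)
  show ?thesis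
  proof (cases "x = z")
    case False
    let ?d = "norm (x - z)"
    have d: "0 < ?d" "?d < r" using False x by (auto simp: dist_norm norm_minus_commute)
    have "\<bar>b x - b z\<bar> \<le> C / (- ln ?d)"
      using lh d r exp_minus_one_less_half by (auto simp: log_holder_def)
    also have "\<dots> \<le> C / (- ln r)"
    proof (intro divide_left_mono mult_pos_pos)
      have "ln ?d \<le> ln r" using d by (intro ln_mono) auto
      then show "- ln r \<le> - ln ?d" "0 < - ln ?d" "0 < - ln r" using lnr by linarith+
    qed (rule C)
    finally show ?thesis using lnr by (simp add: field_simps)
  qed (use C in auto)
qed

lemma ln_e_norm_ge_1: "1 \<le> ln (exp 1 + norm x)"
  by (metis add_increasing2 dual_order.refl exp_gt_zero ln_exp ln_mono norm_ge_zero)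

lemma log_holder_infinity:
  assumes "log_holder b b_inf C"
  shows "\<bar>b x - b_inf\<bar> * ln (exp 1 + norm x) \<le> C" "\<bar>b x - b_inf\<bar> \<le> C"
proof -
  show *: "\<bar>b x - b_inf\<bar> * ln (exp 1 + norm x) \<le> C"
  proof -
    have "\<bar>b x - b_inf\<bar> \<le> C / ln (exp 1 + norm x)" using assms unfolding log_holder_def by blast
    then show ?thesis using ln_e_norm_ge_1[of x] by (subst (asm) pos_le_divide_eq) auto
  qed
  have "\<bar>b x - b_inf\<bar> \<le> \<bar>b x - b_inf\<bar> * ln (exp 1 + norm x)"
    using mult_left_mono[OF ln_e_norm_ge_1[of x], of "\<bar>b x - b_inf\<bar>"] by simp
  then show "\<bar>b x - b_inf\<bar> \<le> C" using * by (rule order_trans)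
qed

lemma log_holder_uminus: "log_holder b b_inf C \<Longrightarrow> log_holder (\<lambda>x. - b x) (- b_inf) C"
  unfolding log_holder_def by (smt (verit))

lemma log_holder_affine:
  assumes "log_holder b b_inf C"
  shows "log_holder (\<lambda>x. c * b x + d) (c * b_inf + d) (\<bar>c\<bar> * C)"
proof -
  have "\<bar>(c * s + d) - (c * t + d)\<bar> = \<bar>c\<bar> * \<bar>s - t\<bar>" for s t :: real
    by (simp add: abs_mult[symmetric] algebra_simps)
  then show ?thesis
    using assms unfolding log_holder_def by (auto simp only: times_divide_eq_right[symmetric] intro!: mult_left_mono abs_ge_zero)
qed

text \<open>
  The value \<open>b_inf\<close> is the limit of \<open>b\<close> at infinity and inherits its bounds.
\<close>
lemma log_holder_inf_ge:
  fixes b :: "'a::euclidean_space \<Rightarrow> real"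
  assumes lh: "log_holder b b_inf C" and c: "\<And>x. c \<le> b x"
  shows "c \<le> b_inf"
proof (rule ccontr)
  assume "\<not> c \<le> b_inf"
  then have gap: "0 < c - b_inf" by simp
  obtain e :: 'a where e: "e \<in> Basis" using nonempty_Basis by blast
  define R where "R = exp (\<bar>C\<bar> / (c - b_inf) + 1)"
  let ?x = "R *\<^sub>R e"
  have n: "norm ?x = R" using e by (simp add: R_def)
  have R: "0 < R" by (simp add: R_def)
  have "ln R \<le> ln (exp 1 + R)" using R by (intro ln_mono) auto
  then have l: "\<bar>C\<bar> / (c - b_inf) < ln (exp 1 + norm ?x)" unfolding n by (simp add: R_def)
  have "(c - b_inf) * ln (exp 1 + norm ?x) \<le> \<bar>b ?x - b_inf\<bar> * ln (exp 1 + norm ?x)"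
    using c[of ?x] ln_e_norm_ge_1[of ?x] by (intro mult_right_mono) auto
  also have "\<dots> \<le> C" using lh by (rule log_holder_infinity)
  finally have "(c - b_inf) * ln (exp 1 + norm ?x) \<le> C" .
  moreover have "\<bar>C\<bar> < (c - b_inf) * ln (exp 1 + norm ?x)" using l gap by (simp add: pos_divide_less_eq mult.commute)
  ultimately show False by linarith
qed

lemma log_holder_inf_le:
  fixes b :: "'a::euclidean_space \<Rightarrow> real"
  assumes lh: "log_holder b b_inf C" and c: "\<And>x. b x \<le> c"
  shows "b_inf \<le> c"
  using log_holder_inf_ge[OF log_holder_uminus[OF lh], of "- c"] c by simp

lemma log_holder_inverse:
  fixes b :: "'a::euclidean_space \<Rightarrow> real"
  assumes lh: "log_holder b b_inf C" and b1: "\<And>x. 1 \<le> b x"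
  shows "log_holder (\<lambda>x. 1 / b x) (1 / b_inf) C"
proof -
  have inv: "\<bar>1 / s - 1 / t\<bar> \<le> \<bar>s - t\<bar>" if "1 \<le> s" "1 \<le> t" for s t :: real
  proof -
    have "1 / s - 1 / t = (t - s) / (s * t)" using that by (simp add: field_simps)
    then have "\<bar>1 / s - 1 / t\<bar> = \<bar>s - t\<bar> / (s * t)" using that by (simp add: abs_minus_commute abs_mult)
    also have "\<dots> \<le> \<bar>s - t\<bar> / 1"
      using that mult_mono[of 1 s 1 t] by (intro divide_left_mono) auto
    finally show ?thesis by simp
  qed
  have "1 \<le> b_inf" using log_holder_inf_ge[OF lh b1] .
  then show ?thesis using lh b1 inv unfolding log_holder_def by (meson order_trans)
qed

lemma LH_log_holder:
  fixes p :: "'a::euclidean_space \<Rightarrow> ennreal"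
  assumes "p \<in> LH"
  obtains p_inf C where "0 \<le> C" "log_holder (\<lambda>x. enn2real (p x)) p_inf C"
proof -
  obtain C_0 C_inf p_inf where C: "0 < C_0" "0 < C_inf"
    and loc: "\<forall>x y. 0 < norm (x - y) \<and> norm (x - y) < 1/2 \<longrightarrow>
        \<bar>enn2real (p x) - enn2real (p y)\<bar> \<le> C_0 / (- ln (norm (x - y)))"
    and inf: "\<forall>x. \<bar>enn2real (p x) - p_inf\<bar> \<le> C_inf / ln (exp 1 + norm x)"
    using assms unfolding LH_def by blast
  show ?thesis
  proof (rule that[of "max C_0 C_inf"])
    show "log_holder (\<lambda>x. enn2real (p x)) p_inf (max C_0 C_inf)"
      unfolding log_holder_def
    proof (intro conjI allI impI)
      fix x y :: 'a assume d: "0 < norm (x - y) \<and> norm (x - y) < 1/2"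
      then have "ln (norm (x - y)) < 0" by simp
      then have "C_0 / (- ln (norm (x - y))) \<le> max C_0 C_inf / (- ln (norm (x - y)))"
        by (intro divide_right_mono) auto
      then show "\<bar>enn2real (p x) - enn2real (p y)\<bar> \<le> max C_0 C_inf / (- ln (norm (x - y)))"
        using loc d by (meson order_trans)
    next
      fix x :: 'a
      have "C_inf / ln (exp 1 + norm x) \<le> max C_0 C_inf / ln (exp 1 + norm x)"
        using ln_e_norm_ge_1[of x] by (intro divide_right_mono) auto
      then show "\<bar>enn2real (p x) - p_inf\<bar> \<le> max C_0 C_inf / ln (exp 1 + norm x)"
        using inf by (meson order_trans)
    qed
  qed (use C in auto)
qed

text \<open>
  How log-Hoelder continuity is used: replacing the exponent \<open>a\<close> by \<open>b\<close> costs a bounded factor as long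
  as \<open>|a - b|\<close> is at most of the order \<open>1 / |ln U|\<close>.
\<close>
lemma powr_change_exponent:
  fixes U :: real
  assumes "0 < U" "\<bar>a - b\<bar> * \<bar>ln U\<bar> \<le> L"
  shows "U powr a \<le> exp L * U powr b"
proof -
  have "a * ln U - b * ln U \<le> \<bar>(a - b) * ln U\<bar>" by (simp add: algebra_simps)
  then have "a * ln U \<le> L + b * ln U" using assms(2) by (simp add: abs_mult)
  then show ?thesis using assms(1) by (simp add: powr_def exp_add[symmetric])
qed

lemma AE_ballE:
  fixes z :: "'a::euclidean_space"
  assumes "AE x in lebesgue. x \<in> ball z r \<longrightarrow> P x" and r: "0 < r"
  obtains x where "x \<in> ball z r" "P x"
proof -
  have "\<not> (AE x in lebesgue. x \<notin> ball z r)"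
  proof
    assume "AE x in lebesgue. x \<notin> ball z r"
    then have "emeasure lebesgue (ball z r) = 0"
      by (subst (asm) AE_iff_measurable[OF ball_sets_lebesgue(1)]) auto
    moreover have "0 < emeasure lebesgue (ball z r)"
      unfolding emeasure_lebesgue_ball[OF less_imp_le[OF r]] using vol_pos[OF r, where 'a = 'a] by (simp only: ennreal_less_zero_iff)
    ultimately show False by simp
  qed
  then show ?thesis using assms(1) that by (metis (mono_tags, lifting) AE_mp AE_I2)
qed

text \<open>
  The local condition makes \<open>b\<close> continuous, so essential bounds are bounds.
\<close>
lemma log_holder_AE_le:
  fixes b :: "'a::euclidean_space \<Rightarrow> real"
  assumes lh: "log_holder b b_inf C" and C: "0 \<le> C" and le: "AE x in lebesgue. b x \<le> c"
  shows "b x \<le> c"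
proof (rule ccontr)
  assume "\<not> b x \<le> c"
  then have gap: "0 < b x - c" by simp
  define r where "r = exp (- (2 + C / (b x - c)))"
  have "0 \<le> C / (b x - c)" using C gap by simp
  then have r: "0 < r" "r < exp (-1)" "\<bar>ln r\<bar> = 2 + C / (b x - c)" by (auto simp: r_def)
  have "AE y in lebesgue. y \<in> ball x r \<longrightarrow> b y \<le> c" using le by eventually_elim simp
  then obtain y where y: "y \<in> ball x r" "b y \<le> c" using r(1) by (rule AE_ballE)
  have "(b x - c) * \<bar>ln r\<bar> \<le> \<bar>b y - b x\<bar> * \<bar>ln r\<bar>" using y gap by (intro mult_right_mono) auto
  also have "\<dots> \<le> C" by (rule log_holder_small_ball[OF lh C y(1) r(2)])
  finally have "(b x - c) * (2 + C / (b x - c)) \<le> C" unfolding r(3) .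
  moreover have "(b x - c) * (2 + C / (b x - c)) = 2 * (b x - c) + C" using gap by (simp add: distrib_left)
  ultimately show False using gap by simp
qed

section \<open>Variable powers of a weight\<close>

definition ball_avg :: "('a::euclidean_space \<Rightarrow> real) \<Rightarrow> 'a \<Rightarrow> real \<Rightarrow> real" where
  "ball_avg u z r = enn2real (\<integral>\<^sup>+y\<in>ball z r. ennreal (u y) \<partial>lebesgue) / vol TYPE('a) r"

text \<open>
  An \<open>A\<^sub>1\<close> weight \<open>u\<close> such that \<open>u powr (1 / \<rho>)\<close> is integrable and \<open>u\<close> decays at most polynomially.
  Integrability bounds the averages of \<open>u\<close> from above by a power of the volume, the decay condition
  bounds them from below by a power of the distance to the origin; these are exactly the orders of
  magnitude for which a log-Hoelder exponent may be frozen. The exponent \<open>DIM('a) / \<rho>\<close> in \<open>low\<close> is the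
  largest for which powers \<open>u powr s\<close> with \<open>|s| \<le> \<rho>\<close> cannot fall below the order of \<open>1 / volume\<close> on a
  large ball around the origin, and it still leaves \<open>(e + |x|) powr - (DIM('a) / \<rho>\<^sup>2)\<close> integrable.
\<close>
locale A1_weight =
  fixes u :: "'a::euclidean_space \<Rightarrow> real" and \<rho> N I :: real
  assumes u_meas [measurable]: "u \<in> borel_measurable lebesgue"
    and \<rho>: "0 < \<rho>" "\<rho> < 1" and N: "1 \<le> N" and I: "0 < I"
    and low: "\<And>x. (exp 1 + norm x) powr - (real DIM('a) / \<rho>) \<le> u x"
    and A1: "\<And>z r. 0 < r \<Longrightarrow> AE x in lebesgue. x \<in> ball z r \<longrightarrow>
        (\<integral>\<^sup>+y\<in>ball z r. ennreal (u y) \<partial>lebesgue) \<le> ennreal (N * vol TYPE('a) r * u x)"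
    and integrable: "(\<integral>\<^sup>+x. ennreal (u x powr (1 / \<rho>)) \<partial>lebesgue) \<le> ennreal I"
begin

lemma u_pos: "0 < u x"
proof -
  have "0 < exp 1 + norm x" by (simp add: add_pos_nonneg)
  then have "0 < (exp 1 + norm x) powr - (real DIM('a) / \<rho>)" by simp
  then show ?thesis using low[of x] by linarith
qed

lemma avg:
  assumes r: "0 < r"
  shows set_integral_avg: "(\<integral>\<^sup>+y\<in>ball z r. ennreal (u y) \<partial>lebesgue) = ennreal (ball_avg u z r * vol TYPE('a) r)"
    and avg_le: "AE x in lebesgue. x \<in> ball z r \<longrightarrow> ball_avg u z r \<le> N * u x"
proof -
  let ?v = "vol TYPE('a) r"
  have v: "0 < ?v" using r by (rule vol_pos)
  obtain x where "(\<integral>\<^sup>+y\<in>ball z r. ennreal (u y) \<partial>lebesgue) \<le> ennreal (N * ?v * u x)"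
    using AE_ballE[OF A1[OF r] r] by metis
  then have fin: "(\<integral>\<^sup>+y\<in>ball z r. ennreal (u y) \<partial>lebesgue) < \<infinity>"
    by (simp add: le_less_trans[OF _ ennreal_less_top])
  show 1: "(\<integral>\<^sup>+y\<in>ball z r. ennreal (u y) \<partial>lebesgue) = ennreal (ball_avg u z r * ?v)"
  proof -
    have "a / w * w = a" if "0 < w" for a w :: real using that by simp
    from this[OF v] fin show ?thesis unfolding ball_avg_def by (simp only: ennreal_enn2real infinity_ennreal_def)
  qed
  have nn: "0 \<le> ball_avg u z r * ?v" using v unfolding ball_avg_def by simp
  show "AE x in lebesgue. x \<in> ball z r \<longrightarrow> ball_avg u z r \<le> N * u x"
    using A1[OF r, of z]
  proof eventually_elim
    case (elim x)
    show ?case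
    proof
      assume "x \<in> ball z r"
      then have "ennreal (ball_avg u z r * ?v) \<le> ennreal (N * ?v * u x)" using elim 1 by simp
      then have "ball_avg u z r * ?v \<le> (N * u x) * ?v"
        using N u_pos[of x] v by (subst (asm) ennreal_le_iff) (auto simp: mult_ac intro!: mult_nonneg_nonneg)
      then show "ball_avg u z r \<le> N * u x" using v by (simp only: mult_le_cancel_right_pos)
    qed
  qed
qed

lemma avg_lower:
  assumes r: "0 < r" and M: "\<And>y. y \<in> ball z r \<Longrightarrow> exp 1 + norm y \<le> M"
  shows "M powr - (real DIM('a) / \<rho>) \<le> ball_avg u z r"
proof -
  let ?v = "vol TYPE('a) r" and ?m = "M powr - (real DIM('a) / \<rho>)"
  have v: "0 < ?v" using r by (rule vol_pos)
  have "ennreal (?m * ?v) = (\<integral>\<^sup>+y. ennreal ?m * indicator (ball z r) y \<partial>lebesgue)"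
    using r by (subst nn_integral_cmult_indicator) (auto simp: emeasure_ball ennreal_mult')
  also have "\<dots> \<le> (\<integral>\<^sup>+y\<in>ball z r. ennreal (u y) \<partial>lebesgue)"
  proof (rule nn_integral_mono)
    fix y
    show "ennreal ?m * indicator (ball z r) y \<le> ennreal (u y) * indicator (ball z r) y"
    proof (cases "y \<in> ball z r")
      case True
      have "0 < exp 1 + norm y" by (simp add: add_pos_nonneg)
      then have "?m \<le> (exp 1 + norm y) powr - (real DIM('a) / \<rho>)"
        using M[OF True] \<rho> by (intro powr_mono2') auto
      then have "?m \<le> u y" using low[of y] by linarith
      then show ?thesis by (intro mult_right_mono ennreal_leI) auto
    qed auto
  qed
  also have "\<dots> = ennreal (ball_avg u z r * ?v)" using r by (rule set_integral_avg)
  finally have "?m * ?v \<le> ball_avg u z r * ?v"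
    using v by (subst (asm) ennreal_le_iff) (auto simp: ball_avg_def)
  then show ?thesis using v by (simp only: mult_le_cancel_right_pos)
qed

lemma avg_pos:
  assumes r: "0 < r"
  shows "0 < ball_avg u z r"
proof -
  have "exp 1 + norm y \<le> exp 1 + norm z + r" if "y \<in> ball z r" for y
    using that norm_triangle_sub[of y z] by (auto simp: dist_norm norm_minus_commute)
  then have "(exp 1 + norm z + r) powr - (real DIM('a) / \<rho>) \<le> ball_avg u z r"
    using r by (intro avg_lower) auto
  moreover have "0 < exp 1 + norm z + r" using r by (simp add: add_pos_nonneg)
  ultimately show ?thesis by (metis less_le_trans powr_gt_zero order_less_irrefl)
qed

text \<open>
  By the \<open>A\<^sub>1\<close> condition the average divided by \<open>N\<close> is a
  pointwise lower bound for \<open>u\<close> on the ball; integrate its \<open>1 / \<rho>\<close>-th power.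
\<close>
lemma avg_upper:
  assumes r: "0 < r"
  shows "ball_avg u z r \<le> N * (I / vol TYPE('a) r) powr \<rho>"
proof -
  let ?v = "vol TYPE('a) r" and ?U = "ball_avg u z r"
  have v: "0 < ?v" using r by (rule vol_pos)
  have U: "0 < ?U" using r by (rule avg_pos)
  have "ennreal ((?U / N) powr (1 / \<rho>) * ?v) = (\<integral>\<^sup>+y. ennreal ((?U / N) powr (1 / \<rho>)) * indicator (ball z r) y \<partial>lebesgue)"
    using r by (subst nn_integral_cmult_indicator) (auto simp: emeasure_ball ennreal_mult')
  also have "\<dots> \<le> (\<integral>\<^sup>+y. ennreal (u y powr (1 / \<rho>)) \<partial>lebesgue)"
    using avg_le[OF r, of z]
  proof (intro nn_integral_mono_AE, eventually_elim)
    case (elim y)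
    show ?case
    proof (cases "y \<in> ball z r")
      case True
      then have "?U / N \<le> u y" using elim N by (simp add: pos_divide_le_eq mult.commute)
      then have "(?U / N) powr (1 / \<rho>) \<le> u y powr (1 / \<rho>)" using \<rho> U N by (intro powr_mono2) auto
      then show ?thesis using True by (simp add: ennreal_leI)
    qed auto
  qed
  also have "\<dots> \<le> ennreal I" by (rule integrable)
  finally have "(?U / N) powr (1 / \<rho>) * ?v \<le> I" using I by (simp only: ennreal_le_iff less_imp_le)
  then have "(?U / N) powr (1 / \<rho>) \<le> I / ?v" using v by (simp only: pos_le_divide_eq)
  then have "((?U / N) powr (1 / \<rho>)) powr \<rho> \<le> (I / ?v) powr \<rho>" using \<rho> by (intro powr_mono2) auto
  then have "?U / N \<le> (I / ?v) powr \<rho>" using U N \<rho> by (simp add: powr_powr)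
  then show ?thesis using N by (simp add: pos_divide_le_eq mult.commute)
qed

text \<open>
  Relative to its average an \<open>A\<^sub>1\<close> weight is bounded below by \<open>1 / N\<close> and has mean one. Positive powers
  up to one are controlled by the mean, negative powers down to minus one by the lower bound.
\<close>
lemma normalised_power_integral:
  assumes b [measurable]: "b \<in> borel_measurable lebesgue" and b1: "\<And>x. \<bar>b x\<bar> \<le> 1" and r: "0 < r"
  shows "(\<integral>\<^sup>+y\<in>ball z r. ennreal ((u y / ball_avg u z r) powr b y) \<partial>lebesgue) \<le> ennreal ((N + 1) * vol TYPE('a) r)"
proof -
  let ?v = "vol TYPE('a) r" and ?U = "ball_avg u z r"
  have v: "0 < ?v" using r by (rule vol_pos)
  have U: "0 < ?U" using r by (rule avg_pos)
  have "(\<integral>\<^sup>+y\<in>ball z r. ennreal ((u y / ?U) powr b y) \<partial>lebesgue)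
      \<le> (\<integral>\<^sup>+y. ennreal N * indicator (ball z r) y + ennreal (1 / ?U) * (ennreal (u y) * indicator (ball z r) y) \<partial>lebesgue)"
    using avg_le[OF r, of z]
  proof (intro nn_integral_mono_AE, eventually_elim)
    case (elim y)
    show ?case
    proof (cases "y \<in> ball z r")
      case True
      let ?t = "u y / ?U"
      have t: "0 < ?t" "1 / N \<le> ?t"
        using U u_pos[of y] elim True N by (auto simp: field_simps)
      have "?t powr b y \<le> N + ?t"
      proof (cases "1 \<le> ?t")
        case True
        then have "?t powr b y \<le> ?t powr 1" using b1[of y] by (intro powr_mono) auto
        then show ?thesis using t N by simp
      next
        case False
        then have "?t powr b y \<le> ?t powr - 1" using b1[of y] t by (intro powr_mono') auto
        also have "\<dots> \<le> N" using t N U u_pos[of y] by (simp add: powr_minus field_simps)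
        finally show ?thesis using t by simp
      qed
      then have "ennreal (?t powr b y) \<le> ennreal (N + (1 / ?U) * u y)" by (intro ennreal_leI) simp
      also have "\<dots> = ennreal N + ennreal (1 / ?U) * ennreal (u y)"
        using N U u_pos[of y] by (simp add: ennreal_mult'[symmetric])
      finally show ?thesis using True by simp
    qed auto
  qed
  also have "\<dots> = (\<integral>\<^sup>+y. ennreal N * indicator (ball z r) y \<partial>lebesgue)
      + (\<integral>\<^sup>+y. ennreal (1 / ?U) * (ennreal (u y) * indicator (ball z r) y) \<partial>lebesgue)"
    by (rule nn_integral_add) measurable
  also have "(\<integral>\<^sup>+y. ennreal N * indicator (ball z r) y \<partial>lebesgue) = ennreal (N * ?v)"
    using r N by (subst nn_integral_cmult_indicator) (auto simp: emeasure_ball ennreal_mult')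
  also have "(\<integral>\<^sup>+y. ennreal (1 / ?U) * (ennreal (u y) * indicator (ball z r) y) \<partial>lebesgue)
      = ennreal (1 / ?U) * ennreal (?U * ?v)"
    unfolding set_integral_avg[OF r, symmetric] by (rule nn_integral_cmult) measurable
  also have "\<dots> = ennreal ?v" using U by (simp add: ennreal_mult'[symmetric])
  also have "ennreal (N * ?v) + ennreal ?v = ennreal ((N + 1) * ?v)"
    using N v by (subst ennreal_plus[symmetric]) (auto simp: algebra_simps)
  finally show ?thesis .
qed

end

text \<open>
  The exponent that represents \<open>b\<close> on a ball: the value at the centre where \<open>b\<close> varies little on the
  ball, namely for a small ball or one far from the origin, and the limit at infinity for a large
  ball near the origin.
\<close>
definition ball_exponent :: "('a::euclidean_space \<Rightarrow> real) \<Rightarrow> real \<Rightarrow> 'a \<Rightarrow> real \<Rightarrow> real" where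
  "ball_exponent b b_inf z r = (if r < exp (-1) \<or> 3 * r < norm z then b z else b_inf)"

lemma ball_exponent_uminus: "ball_exponent (\<lambda>x. - b x) (- b_inf) z r = - ball_exponent b b_inf z r"
  by (simp add: ball_exponent_def)

lemma set_nn_integral_cmult:
  fixes f :: "'a \<Rightarrow> ennreal"
  assumes [measurable]: "f \<in> borel_measurable M" "A \<in> sets M"
  shows "(\<integral>\<^sup>+x\<in>A. c * f x \<partial>M) = c * (\<integral>\<^sup>+x\<in>A. f x \<partial>M)"
  unfolding mult.assoc by (rule nn_integral_cmult) measurable

context A1_weight begin

text \<open>
  On a small ball, or one far from the origin, \<open>b\<close> oscillates so little that the average of \<open>u\<close> may
  be raised to \<open>b x\<close> or to \<open>b z\<close> without harm. The logarithm of the average is at most of order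
  \<open>- ln r + ln (e + norm z)\<close>; the first term is absorbed by the local condition, the second by the
  condition at infinity.
\<close>
lemma good_ball_oscillation:
  assumes lh: "log_holder b b_inf C" and C: "0 \<le> C"
    and r: "0 < r" and good: "r < exp (-1) \<or> 3 * r < norm z" and x: "x \<in> ball z r"
  shows "\<bar>b x - b z\<bar> * \<bar>ln (ball_avg u z r)\<bar>
     \<le> 2 * C * (ln N + \<bar>ln I\<bar> + \<bar>ln (unit_ball_vol DIM('a))\<bar> + DIM('a)) + 5 * C * (DIM('a) / \<rho>)"
proof -
  let ?n = "real DIM('a)" and ?w = "unit_ball_vol DIM('a)" and ?v = "vol TYPE('a) r" and ?U = "ball_avg u z r"
  define D where "D = \<bar>b x - b z\<bar>"
  have w: "0 < ?w" by simp
  have v: "0 < ?v" using r by (rule vol_pos)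
  have U: "0 < ?U" using r by (rule avg_pos)
  have e2: "2 \<le> exp (1::real)" using exp_ge_add_one_self[of 1] by simp
  have D2: "D \<le> 2 * C"
    using log_holder_infinity(2)[OF lh, of x] log_holder_infinity(2)[OF lh, of z] unfolding D_def by linarith
  have dxz: "norm (x - z) < r" using x by (simp add: dist_norm norm_minus_commute)
  have tri: "norm z \<le> norm x + norm (x - z)" by (metis norm_minus_commute norm_triangle_sub)
  have small: "norm z \<le> 2 * norm x + 1"
    using good
  proof
    assume "r < exp (-1)"
    then have "r < 1" using exp_minus_one_less_half by linarith
    then show ?thesis using dxz tri norm_ge_zero[of x] by linarith
  next
    assume "3 * r < norm z"
    then show ?thesis using dxz tri norm_ge_zero[of x] by linarith
  qed
  have lz: "ln (exp 1 + norm z) \<le> 2 * ln (exp 1 + norm x)"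
  proof -
    have p: "0 < exp 1 + norm x" "0 < exp 1 + norm z" by (simp_all add: add_pos_nonneg)
    have "exp 1 + norm z \<le> 2 * (exp 1 + norm x)" using small e2 by argo
    also have "\<dots> \<le> (exp 1 + norm x) * (exp 1 + norm x)"
      using e2 norm_ge_zero[of x] p by (intro mult_right_mono) linarith+
    finally have "ln (exp 1 + norm z) \<le> ln ((exp 1 + norm x) * (exp 1 + norm x))"
      using p by (intro ln_mono) auto
    then show ?thesis using p by (simp add: ln_mult_pos)
  qed
  have Dln: "D * ln (exp 1 + norm z) \<le> 3 * C"
  proof -
    have "D * ln (exp 1 + norm z) \<le> (\<bar>b x - b_inf\<bar> + \<bar>b z - b_inf\<bar>) * ln (exp 1 + norm z)"
      using ln_e_norm_ge_1[of z] unfolding D_def by (intro mult_right_mono) auto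
    also have "\<dots> = \<bar>b x - b_inf\<bar> * ln (exp 1 + norm z) + \<bar>b z - b_inf\<bar> * ln (exp 1 + norm z)"
      by (simp only: distrib_right)
    also have "\<bar>b x - b_inf\<bar> * ln (exp 1 + norm z) \<le> \<bar>b x - b_inf\<bar> * (2 * ln (exp 1 + norm x))"
      using lz by (intro mult_left_mono) auto
    finally show ?thesis
      using log_holder_infinity(1)[OF lh, of x] log_holder_infinity(1)[OF lh, of z] by linarith
  qed
  define L where "L = max 1 (- ln r)"
  have DL: "D * L \<le> 2 * C"
  proof (cases "r < exp (-1)")
    case True
    have "ln r < -1" using True r by (metis ln_exp ln_less_cancel_iff exp_gt_zero)
    then have "D * L = D * \<bar>ln r\<bar>" by (simp add: L_def)
    also have "\<dots> \<le> C" unfolding D_def by (rule log_holder_small_ball[OF lh C x True])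
    finally show ?thesis using C by linarith
  next
    case False
    then have "ln (exp (-1)) \<le> ln r" by (intro ln_mono) auto
    then have "L = 1" by (simp add: L_def)
    then show ?thesis using D2 by simp
  qed
  have up: "ln ?U \<le> (ln N + \<bar>ln I\<bar> + \<bar>ln ?w\<bar>) + ?n * L"
  proof -
    have "ln ?U \<le> ln (N * (I / ?v) powr \<rho>)" using U avg_upper[OF r, of z] by (intro ln_mono) auto
    also have "\<dots> = ln N + \<rho> * (ln I - (ln ?w + ?n * ln r))"
    proof -
      have "ln ?v = ln ?w + ?n * ln r" using w r by (subst ln_mult_pos) (auto simp: ln_realpow)
      then have "ln (I / ?v) = ln I - (ln ?w + ?n * ln r)" by (simp only: ln_divide_pos[OF I v])
      moreover have "ln (N * Q powr \<rho>) = ln N + \<rho> * ln Q" if "0 < Q" for Q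
        using that N by (simp add: ln_mult_pos)
      from this[OF divide_pos_pos[OF I v]] have "ln (N * (I / ?v) powr \<rho>) = ln N + \<rho> * ln (I / ?v)" .
      ultimately show ?thesis by (simp only:)
    qed
    also have "\<dots> \<le> ln N + 1 * (\<bar>ln I\<bar> + \<bar>ln ?w\<bar> + ?n * L)"
    proof -
      have "ln I - (ln ?w + ?n * ln r) \<le> \<bar>ln I\<bar> + \<bar>ln ?w\<bar> + ?n * L"
      proof -
        have "?n * (- ln r) \<le> ?n * L" by (intro mult_left_mono) (auto simp: L_def)
        then show ?thesis by simp
      qed
      then have "\<rho> * (ln I - (ln ?w + ?n * ln r)) \<le> \<rho> * (\<bar>ln I\<bar> + \<bar>ln ?w\<bar> + ?n * L)"
        using \<rho> by (intro mult_left_mono) auto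
      also have "\<dots> \<le> 1 * (\<bar>ln I\<bar> + \<bar>ln ?w\<bar> + ?n * L)"
        using \<rho> by (intro mult_right_mono) (auto simp: L_def)
      finally show ?thesis by simp
    qed
    finally show ?thesis by simp
  qed
  have low: "- ln ?U \<le> (?n / \<rho>) * (1 + ln (exp 1 + norm z))"
  proof -
    have "exp 1 + norm y \<le> 2 * (exp 1 + norm z)" if "y \<in> ball z r" for y
    proof -
      have d: "norm y < norm z + r" using that norm_triangle_sub[of y z] by (simp add: dist_norm norm_minus_commute)
      show ?thesis using good
      proof
        assume "r < exp (-1)"
        then have "r < 1" using exp_minus_one_less_half by linarith
        then show ?thesis using d e2 norm_ge_zero[of z] by argo
      next
        assume "3 * r < norm z"
        then show ?thesis using d e2 r by argo
      qed
    qed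
    then have l: "(2 * (exp 1 + norm z)) powr - (?n / \<rho>) \<le> ?U" by (rule avg_lower[OF r])
    have p: "0 < exp 1 + norm z" by (simp add: add_pos_nonneg)
    have "ln ((2 * (exp 1 + norm z)) powr - (?n / \<rho>)) \<le> ln ?U" using p by (intro ln_mono l) simp
    then have "- ln ?U \<le> (?n / \<rho>) * ln (2 * (exp 1 + norm z))" by (simp only: ln_powr)
    also have "ln (2 * (exp 1 + norm z)) = ln 2 + ln (exp 1 + norm z)" using p by (intro ln_mult_pos) auto
    also have "(?n / \<rho>) * (ln 2 + ln (exp 1 + norm z)) \<le> (?n / \<rho>) * (1 + ln (exp 1 + norm z))"
      using \<rho> ln_2_less_1 by (intro mult_left_mono) auto
    finally show ?thesis .
  qed
  have nn: "0 \<le> (ln N + \<bar>ln I\<bar> + \<bar>ln ?w\<bar>) + ?n * L" "0 \<le> (?n / \<rho>) * (1 + ln (exp 1 + norm z))"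
    using N \<rho> ln_e_norm_ge_1[of z] by (auto simp: L_def intro!: add_nonneg_nonneg mult_nonneg_nonneg)
  have "\<bar>ln ?U\<bar> \<le> (ln N + \<bar>ln I\<bar> + \<bar>ln ?w\<bar>) + ?n * L + (?n / \<rho>) * (1 + ln (exp 1 + norm z))"
    using up low nn by linarith
  then have "D * \<bar>ln ?U\<bar> \<le> D * ((ln N + \<bar>ln I\<bar> + \<bar>ln ?w\<bar>) + ?n * L + (?n / \<rho>) * (1 + ln (exp 1 + norm z)))"
    by (rule mult_left_mono) (simp add: D_def)
  also have "\<dots> = D * (ln N + \<bar>ln I\<bar> + \<bar>ln ?w\<bar>) + ?n * (D * L) + (?n / \<rho>) * (D + D * ln (exp 1 + norm z))"
    by (simp add: algebra_simps)
  also have "\<dots> \<le> 2 * C * (ln N + \<bar>ln I\<bar> + \<bar>ln ?w\<bar>) + ?n * (2 * C) + (?n / \<rho>) * (2 * C + 3 * C)"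
    using D2 DL Dln N \<rho> by (intro add_mono mult_right_mono mult_left_mono) auto
  finally show ?thesis unfolding D_def by (simp add: algebra_simps)
qed

text \<open>
  On a large ball around the origin the exponent is not nearly constant. There the error terms
  integrate to a constant over the whole space, and this lemma says that a constant is small
  enough.
\<close>
lemma bad_ball_lower_bound:
  obtains c where "0 < c"
    "\<And>r z s. exp (-1) \<le> r \<Longrightarrow> norm z \<le> 3 * r \<Longrightarrow> \<bar>s\<bar> \<le> \<rho> \<Longrightarrow> c \<le> ball_avg u z r powr s * vol TYPE('a) r"
proof -
  let ?n = "real DIM('a)" and ?w = "unit_ball_vol DIM('a)"
  define v0 where "v0 = vol TYPE('a) (exp (-1))"
  have v0: "0 < v0" unfolding v0_def by (rule vol_pos) simp
  define U1 where "U1 = max 1 (N * (I / v0) powr \<rho>)"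
  have U1: "1 \<le> U1" by (simp add: U1_def)
  show ?thesis
  proof (rule that[of "min (?w / 13 powr ?n) (v0 / U1)"])
    show "0 < min (?w / 13 powr ?n) (v0 / U1)" using v0 U1 by simp
  next
    fix r and z :: 'a and s assume r': "exp (-1) \<le> r" and z: "norm z \<le> 3 * r" and s: "\<bar>s\<bar> \<le> \<rho>"
    let ?U = "ball_avg u z r" and ?v = "vol TYPE('a) r"
    have r: "0 < r" using r' by (metis exp_gt_zero less_le_trans)
    have v: "0 < ?v" using r by (rule vol_pos)
    have U: "0 < ?U" using r by (rule avg_pos)
    have v0v: "v0 \<le> ?v" unfolding v0_def using r' by (intro mult_left_mono power_mono) auto
    have r3: "1 \<le> 3 * r"
    proof -
      have "exp 1 * exp (-1) \<le> 3 * r" using r' exp_le by (intro mult_mono) auto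
      then show ?thesis by (simp flip: exp_add)
    qed
    \<comment> \<open>Here \<open>norm y \<le> 4 r\<close>, and \<open>e \<le> 3 \<le> 9 r\<close>.\<close>
    have "exp 1 + norm y \<le> 13 * r" if "y \<in> ball z r" for y
      using that norm_triangle_sub[of y z] z r3 exp_le by (auto simp: dist_norm norm_minus_commute)
    then have low: "(13 * r) powr - (?n / \<rho>) \<le> ?U" by (rule avg_lower[OF r])
    show "min (?w / 13 powr ?n) (v0 / U1) \<le> ?U powr s * ?v"
    proof (cases "0 \<le> s")
      case True
      have "(13 * r) powr - ?n \<le> (13 * r) powr (- (?n / \<rho>) * s)"
      proof (rule powr_mono)
        have "?n * s \<le> ?n * \<rho>" using s by (intro mult_left_mono) auto
        then show "- ?n \<le> - (?n / \<rho>) * s" using \<rho> by (simp add: field_simps)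
        show "1 \<le> 13 * r" using r3 by simp
      qed
      also have "\<dots> = ((13 * r) powr - (?n / \<rho>)) powr s" by (simp only: powr_powr)
      also have "\<dots> \<le> ?U powr s" using low True by (intro powr_mono2) auto
      finally have "(13 * r) powr - ?n * ?v \<le> ?U powr s * ?v" using v by (intro mult_right_mono) auto
      moreover have "(13 * r) powr - ?n * ?v = ?w / 13 powr ?n"
        using r by (simp add: powr_minus powr_mult powr_realpow field_simps)
      ultimately show ?thesis by linarith
    next
      case False
      have "?U \<le> N * (I / ?v) powr \<rho>" by (rule avg_upper[OF r])
      also have "\<dots> \<le> N * (I / v0) powr \<rho>"
        using v0v v0 v I N \<rho> by (intro mult_left_mono powr_mono2 divide_left_mono mult_pos_pos[of ?v]) auto
      finally have "?U \<le> U1" by (simp add: U1_def)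
      then have "U1 powr s \<le> ?U powr s" using False U by (intro powr_mono2') auto
      moreover have "U1 powr - 1 \<le> U1 powr s" using s \<rho> U1 by (intro powr_mono) auto
      ultimately have "inverse U1 \<le> ?U powr s" using U1 by (simp add: powr_minus)
      then have "inverse U1 * v0 \<le> ?U powr s * ?v" using v0v v0 U1 by (intro mult_mono) auto
      then show ?thesis by (simp add: field_simps)
    qed
  qed
qed

text \<open>
  On the first kind of balls the exponent is frozen at the centre. On the others it is replaced by
  its limit at infinity where \<open>u < 1\<close>, since there \<open>|ln u|\<close> is at most of the order \<open>ln (e + norm y)\<close>;
  where \<open>u \<ge> 1\<close> the power is dominated by the integrable function \<open>u powr (1 / \<rho>)\<close>.
\<close>
lemma variable_power_integral:
  assumes lh: "log_holder b b_inf C" and C: "0 \<le> C"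
    and b [measurable]: "b \<in> borel_measurable lebesgue" and b\<rho>: "\<And>x. \<bar>b x\<bar> \<le> \<rho>"
  obtains K where "0 \<le> K"
    "\<And>z r. 0 < r \<Longrightarrow> (\<integral>\<^sup>+y\<in>ball z r. ennreal (u y powr b y) \<partial>lebesgue)
       \<le> ennreal (K * ball_avg u z r powr ball_exponent b b_inf z r * vol TYPE('a) r)"
proof -
  let ?n = "real DIM('a)" and ?w = "unit_ball_vol DIM('a)"
  define E1 where "E1 = exp (2 * C * (ln N + \<bar>ln I\<bar> + \<bar>ln ?w\<bar> + ?n) + 5 * C * (?n / \<rho>))"
  define E2 where "E2 = exp (?n / \<rho> * C)"
  have E: "0 < E1" "0 < E2" by (simp_all add: E1_def E2_def)
  obtain c where c: "0 < c" and c_le: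
    "\<And>r z s. exp (-1) \<le> r \<Longrightarrow> norm z \<le> 3 * r \<Longrightarrow> \<bar>s\<bar> \<le> \<rho> \<Longrightarrow> c \<le> ball_avg u z r powr s * vol TYPE('a) r"
    by (rule bad_ball_lower_bound) blast
  have b_le: "\<bar>b x\<bar> \<le> 1" for x using b\<rho>[of x] \<rho> by linarith
  have b_inf: "\<bar>b_inf\<bar> \<le> \<rho>"
    using log_holder_inf_ge[OF lh, of "- \<rho>"] log_holder_inf_le[OF lh, of \<rho>] b\<rho> by (simp add: abs_le_iff minus_le_iff)
  define K where "K = max (E1 * (N + 1)) (E2 * (N + 1) + I / c)"
  show ?thesis
  proof (rule that[of K])
    show "0 \<le> K" using E N by (auto simp: K_def le_max_iff_disj)
  next
    fix z :: 'a and r :: real assume r: "0 < r"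
    let ?U = "ball_avg u z r" and ?v = "vol TYPE('a) r"
    have v: "0 < ?v" using r by (rule vol_pos)
    have U: "0 < ?U" using r by (rule avg_pos)
    show "(\<integral>\<^sup>+y\<in>ball z r. ennreal (u y powr b y) \<partial>lebesgue)
       \<le> ennreal (K * ?U powr ball_exponent b b_inf z r * ?v)"
    proof (cases "r < exp (-1) \<or> 3 * r < norm z")
      case True
      then have be: "ball_exponent b b_inf z r = b z" by (simp add: ball_exponent_def)
      have "(\<integral>\<^sup>+y\<in>ball z r. ennreal (u y powr b y) \<partial>lebesgue)
          \<le> (\<integral>\<^sup>+y\<in>ball z r. ennreal (E1 * ?U powr b z) * ennreal ((u y / ?U) powr b y) \<partial>lebesgue)"
      proof (rule nn_integral_mono)
        fix y
        show "ennreal (u y powr b y) * indicator (ball z r) y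
           \<le> ennreal (E1 * ?U powr b z) * ennreal ((u y / ?U) powr b y) * indicator (ball z r) y"
        proof (cases "y \<in> ball z r")
          case y: True
          have "u y powr b y = (u y / ?U) powr b y * ?U powr b y"
            using U u_pos[of y] by (simp add: powr_divide)
          also have "\<dots> \<le> (u y / ?U) powr b y * (E1 * ?U powr b z)"
            unfolding E1_def using good_ball_oscillation[OF lh C r True y] U
            by (intro mult_left_mono powr_change_exponent) auto
          finally have "ennreal (u y powr b y) \<le> ennreal ((E1 * ?U powr b z) * (u y / ?U) powr b y)"
            by (intro ennreal_leI) (simp add: mult.commute)
          then show ?thesis using y E by (simp add: ennreal_mult')
        qed auto
      qed
      also have "\<dots> = ennreal (E1 * ?U powr b z) * (\<integral>\<^sup>+y\<in>ball z r. ennreal ((u y / ?U) powr b y) \<partial>lebesgue)"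
        by (rule set_nn_integral_cmult) measurable
      also have "\<dots> \<le> ennreal (E1 * ?U powr b z) * ennreal ((N + 1) * ?v)"
        using r by (intro mult_left_mono normalised_power_integral b b_le) auto
      also have "\<dots> = ennreal ((E1 * (N + 1)) * (?U powr b z * ?v))"
        using E by (subst ennreal_mult'[symmetric]) (auto simp: mult_ac)
      also have "\<dots> \<le> ennreal (K * (?U powr b z * ?v))"
        using v by (intro ennreal_leI mult_right_mono) (auto simp: K_def)
      finally show ?thesis by (simp add: be mult.assoc)
    next
      case False
      then have be: "ball_exponent b b_inf z r = b_inf" by (simp add: ball_exponent_def)
      have cU: "c \<le> ?U powr b_inf * ?v" using False b_inf by (intro c_le) auto
      have "(\<integral>\<^sup>+y\<in>ball z r. ennreal (u y powr b y) \<partial>lebesgue)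
          \<le> (\<integral>\<^sup>+y. ennreal (E2 * ?U powr b_inf) * ennreal ((u y / ?U) powr b_inf) * indicator (ball z r) y
                + ennreal (u y powr (1 / \<rho>)) \<partial>lebesgue)"
      proof (rule nn_integral_mono)
        fix y
        show "ennreal (u y powr b y) * indicator (ball z r) y
           \<le> ennreal (E2 * ?U powr b_inf) * ennreal ((u y / ?U) powr b_inf) * indicator (ball z r) y + ennreal (u y powr (1 / \<rho>))"
        proof (cases "y \<in> ball z r")
          case y: True
          show ?thesis
          proof (cases "1 \<le> u y")
            case True
            have "u y powr b y \<le> u y powr (1 / \<rho>)"
            proof (rule powr_mono)
              have "1 \<le> 1 / \<rho>" using \<rho> by simp
              then show "b y \<le> 1 / \<rho>" using b_le[of y] by linarith
            qed (rule True)
            then have "ennreal (u y powr b y) \<le> ennreal (u y powr (1 / \<rho>))" by (rule ennreal_leI)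
            then show ?thesis using y by (simp add: add_increasing)
          next
            case False
            have p: "0 < exp 1 + norm y" by (simp add: add_pos_nonneg)
            have "ln ((exp 1 + norm y) powr - (?n / \<rho>)) \<le> ln (u y)" using p by (intro ln_mono low) simp
            then have "\<bar>ln (u y)\<bar> \<le> (?n / \<rho>) * ln (exp 1 + norm y)"
              using False u_pos[of y] p by (simp add: ln_powr)
            then have "\<bar>b y - b_inf\<bar> * \<bar>ln (u y)\<bar> \<le> \<bar>b y - b_inf\<bar> * ((?n / \<rho>) * ln (exp 1 + norm y))"
              by (rule mult_left_mono) simp
            also have "\<dots> = (?n / \<rho>) * (\<bar>b y - b_inf\<bar> * ln (exp 1 + norm y))" by (simp only: mult_ac)
            also have "\<dots> \<le> (?n / \<rho>) * C"
              using log_holder_infinity(1)[OF lh, of y] \<rho> by (intro mult_left_mono) auto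
            finally have "u y powr b y \<le> E2 * u y powr b_inf"
              unfolding E2_def by (intro powr_change_exponent u_pos)
            also have "\<dots> = (E2 * ?U powr b_inf) * (u y / ?U) powr b_inf"
              using U u_pos[of y] by (simp add: powr_divide)
            finally have "ennreal (u y powr b y) \<le> ennreal ((E2 * ?U powr b_inf) * (u y / ?U) powr b_inf)"
              by (rule ennreal_leI)
            then show ?thesis using y E by (simp add: ennreal_mult' add_increasing2)
          qed
        qed auto
      qed
      also have "\<dots> = (\<integral>\<^sup>+y\<in>ball z r. ennreal (E2 * ?U powr b_inf) * ennreal ((u y / ?U) powr b_inf) \<partial>lebesgue)
           + (\<integral>\<^sup>+y. ennreal (u y powr (1 / \<rho>)) \<partial>lebesgue)"
        by (rule nn_integral_add) measurable
      also have "(\<integral>\<^sup>+y\<in>ball z r. ennreal (E2 * ?U powr b_inf) * ennreal ((u y / ?U) powr b_inf) \<partial>lebesgue)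
          = ennreal (E2 * ?U powr b_inf) * (\<integral>\<^sup>+y\<in>ball z r. ennreal ((u y / ?U) powr b_inf) \<partial>lebesgue)"
        by (rule set_nn_integral_cmult) measurable
      also have "\<dots> + (\<integral>\<^sup>+y. ennreal (u y powr (1 / \<rho>)) \<partial>lebesgue)
          \<le> ennreal (E2 * ?U powr b_inf) * ennreal ((N + 1) * ?v) + ennreal I"
        using r b_inf \<rho> by (intro add_mono mult_left_mono normalised_power_integral integrable) auto
      also have "\<dots> = ennreal ((E2 * (N + 1)) * (?U powr b_inf * ?v) + I)"
      proof -
        have nn: "0 \<le> E2 * ?U powr b_inf" "0 \<le> (E2 * ?U powr b_inf) * ((N + 1) * ?v)"
          using E N v by (auto intro!: mult_nonneg_nonneg simp del: mult_pos_pos zero_le_mult_iff)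
        have "ennreal (E2 * ?U powr b_inf) * ennreal ((N + 1) * ?v) + ennreal I
            = ennreal ((E2 * ?U powr b_inf) * ((N + 1) * ?v) + I)"
          using I by (simp only: ennreal_mult'[OF nn(1)] ennreal_plus[OF nn(2) less_imp_le])
        then show ?thesis by (simp only: mult_ac)
      qed
      also have "\<dots> \<le> ennreal ((E2 * (N + 1) + I / c) * (?U powr b_inf * ?v))"
      proof (rule ennreal_leI)
        have "I = I / c * c" using c by simp
        also have "\<dots> \<le> I / c * (?U powr b_inf * ?v)" using cU I c by (intro mult_left_mono) auto
        finally show "(E2 * (N + 1)) * (?U powr b_inf * ?v) + I \<le> (E2 * (N + 1) + I / c) * (?U powr b_inf * ?v)"
          by (simp only: distrib_right add_left_mono)
      qed
      also have "\<dots> \<le> ennreal (K * (?U powr b_inf * ?v))"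
        using v by (intro ennreal_leI mult_right_mono) (auto simp: K_def)
      finally show ?thesis by (simp add: be mult.assoc)
    qed
  qed
qed

text \<open>
  The two averages are estimated by powers of the same number with opposite exponents, which
  cancel.
\<close>
theorem variable_power_A2:
  assumes lh: "log_holder b b_inf C" and C: "0 \<le> C"
    and b [measurable]: "b \<in> borel_measurable lebesgue" and b\<rho>: "\<And>x. \<bar>b x\<bar> \<le> \<rho>"
  obtains K where "0 \<le> K"
    "\<And>z r. 0 < r \<Longrightarrow> (\<integral>\<^sup>+y\<in>ball z r. ennreal (u y powr b y) \<partial>lebesgue) * (\<integral>\<^sup>+y\<in>ball z r. ennreal (u y powr - b y) \<partial>lebesgue)
       \<le> ennreal (K * (vol TYPE('a) r)\<^sup>2)"
proof -
  obtain K1 where K1: "0 \<le> K1" "\<And>z r. 0 < r \<Longrightarrow> (\<integral>\<^sup>+y\<in>ball z r. ennreal (u y powr b y) \<partial>lebesgue)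
       \<le> ennreal (K1 * ball_avg u z r powr ball_exponent b b_inf z r * vol TYPE('a) r)"
    by (rule variable_power_integral[OF lh C b b\<rho>]) (rule that; assumption)
  have m: "(\<lambda>x. - b x) \<in> borel_measurable lebesgue" by measurable
  have b\<rho>': "\<bar>- b x\<bar> \<le> \<rho>" for x using b\<rho>[of x] by simp
  obtain K2 where K2: "0 \<le> K2" "\<And>z r. 0 < r \<Longrightarrow> (\<integral>\<^sup>+y\<in>ball z r. ennreal (u y powr - b y) \<partial>lebesgue)
       \<le> ennreal (K2 * ball_avg u z r powr - ball_exponent b b_inf z r * vol TYPE('a) r)"
    by (rule variable_power_integral[OF log_holder_uminus[OF lh] C m b\<rho>', unfolded ball_exponent_uminus]) (rule that; assumption)
  show ?thesis
  proof (rule that[of "K1 * K2"])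
    fix z :: 'a and r :: real assume r: "0 < r"
    let ?U = "ball_avg u z r" and ?e = "ball_exponent b b_inf z r" and ?v = "vol TYPE('a) r"
    have "(\<integral>\<^sup>+y\<in>ball z r. ennreal (u y powr b y) \<partial>lebesgue) * (\<integral>\<^sup>+y\<in>ball z r. ennreal (u y powr - b y) \<partial>lebesgue)
       \<le> ennreal (K1 * ?U powr ?e * ?v) * ennreal (K2 * ?U powr - ?e * ?v)"
      using K1(2)[OF r, of z] K2(2)[OF r, of z] by (intro mult_mono) auto
    also have "\<dots> = ennreal ((K1 * ?U powr ?e * ?v) * (K2 * ?U powr - ?e * ?v))"
      using K1 vol_pos[OF r, where 'a = 'a] by (intro ennreal_mult'[symmetric]) (simp add: less_imp_le)
    also have "(K1 * ?U powr ?e * ?v) * (K2 * ?U powr - ?e * ?v) = K1 * K2 * ?v\<^sup>2"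
      using avg_pos[OF r, of z] by (simp add: powr_minus power2_eq_square field_simps)
    finally show "(\<integral>\<^sup>+y\<in>ball z r. ennreal (u y powr b y) \<partial>lebesgue) * (\<integral>\<^sup>+y\<in>ball z r. ennreal (u y powr - b y) \<partial>lebesgue)
       \<le> ennreal (K1 * K2 * ?v\<^sup>2)" .
  qed (use K1 K2 in simp)
qed

end

section \<open>The classical Muckenhoupt class\<close>

lemma A2I:
  fixes y :: "'a::euclidean_space \<Rightarrow> ennreal"
  assumes y: "y \<in> borel_measurable lebesgue" "AE x in lebesgue. 0 < y x \<and> y x < \<infinity>"
    and bound: "\<And>z r. 0 < r \<Longrightarrow> (\<integral>\<^sup>+x\<in>ball z r. y x \<partial>lebesgue) * (\<integral>\<^sup>+x\<in>ball z r. inverse (y x) \<partial>lebesgue)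
        \<le> ennreal (K * (vol TYPE('a) r)\<^sup>2)"
  shows "y \<in> A2"
proof -
  have "(\<integral>\<^sup>+x\<in>ball z r. y x \<partial>lebesgue) / emeasure lebesgue (ball z r) *
        ((\<integral>\<^sup>+x\<in>ball z r. inverse (y x) \<partial>lebesgue) / emeasure lebesgue (ball z r)) \<le> ennreal K"
    if r: "0 < r" for z :: 'a and r
  proof -
    define v where "v = vol TYPE('a) r"
    have v: "0 < v" using r by (simp add: v_def)
    have V: "emeasure lebesgue (ball z r) = ennreal v" unfolding v_def using r by (intro emeasure_lebesgue_ball) simp
    have "(\<integral>\<^sup>+x\<in>ball z r. y x \<partial>lebesgue) / ennreal v * ((\<integral>\<^sup>+x\<in>ball z r. inverse (y x) \<partial>lebesgue) / ennreal v)
      = ((\<integral>\<^sup>+x\<in>ball z r. y x \<partial>lebesgue) * (\<integral>\<^sup>+x\<in>ball z r. inverse (y x) \<partial>lebesgue)) * ennreal (inverse v * inverse v)"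
      using v by (simp add: divide_ennreal_def inverse_ennreal ennreal_mult' mult_ac)
    also have "\<dots> \<le> ennreal (K * v\<^sup>2) * ennreal (inverse v * inverse v)"
      using bound[OF r, of z] unfolding v_def by (rule mult_right_mono) simp
    also have "\<dots> = ennreal K"
    proof -
      have "K * v\<^sup>2 * (inverse v * inverse v) = K" using v by (simp add: power2_eq_square field_simps)
      then show ?thesis by (subst ennreal_mult''[symmetric], simp) (simp only:)
    qed
    finally show ?thesis unfolding V .
  qed
  then have "(SUP (z, r)\<in>UNIV \<times> {0<..}.
        ((\<integral>\<^sup>+x\<in>ball z r. y x \<partial>lebesgue) / emeasure lebesgue (ball z r)) *
        ((\<integral>\<^sup>+x\<in>ball z r. inverse (y x) \<partial>lebesgue) / emeasure lebesgue (ball z r))) \<le> ennreal K"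
    by (intro SUP_least) auto
  also have "\<dots> < \<infinity>" by simp
  finally show ?thesis using y by (auto simp: A2_def weights_def)
qed

lemma A2D:
  fixes y :: "'a::euclidean_space \<Rightarrow> ennreal"
  assumes "y \<in> A2"
  obtains K where "0 \<le> K" "\<And>z r. 0 < r \<Longrightarrow>
      (\<integral>\<^sup>+x\<in>ball z r. y x \<partial>lebesgue) * (\<integral>\<^sup>+x\<in>ball z r. inverse (y x) \<partial>lebesgue) \<le> ennreal (K * (vol TYPE('a) r)\<^sup>2)"
proof -
  define S where "S = (SUP (z::'a, r)\<in>UNIV \<times> {0<..}.
        ((\<integral>\<^sup>+x\<in>ball z r. y x \<partial>lebesgue) / emeasure lebesgue (ball z r)) *
        ((\<integral>\<^sup>+x\<in>ball z r. inverse (y x) \<partial>lebesgue) / emeasure lebesgue (ball z r)))"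
  have "S < \<infinity>" using assms by (simp add: A2_def S_def)
  then obtain K where K: "S = ennreal K" "0 \<le> K" by (cases S) auto
  show ?thesis
  proof (rule that[OF K(2)])
    fix z :: 'a and r :: real assume r: "0 < r"
    define v where "v = vol TYPE('a) r"
    have v: "0 < v" using r by (simp add: v_def)
    have V: "emeasure lebesgue (ball z r) = ennreal v" unfolding v_def using r by (intro emeasure_lebesgue_ball) simp
    let ?a = "\<integral>\<^sup>+x\<in>ball z r. y x \<partial>lebesgue" and ?b = "\<integral>\<^sup>+x\<in>ball z r. inverse (y x) \<partial>lebesgue"
    have "?a / ennreal v * (?b / ennreal v) \<le> S"
      unfolding S_def V[symmetric] by (rule SUP_upper2[of "(z, r)"]) (use r in auto)
    then have "?a / ennreal v * (?b / ennreal v) * ennreal (v * v) \<le> ennreal K * ennreal (v * v)"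
      unfolding K by (rule mult_right_mono) simp
    also have "\<dots> = ennreal (K * v\<^sup>2)" using K by (simp add: ennreal_mult'[symmetric] power2_eq_square)
    also have "?a / ennreal v * (?b / ennreal v) * ennreal (v * v) = (?a / ennreal v * ennreal v) * (?b / ennreal v * ennreal v)"
      using v by (simp add: ennreal_mult' mult_ac)
    also have "\<dots> = ?a * ?b" by (simp only: ennreal_divide_times_self[OF v])
    finally show "?a * ?b \<le> ennreal (K * (vol TYPE('a) r)\<^sup>2)" unfolding v_def .
  qed
qed

lemma A2_cong_AE:
  fixes y :: "'a::euclidean_space \<Rightarrow> ennreal"
  assumes y: "y \<in> A2" and y': "y' \<in> borel_measurable lebesgue" and eq: "AE x in lebesgue. y x = y' x"
  shows "y' \<in> A2"
proof -
  obtain K where K: "\<And>z r. 0 < r \<Longrightarrow>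
      (\<integral>\<^sup>+x\<in>ball z r. y x \<partial>lebesgue) * (\<integral>\<^sup>+x\<in>ball z r. inverse (y x) \<partial>lebesgue) \<le> ennreal (K * (vol TYPE('a) r)\<^sup>2)"
    by (rule A2D[OF y]) blast
  have pos: "AE x in lebesgue. 0 < y x \<and> y x < \<infinity>" using y by (simp add: A2_def)
  show ?thesis
  proof (rule A2I[OF y'])
    show "AE x in lebesgue. 0 < y' x \<and> y' x < \<infinity>" using pos eq by eventually_elim simp
    fix z :: 'a and r :: real assume r: "0 < r"
    have 1: "(\<integral>\<^sup>+x\<in>ball z r. y' x \<partial>lebesgue) = (\<integral>\<^sup>+x\<in>ball z r. y x \<partial>lebesgue)"
      by (rule nn_integral_cong_AE) (use eq in eventually_elim, simp)
    have 2: "(\<integral>\<^sup>+x\<in>ball z r. inverse (y' x) \<partial>lebesgue) = (\<integral>\<^sup>+x\<in>ball z r. inverse (y x) \<partial>lebesgue)"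
      by (rule nn_integral_cong_AE) (use eq in eventually_elim, simp)
    show "(\<integral>\<^sup>+x\<in>ball z r. y' x \<partial>lebesgue) * (\<integral>\<^sup>+x\<in>ball z r. inverse (y' x) \<partial>lebesgue) \<le> ennreal (K * (vol TYPE('a) r)\<^sup>2)"
      unfolding 1 2 by (rule K[OF r])
  qed
qed

lemma set_integral_pos:
  fixes y :: "'a::euclidean_space \<Rightarrow> real"
  assumes [measurable]: "y \<in> borel_measurable lebesgue" and pos: "\<And>x. 0 < y x" and r: "0 < r"
  shows "0 < (\<integral>\<^sup>+x\<in>ball z r. ennreal (y x) \<partial>lebesgue)"
proof (rule ccontr)
  assume "\<not> ?thesis"
  then have "(\<integral>\<^sup>+x\<in>ball z r. ennreal (y x) \<partial>lebesgue) = 0" by simp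
  then have "AE x in lebesgue. ennreal (y x) * indicator (ball z r) x = 0"
    by (subst (asm) nn_integral_0_iff_AE) auto
  then have "AE x in lebesgue. x \<in> ball z r \<longrightarrow> ennreal (y x) = 0"
    by eventually_elim (auto simp: indicator_def)
  then obtain x where "ennreal (y x) = 0" using r by (rule AE_ballE)
  then show False using pos[of x] by (simp add: ennreal_eq_0_iff)
qed

text \<open>
  Hoelder's inequality with exponents \<open>1 / (1 - \<rho>)\<close> and \<open>1 / \<rho>\<close>, by Young's inequality for the
  normalised functions.
\<close>
lemma holder_interpolation:
  fixes f g :: "'a \<Rightarrow> real"
  assumes [measurable]: "f \<in> borel_measurable M" "g \<in> borel_measurable M" "A \<in> sets M"
    and pos: "\<And>x. 0 < f x" "\<And>x. 0 < g x" and \<rho>: "0 < \<rho>" "\<rho> < 1"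
    and X: "(\<integral>\<^sup>+x\<in>A. ennreal (f x) \<partial>M) = ennreal X" "0 < X"
    and Y: "(\<integral>\<^sup>+x\<in>A. ennreal (g x) \<partial>M) = ennreal Y" "0 < Y"
  shows "(\<integral>\<^sup>+x\<in>A. ennreal (f x powr (1 - \<rho>) * g x powr \<rho>) \<partial>M) \<le> ennreal (X powr (1 - \<rho>) * Y powr \<rho>)"
proof -
  let ?c = "X powr (1 - \<rho>) * Y powr \<rho>"
  have c: "0 < ?c" using X Y by simp
  have "(\<integral>\<^sup>+x\<in>A. ennreal (f x powr (1 - \<rho>) * g x powr \<rho>) \<partial>M)
      \<le> (\<integral>\<^sup>+x. ennreal (?c * (1 - \<rho>) / X) * (ennreal (f x) * indicator A x) + ennreal (?c * \<rho> / Y) * (ennreal (g x) * indicator A x) \<partial>M)"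
  proof (rule nn_integral_mono)
    fix x
    have "(f x / X) powr (1 - \<rho>) * (g x / Y) powr \<rho> \<le> (1 - \<rho>) * (f x / X) + \<rho> * (g x / Y)"
      using pos[of x] X Y \<rho> by (intro Youngs_inequality_0) auto
    then have "?c * ((f x / X) powr (1 - \<rho>) * (g x / Y) powr \<rho>) \<le> ?c * ((1 - \<rho>) * (f x / X) + \<rho> * (g x / Y))"
      using c by (intro mult_left_mono) auto
    moreover have "?c * ((f x / X) powr (1 - \<rho>) * (g x / Y) powr \<rho>) = f x powr (1 - \<rho>) * g x powr \<rho>"
      using pos[of x] X Y by (simp add: powr_divide)
    ultimately have "f x powr (1 - \<rho>) * g x powr \<rho> \<le> (?c * (1 - \<rho>) / X) * f x + (?c * \<rho> / Y) * g x"
      by (simp add: algebra_simps)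
    then have "ennreal (f x powr (1 - \<rho>) * g x powr \<rho>) \<le> ennreal ((?c * (1 - \<rho>) / X) * f x + (?c * \<rho> / Y) * g x)"
      by (rule ennreal_leI)
    also have "\<dots> = ennreal (?c * (1 - \<rho>) / X) * ennreal (f x) + ennreal (?c * \<rho> / Y) * ennreal (g x)"
    proof -
      have nn: "0 \<le> ?c * (1 - \<rho>) / X" "0 \<le> ?c * \<rho> / Y"
        using c X Y \<rho> by (auto intro!: divide_nonneg_pos mult_nonneg_nonneg)
      have nn2: "0 \<le> ?c * (1 - \<rho>) / X * f x" "0 \<le> ?c * \<rho> / Y * g x"
        using nn pos[of x] by (auto intro!: mult_nonneg_nonneg less_imp_le simp del: times_divide_eq_left)
      show ?thesis by (simp only: ennreal_plus[OF nn2] ennreal_mult'[OF nn(1)] ennreal_mult'[OF nn(2)])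
    qed
    finally show "ennreal (f x powr (1 - \<rho>) * g x powr \<rho>) * indicator A x
      \<le> ennreal (?c * (1 - \<rho>) / X) * (ennreal (f x) * indicator A x) + ennreal (?c * \<rho> / Y) * (ennreal (g x) * indicator A x)"
      by (auto simp: indicator_def)
  qed
  also have "\<dots> = (\<integral>\<^sup>+x. ennreal (?c * (1 - \<rho>) / X) * (ennreal (f x) * indicator A x) \<partial>M)
      + (\<integral>\<^sup>+x. ennreal (?c * \<rho> / Y) * (ennreal (g x) * indicator A x) \<partial>M)"
    by (rule nn_integral_add) measurable
  also have "(\<integral>\<^sup>+x. ennreal (?c * (1 - \<rho>) / X) * (ennreal (f x) * indicator A x) \<partial>M) = ennreal (?c * (1 - \<rho>) / X) * ennreal X"
    unfolding X(1)[symmetric] by (rule nn_integral_cmult) measurable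
  also have "(\<integral>\<^sup>+x. ennreal (?c * \<rho> / Y) * (ennreal (g x) * indicator A x) \<partial>M) = ennreal (?c * \<rho> / Y) * ennreal Y"
    unfolding Y(1)[symmetric] by (rule nn_integral_cmult) measurable
  also have "ennreal (?c * (1 - \<rho>) / X) * ennreal X = ennreal (?c * (1 - \<rho>))"
    using X by (simp add: ennreal_mult''[symmetric])
  also have "ennreal (?c * \<rho> / Y) * ennreal Y = ennreal (?c * \<rho>)"
    using Y by (simp add: ennreal_mult''[symmetric])
  also have "ennreal (?c * (1 - \<rho>)) + ennreal (?c * \<rho>) = ennreal ?c"
  proof -
    have "0 \<le> ?c * (1 - \<rho>)" "0 \<le> ?c * \<rho>" using c \<rho> by (auto intro!: mult_nonneg_nonneg)
    then have "ennreal (?c * (1 - \<rho>)) + ennreal (?c * \<rho>) = ennreal (?c * (1 - \<rho>) + ?c * \<rho>)"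
      by (simp only: ennreal_plus)
    also have "?c * (1 - \<rho>) + ?c * \<rho> = ?c" by (simp add: algebra_simps)
    finally show ?thesis .
  qed
  finally show ?thesis .
qed

lemma A2_averages:
  fixes y :: "'a::euclidean_space \<Rightarrow> real"
  assumes [measurable]: "y \<in> borel_measurable lebesgue" and pos: "\<And>x. 0 < y x" and r: "0 < r"
    and bound: "(\<integral>\<^sup>+x\<in>ball z r. ennreal (y x) \<partial>lebesgue) * (\<integral>\<^sup>+x\<in>ball z r. ennreal (1 / y x) \<partial>lebesgue) \<le> ennreal c"
  obtains X X' where "(\<integral>\<^sup>+x\<in>ball z r. ennreal (y x) \<partial>lebesgue) = ennreal X" "0 < X"
    "(\<integral>\<^sup>+x\<in>ball z r. ennreal (1 / y x) \<partial>lebesgue) = ennreal X'" "0 < X'" "X * X' \<le> c"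
proof -
  let ?a = "\<integral>\<^sup>+x\<in>ball z r. ennreal (y x) \<partial>lebesgue" and ?b = "\<integral>\<^sup>+x\<in>ball z r. ennreal (1 / y x) \<partial>lebesgue"
  have a: "0 < ?a" using pos r by (intro set_integral_pos) measurable
  have b: "0 < ?b" using pos r by (intro set_integral_pos) auto
  have fin: "?a * ?b < \<infinity>" using bound by (simp add: le_less_trans[OF _ ennreal_less_top])
  then have "?a < \<infinity>" "?b < \<infinity>" using a b by (auto simp: ennreal_mult_less_top)
  then obtain X X' where XX: "?a = ennreal X" "?b = ennreal X'" by (metis ennreal_enn2real infinity_ennreal_def)
  then have pos: "0 < X" "0 < X'" using a b by (auto simp: ennreal_less_zero_iff)
  have "ennreal (X * X') \<le> ennreal c" using bound XX pos by (simp add: ennreal_mult')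
  moreover have "0 < X * X'" using pos by simp
  ultimately have "X * X' \<le> c" by (metis ennreal_le_iff2 not_less)
  then show ?thesis using that XX pos by blast
qed

text \<open>
  Hoelder's inequality for both averages in the \<open>A\<^sub>2\<close> condition.
\<close>
lemma A2_log_convex:
  fixes v y :: "'a::euclidean_space \<Rightarrow> real"
  assumes [measurable]: "v \<in> borel_measurable lebesgue" "y \<in> borel_measurable lebesgue"
    and pos: "\<And>x. 0 < v x" "\<And>x. 0 < y x" and \<rho>: "0 < \<rho>" "\<rho> < 1"
    and A2: "(\<lambda>x. ennreal (v x)) \<in> A2" "(\<lambda>x. ennreal (y x)) \<in> A2"
  shows "(\<lambda>x. ennreal (v x powr (1 - \<rho>) * y x powr \<rho>)) \<in> A2"
proof -
  have inv: "inverse (ennreal t) = ennreal (1 / t)" if "0 < t" for t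
    using that by (simp add: inverse_ennreal inverse_eq_divide)
  have iv: "inverse (ennreal (v x)) = ennreal (1 / v x)" "inverse (ennreal (y x)) = ennreal (1 / y x)" for x
    by (intro inv pos)+
  obtain K1 where "0 \<le> K1" "\<And>z r. 0 < r \<Longrightarrow>
      (\<integral>\<^sup>+x\<in>ball z r. ennreal (v x) \<partial>lebesgue) * (\<integral>\<^sup>+x\<in>ball z r. inverse (ennreal (v x)) \<partial>lebesgue) \<le> ennreal (K1 * (vol TYPE('a) r)\<^sup>2)"
    by (rule A2D[OF A2(1)]) blast
  note K1 = this[unfolded iv]
  obtain K2 where "0 \<le> K2" "\<And>z r. 0 < r \<Longrightarrow>
      (\<integral>\<^sup>+x\<in>ball z r. ennreal (y x) \<partial>lebesgue) * (\<integral>\<^sup>+x\<in>ball z r. inverse (ennreal (y x)) \<partial>lebesgue) \<le> ennreal (K2 * (vol TYPE('a) r)\<^sup>2)"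
    by (rule A2D[OF A2(2)]) blast
  note K2 = this[unfolded iv]
  let ?f = "\<lambda>x. v x powr (1 - \<rho>) * y x powr \<rho>"
  have f: "0 < ?f x" for x using pos[of x] by simp
  show ?thesis
  proof (rule A2I[where K = "K1 powr (1 - \<rho>) * K2 powr \<rho>"])
    fix z :: 'a and r :: real assume r: "0 < r"
    define V where "V = vol TYPE('a) r"
    have V: "0 < V" using r by (simp add: V_def)
    obtain X X' where X: "(\<integral>\<^sup>+x\<in>ball z r. ennreal (v x) \<partial>lebesgue) = ennreal X" "0 < X"
      "(\<integral>\<^sup>+x\<in>ball z r. ennreal (1 / v x) \<partial>lebesgue) = ennreal X'" "0 < X'" "X * X' \<le> K1 * V\<^sup>2"
      using A2_averages[OF _ pos(1) r K1(2)[OF r, of z]] unfolding V_def by auto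
    obtain Y Y' where Y: "(\<integral>\<^sup>+x\<in>ball z r. ennreal (y x) \<partial>lebesgue) = ennreal Y" "0 < Y"
      "(\<integral>\<^sup>+x\<in>ball z r. ennreal (1 / y x) \<partial>lebesgue) = ennreal Y'" "0 < Y'" "Y * Y' \<le> K2 * V\<^sup>2"
      using A2_averages[OF _ pos(2) r K2(2)[OF r, of z]] unfolding V_def by auto
    have "inverse (ennreal (?f x)) = ennreal ((1 / v x) powr (1 - \<rho>) * (1 / y x) powr \<rho>)" for x
      using pos[of x] f[of x] by (simp add: inv powr_divide)
    then have "(\<integral>\<^sup>+x\<in>ball z r. ennreal (?f x) \<partial>lebesgue) * (\<integral>\<^sup>+x\<in>ball z r. inverse (ennreal (?f x)) \<partial>lebesgue)
       \<le> ennreal (X powr (1 - \<rho>) * Y powr \<rho>) * ennreal (X' powr (1 - \<rho>) * Y' powr \<rho>)"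
      using pos \<rho> X Y by (simp only:) (intro mult_mono holder_interpolation, auto)
    also have "\<dots> = ennreal ((X * X') powr (1 - \<rho>) * (Y * Y') powr \<rho>)"
      using X Y by (subst ennreal_mult'[symmetric]) (auto simp: powr_mult mult_ac)
    also have "\<dots> \<le> ennreal ((K1 * V\<^sup>2) powr (1 - \<rho>) * (K2 * V\<^sup>2) powr \<rho>)"
    proof -
      have "(X * X') powr (1 - \<rho>) \<le> (K1 * V\<^sup>2) powr (1 - \<rho>)" "(Y * Y') powr \<rho> \<le> (K2 * V\<^sup>2) powr \<rho>"
        by (rule powr_mono2; use X Y \<rho> in simp)+
      then show ?thesis by (intro ennreal_leI mult_mono) auto
    qed
    also have "(K1 * V\<^sup>2) powr (1 - \<rho>) * (K2 * V\<^sup>2) powr \<rho> = K1 powr (1 - \<rho>) * K2 powr \<rho> * ((V\<^sup>2) powr (1 - \<rho>) * (V\<^sup>2) powr \<rho>)"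
      using K1 K2 V by (simp add: powr_mult)
    also have "(V\<^sup>2) powr (1 - \<rho>) * (V\<^sup>2) powr \<rho> = V\<^sup>2" using V by (simp flip: powr_add)
    finally show "(\<integral>\<^sup>+x\<in>ball z r. ennreal (?f x) \<partial>lebesgue) * (\<integral>\<^sup>+x\<in>ball z r. inverse (ennreal (?f x)) \<partial>lebesgue)
       \<le> ennreal (K1 powr (1 - \<rho>) * K2 powr \<rho> * (vol TYPE('a) r)\<^sup>2)" unfolding V_def .
  next
    show "AE x in lebesgue. 0 < ennreal (?f x) \<and> ennreal (?f x) < \<infinity>"
      using f by (intro AE_I2) (simp only: ennreal_less_zero_iff infinity_ennreal_def ennreal_less_top)
  qed measurable
qed

section \<open>Variable Muckenhoupt weights are classical\<close>

text \<open>
  With \<open>e = 1 / p\<close> this says that the norm of the indicator of a ball \<open>B\<close> in \<open>L^p\<close> is at most of the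
  order \<open>|B| powr E\<close>, where \<open>E\<close> is the value of \<open>e\<close> at the centre of a small ball and its limit at
  infinity for a large one. On a large ball the exponent is compared with its limit only where the
  volume is at most a power of \<open>e + norm y\<close>; elsewhere the integrand is below an integrable power
  of \<open>e + norm y\<close>.
\<close>
lemma ball_power_integral:
  fixes e :: "'a::euclidean_space \<Rightarrow> real"
  assumes lh: "log_holder e e_inf C" and C: "0 \<le> C"
    and e [measurable]: "e \<in> borel_measurable lebesgue" and e0: "0 < e0" and ge: "\<And>x. e0 \<le> e x" and le: "\<And>x. e x \<le> 1"
  obtains K where "0 \<le> K"
    "\<And>z r. 0 < r \<Longrightarrow> (\<integral>\<^sup>+y\<in>ball z r. ennreal (vol TYPE('a) r powr - ((if r < exp (-1) then e z else e_inf) / e y)) \<partial>lebesgue) \<le> ennreal K"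
proof -
  let ?n = "real DIM('a)" and ?w = "unit_ball_vol DIM('a)"
  define m where "m = (?n + 1) / e0"
  define a where "a = (\<bar>ln ?w\<bar> + ?n + m) * C / e0"
  define K1 where "K1 = exp a"
  have m0: "0 \<le> m" using e0 by (simp add: m_def)
  have e_pos: "0 < e y" for y using ge[of y] e0 by linarith
  have e_inf: "e0 \<le> e_inf" using log_holder_inf_ge[OF lh ge] .
  obtain J where J: "(\<integral>\<^sup>+x. ennreal ((exp 1 + norm x) powr - (?n + 1)) \<partial>(lebesgue :: 'a measure)) = ennreal J" "0 \<le> J"
    using inverse_polynomial_integrable[where 'a = 'a, of "?n + 1"]
    by (cases "\<integral>\<^sup>+x. ennreal ((exp 1 + norm x) powr - (?n + 1)) \<partial>(lebesgue :: 'a measure)") auto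
  show ?thesis
  proof (rule that[of "K1 + J"])
    show "0 \<le> K1 + J" using J by (simp add: K1_def)
  next
    fix z :: 'a and r :: real assume r: "0 < r"
    define v where "v = vol TYPE('a) r"
    have v: "0 < v" using r by (simp add: v_def)
    have lnv: "ln v = ln ?w + ?n * ln r" unfolding v_def using r by (subst ln_mult_pos) (auto simp: ln_realpow)
    define E where "E = (if r < exp (-1) then e z else e_inf)"
    have pt: "v powr - (E / e y) \<le> K1 / v + (exp 1 + norm y) powr - (?n + 1)" if y: "y \<in> ball z r" for y
    proof -
      have key: "v powr - (E / e y) \<le> K1 / v" if osc: "\<bar>e y - E\<bar> * \<bar>ln v\<bar> \<le> a * e0"
      proof -
        have "\<bar>- (E / e y) - (- 1)\<bar> = \<bar>e y - E\<bar> / e y"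
          using e_pos[of y] by (simp add: field_simps)
        then have "\<bar>- (E / e y) - (- 1)\<bar> * \<bar>ln v\<bar> = \<bar>e y - E\<bar> * \<bar>ln v\<bar> / e y" by simp
        also have "\<dots> \<le> a * e0 / e y" using osc e_pos[of y] by (intro divide_right_mono) auto
        also have "\<dots> \<le> a * e0 / e0"
          using e0 ge[of y] C m0 e_pos[of y] by (intro divide_left_mono) (auto simp: a_def)
        finally have "\<bar>- (E / e y) - (- 1)\<bar> * \<bar>ln v\<bar> \<le> a" using e0 by simp
        then have "v powr - (E / e y) \<le> exp a * v powr - 1" by (rule powr_change_exponent[OF v])
        then show ?thesis using v by (simp add: K1_def powr_minus field_simps)
      qed
      have a_eq: "a * e0 = (\<bar>ln ?w\<bar> + ?n + m) * C" using e0 by (simp add: a_def)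
      show ?thesis
      proof (cases "r < exp (-1)")
        case True
        have E: "E = e z" using True by (simp add: E_def)
        have lnr: "ln r < -1" using True r by (metis ln_exp ln_less_cancel_iff exp_gt_zero)
        have D: "\<bar>e y - E\<bar> * \<bar>ln r\<bar> \<le> C" unfolding E by (rule log_holder_small_ball[OF lh C y True])
        have "\<bar>ln v\<bar> \<le> \<bar>ln ?w\<bar> + ?n * \<bar>ln r\<bar>" unfolding lnv by (metis abs_mult abs_of_nat abs_triangle_ineq)
        also have "\<dots> \<le> (\<bar>ln ?w\<bar> + ?n) * \<bar>ln r\<bar>"
        proof -
          have "\<bar>ln ?w\<bar> * 1 \<le> \<bar>ln ?w\<bar> * \<bar>ln r\<bar>" using lnr by (intro mult_left_mono) auto
          then show ?thesis by (simp only: distrib_right mult_1_right add_left_mono)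
        qed
        also have "\<dots> \<le> (\<bar>ln ?w\<bar> + ?n + m) * \<bar>ln r\<bar>" using m0 by (intro mult_right_mono) auto
        finally have "\<bar>e y - E\<bar> * \<bar>ln v\<bar> \<le> \<bar>e y - E\<bar> * ((\<bar>ln ?w\<bar> + ?n + m) * \<bar>ln r\<bar>)"
          by (rule mult_left_mono) simp
        also have "\<dots> = (\<bar>ln ?w\<bar> + ?n + m) * (\<bar>e y - E\<bar> * \<bar>ln r\<bar>)" by (simp only: mult_ac)
        also have "\<dots> \<le> (\<bar>ln ?w\<bar> + ?n + m) * C" using D m0 by (intro mult_left_mono) auto
        finally have "v powr - (E / e y) \<le> K1 / v" by (intro key) (simp only: a_eq)
        then show ?thesis by (simp add: add_increasing2)
      next
        case False
        have E: "E = e_inf" using False by (simp add: E_def)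
        have p: "1 \<le> exp 1 + norm y" using exp_ge_add_one_self[of 1] norm_ge_zero[of y] by argo
        show ?thesis
        proof (cases "v \<le> (exp 1 + norm y) powr m")
          case True
          have "ln (exp (-1)) \<le> ln r" using False by (intro ln_mono) auto
          then have "?n * (- 1) \<le> ?n * ln r" by (intro mult_left_mono) auto
          then have "- ln v \<le> \<bar>ln ?w\<bar> + ?n" unfolding lnv by simp
          moreover have "ln v \<le> ln ((exp 1 + norm y) powr m)" using True v by (intro ln_mono) auto
          then have "ln v \<le> m * ln (exp 1 + norm y)" by (simp only: ln_powr)
          moreover have "0 \<le> m * ln (exp 1 + norm y)" using ln_e_norm_ge_1[of y] by (intro mult_nonneg_nonneg[OF m0]) linarith
          ultimately have "\<bar>ln v\<bar> \<le> (\<bar>ln ?w\<bar> + ?n) * 1 + m * ln (exp 1 + norm y)" by (simp add: abs_le_iff)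
          also have "\<dots> \<le> (\<bar>ln ?w\<bar> + ?n) * ln (exp 1 + norm y) + m * ln (exp 1 + norm y)"
            using m0 ln_e_norm_ge_1[of y] by (intro add_mono mult_left_mono) auto
          also have "\<dots> = (\<bar>ln ?w\<bar> + ?n + m) * ln (exp 1 + norm y)" by (simp only: distrib_right)
          finally have "\<bar>e y - E\<bar> * \<bar>ln v\<bar> \<le> \<bar>e y - E\<bar> * ((\<bar>ln ?w\<bar> + ?n + m) * ln (exp 1 + norm y))"
            by (rule mult_left_mono) simp
          also have "\<dots> = (\<bar>ln ?w\<bar> + ?n + m) * (\<bar>e y - E\<bar> * ln (exp 1 + norm y))" by (simp only: mult_ac)
          also have "\<dots> \<le> (\<bar>ln ?w\<bar> + ?n + m) * C"
            using log_holder_infinity(1)[OF lh, of y] m0 unfolding E by (intro mult_left_mono) auto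
          finally have "v powr - (E / e y) \<le> K1 / v" by (intro key) (simp only: a_eq)
          then show ?thesis by (simp add: add_increasing2)
        next
          case False
          have "1 \<le> (exp 1 + norm y) powr m" using p m0 by (intro ge_one_powr_ge_zero) auto
          then have v1: "1 \<le> v" using False by linarith
          have "e_inf / 1 \<le> e_inf / e y" using e_pos[of y] le[of y] e_inf e0 by (intro divide_left_mono) auto
          then have "v powr - (E / e y) \<le> v powr - e_inf" unfolding E using v1 by (intro powr_mono) auto
          also have "\<dots> \<le> ((exp 1 + norm y) powr m) powr - e_inf"
            using False e_inf e0 p by (intro powr_mono2') auto
          also have "\<dots> = (exp 1 + norm y) powr (- (m * e_inf))" by (simp add: powr_powr)
          also have "\<dots> \<le> (exp 1 + norm y) powr - (?n + 1)"
          proof (rule powr_mono)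
            have "(?n + 1) = m * e0" using e0 by (simp add: m_def)
            also have "\<dots> \<le> m * e_inf" using e_inf m0 by (rule mult_left_mono)
            finally show "- (m * e_inf) \<le> - (?n + 1)" by simp
          qed (rule p)
          finally show ?thesis using v by (simp add: K1_def add_increasing)
        qed
      qed
    qed
    have "(\<integral>\<^sup>+y\<in>ball z r. ennreal (v powr - (E / e y)) \<partial>lebesgue)
       \<le> (\<integral>\<^sup>+y. ennreal (K1 / v) * indicator (ball z r) y + ennreal ((exp 1 + norm y) powr - (?n + 1)) \<partial>lebesgue)"
    proof (rule nn_integral_mono)
      fix y
      show "ennreal (v powr - (E / e y)) * indicator (ball z r) y
        \<le> ennreal (K1 / v) * indicator (ball z r) y + ennreal ((exp 1 + norm y) powr - (?n + 1))"
      proof (cases "y \<in> ball z r")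
        case True
        have "ennreal (v powr - (E / e y)) \<le> ennreal (K1 / v + (exp 1 + norm y) powr - (?n + 1))"
          by (rule ennreal_leI[OF pt[OF True]])
        then show ?thesis using True v by (simp add: K1_def)
      qed auto
    qed
    also have "\<dots> = (\<integral>\<^sup>+y. ennreal (K1 / v) * indicator (ball z r) y \<partial>lebesgue)
        + (\<integral>\<^sup>+y. ennreal ((exp 1 + norm y) powr - (?n + 1)) \<partial>(lebesgue :: 'a measure))"
    proof (rule nn_integral_add)
      have "(\<lambda>y::'a. ennreal ((exp 1 + norm y) powr - (?n + 1))) \<in> borel_measurable borel" by measurable
      then show "(\<lambda>y::'a. ennreal ((exp 1 + norm y) powr - (?n + 1))) \<in> borel_measurable lebesgue"
        by (intro measurable_completion) simp
    qed measurable
    also have "(\<integral>\<^sup>+y. ennreal (K1 / v) * indicator (ball z r) y \<partial>lebesgue) = ennreal K1"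
    proof -
      have "(\<integral>\<^sup>+y. ennreal (K1 / v) * indicator (ball z r) y \<partial>lebesgue) = ennreal (K1 / v) * emeasure lebesgue (ball z r)"
        by (rule nn_integral_cmult_indicator) measurable
      also have "emeasure lebesgue (ball z r) = ennreal v" unfolding v_def using r by (intro emeasure_lebesgue_ball) simp
      also have "ennreal (K1 / v) * ennreal v = ennreal K1" using v by (simp add: K1_def ennreal_mult''[symmetric])
      finally show ?thesis .
    qed
    also have "ennreal K1 + (\<integral>\<^sup>+y. ennreal ((exp 1 + norm y) powr - (?n + 1)) \<partial>(lebesgue :: 'a measure)) = ennreal (K1 + J)"
      unfolding J(1) using J(2) by (simp add: K1_def)
    finally show "(\<integral>\<^sup>+y\<in>ball z r. ennreal (vol TYPE('a) r powr - ((if r < exp (-1) then e z else e_inf) / e y)) \<partial>lebesgue) \<le> ennreal (K1 + J)"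
      unfolding v_def E_def .
  qed
qed

lemma modular_finite_exponent:
  assumes R: "\<And>x. R x = ennreal (s x)" and s: "\<And>x. 0 \<le> s x"
  shows "modular R f t = (\<integral>\<^sup>+x. ennpowr (f x / ennreal t) (s x) \<partial>lebesgue)"
proof -
  have "esssup lebesgue (\<lambda>x::'a. 0::ennreal) \<le> 0" by (rule esssup_I) auto
  then show ?thesis by (simp add: modular_def R s)
qed

text \<open>
  Hoelder's inequality against an indicator function, in the form in which the dual norm of the
  indicator is replaced by a number \<open>\<mu>\<close> with bounded modular.
\<close>
lemma set_integral_le_var_norm:
  fixes v :: "'a::euclidean_space \<Rightarrow> ennreal"
  assumes v [measurable]: "v \<in> borel_measurable lebesgue" and s [measurable]: "s \<in> borel_measurable lebesgue"
    and A [measurable]: "A \<in> sets lebesgue"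
    and R: "\<And>x. R x = ennreal (s x)" and s1: "\<And>x. 1 < s x" and \<mu>: "0 < \<mu>"
    and K: "0 \<le> K" "(\<integral>\<^sup>+x\<in>A. ennreal (\<mu> powr - (s x / (s x - 1))) \<partial>lebesgue) \<le> ennreal K"
  shows "(\<integral>\<^sup>+x\<in>A. v x \<partial>lebesgue) \<le> ennreal (\<mu> * (1 + K)) * var_norm R (\<lambda>x. v x * indicator A x)"
proof -
  have s0: "0 \<le> s x" for x using s1[of x] by simp
  have c: "0 < \<mu> * (1 + K)" using \<mu> K by simp
  have "(\<integral>\<^sup>+x\<in>A. v x \<partial>lebesgue) / ennreal (\<mu> * (1 + K)) \<le> var_norm R (\<lambda>x. v x * indicator A x)"
    unfolding var_norm_def
  proof (rule Inf_greatest, safe)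
    fix t :: real assume t: "0 < t" and mod: "modular R (\<lambda>x. v x * indicator A x) t \<le> 1"
    have "(\<integral>\<^sup>+x\<in>A. v x \<partial>lebesgue) \<le> (\<integral>\<^sup>+x. ennreal (t * \<mu>) *
        (ennpowr (v x * indicator A x / ennreal t) (s x) + ennreal (\<mu> powr - (s x / (s x - 1))) * indicator A x) \<partial>lebesgue)"
    proof (rule nn_integral_mono)
      fix x
      show "v x * indicator A x \<le> ennreal (t * \<mu>) *
        (ennpowr (v x * indicator A x / ennreal t) (s x) + ennreal (\<mu> powr - (s x / (s x - 1))) * indicator A x)"
      proof (cases "x \<in> A")
        case True
        show ?thesis
        proof (cases "v x")
          case top
          then show ?thesis using t \<mu> by (simp add: ennpowr_def ennreal_top_divide ennreal_mult_top True)
        next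
          case (real a)
          let ?s = "s x" and ?s' = "s x / (s x - 1)"
          have "(a / t) * (1 / \<mu>) \<le> (a / t) powr ?s / ?s + (1 / \<mu>) powr ?s' / ?s'"
            using s1[of x] real t \<mu> by (intro Youngs_inequality) (auto simp: field_simps)
          also have "\<dots> \<le> (a / t) powr ?s / 1 + (1 / \<mu>) powr ?s' / 1"
            using s1[of x] by (intro add_mono divide_left_mono) (auto simp: field_simps)
          also have "(1 / \<mu>) powr ?s' = \<mu> powr - ?s'" using \<mu> by (simp add: powr_divide powr_minus_divide)
          finally have "a / (t * \<mu>) \<le> (a / t) powr ?s + \<mu> powr - ?s'" by simp
          then have "a \<le> t * \<mu> * ((a / t) powr ?s + \<mu> powr - ?s')" using t \<mu> by (simp add: pos_divide_le_eq mult.commute)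
          then have "ennreal a \<le> ennreal (t * \<mu>) * (ennreal ((a / t) powr ?s) + ennreal (\<mu> powr - ?s'))"
            using t \<mu> by (subst ennreal_plus[symmetric], simp, simp, subst ennreal_mult'[symmetric]) (auto intro: ennreal_leI)
          then show ?thesis using True real t by (simp add: divide_ennreal ennpowr_ennreal)
        qed
      qed auto
    qed
    also have "\<dots> = ennreal (t * \<mu>) * (\<integral>\<^sup>+x. ennpowr (v x * indicator A x / ennreal t) (s x) + ennreal (\<mu> powr - (s x / (s x - 1))) * indicator A x \<partial>lebesgue)"
      by (rule nn_integral_cmult) measurable
    also have "\<dots> = ennreal (t * \<mu>) * (modular R (\<lambda>x. v x * indicator A x) t + (\<integral>\<^sup>+x\<in>A. ennreal (\<mu> powr - (s x / (s x - 1))) \<partial>lebesgue))"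
      unfolding modular_finite_exponent[OF R s0] by (subst nn_integral_add) auto
    also have "\<dots> \<le> ennreal (t * \<mu>) * (1 + ennreal K)"
      by (intro mult_left_mono add_mono mod K) simp
    also have "\<dots> = ennreal (\<mu> * (1 + K)) * ennreal t"
      using t \<mu> K by (simp add: ennreal_mult'[symmetric] mult_ac flip: ennreal_1 ennreal_plus)
    finally show "(\<integral>\<^sup>+x\<in>A. v x \<partial>lebesgue) / ennreal (\<mu> * (1 + K)) \<le> ennreal t"
      using c by (intro divide_le_posI_ennreal) (auto simp: ennreal_less_zero_iff)
  qed
  then have "(\<integral>\<^sup>+x\<in>A. v x \<partial>lebesgue) / ennreal (\<mu> * (1 + K)) * ennreal (\<mu> * (1 + K)) \<le> var_norm R (\<lambda>x. v x * indicator A x) * ennreal (\<mu> * (1 + K))"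
    by (rule mult_right_mono) simp
  then show ?thesis unfolding ennreal_divide_times_self[OF c] by (simp only: mult.commute)
qed

text \<open>
  For a constant exponent this is Jensen's inequality. In general, Hoelder's inequality bounds the
  averages of \<open>v\<close> and \<open>1 / v\<close> by the two norms in the definition of the variable class times norms of
  indicators of the ball \<open>B\<close> in the dual spaces, and for a log-Hoelder exponent the latter multiply
  to the order of \<open>|B|\<close>: the representative exponents of \<open>1 / p\<close> and of \<open>1 - 1 / p\<close> add up to one.
\<close>
lemma A_var_imp_A2:
  fixes p :: "'a::euclidean_space \<Rightarrow> ennreal"
  assumes p: "\<And>x. p x = ennreal (P x)" and P [measurable]: "P \<in> borel_measurable lebesgue"
    and P1: "1 < p_lo" "\<And>x. p_lo \<le> P x" and P2: "\<And>x. P x \<le> p_hi"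
    and lh: "log_holder (\<lambda>x. 1 / P x) e_inf C" and C: "0 \<le> C"
    and v: "v \<in> A_var p"
  shows "v \<in> A2"
proof -
  let ?e = "\<lambda>x. 1 / P x"
  have Pgt: "1 < P x" for x using P1(1) P1(2)[of x] by linarith
  have p_hi: "1 < p_hi" using Pgt P2 less_le_trans by blast
  have v_meas [measurable]: "v \<in> borel_measurable lebesgue" and v_pos: "AE x in lebesgue. 0 < v x \<and> v x < \<infinity>"
    using v by (auto simp: A_var_def weights_def)
  have lh': "log_holder (\<lambda>x. 1 - 1 / P x) (1 - e_inf) C"
    using lh unfolding log_holder_def by (smt (verit))
  obtain K1 where K1: "0 \<le> K1"
    "\<And>z r. 0 < r \<Longrightarrow> (\<integral>\<^sup>+y\<in>ball z r. ennreal (vol TYPE('a) r powr - ((if r < exp (-1) then ?e z else e_inf) / ?e y)) \<partial>lebesgue) \<le> ennreal K1"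
  proof (rule ball_power_integral[OF lh C, of "1 / p_hi"])
    show "1 / p_hi \<le> 1 / P x" "1 / P x \<le> 1" for x using Pgt[of x] P2[of x] by (auto simp: frac_le)
  qed (use p_hi that in auto)
  obtain K2 where K2: "0 \<le> K2"
    "\<And>z r. 0 < r \<Longrightarrow> (\<integral>\<^sup>+y\<in>ball z r. ennreal (vol TYPE('a) r powr - ((if r < exp (-1) then 1 - ?e z else 1 - e_inf) / (1 - ?e y))) \<partial>lebesgue) \<le> ennreal K2"
  proof (rule ball_power_integral[OF lh' C, of "1 - 1 / p_lo"])
    show "1 - 1 / p_lo \<le> 1 - 1 / P x" "1 - 1 / P x \<le> 1" for x
      using Pgt[of x] P1(1) P1(2)[of x] by (auto simp: frac_le)
  qed (use P1 that in auto)
  have conj: "conj_exponent p x = ennreal (P x / (P x - 1))" for x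
  proof -
    have "1 - inverse (ennreal (P x)) = ennreal (1 - 1 / P x)"
      using Pgt[of x] by (simp add: inverse_ennreal inverse_eq_divide ennreal_minus flip: ennreal_1)
    moreover have "inverse (ennreal (1 - 1 / P x)) = ennreal (P x / (P x - 1))"
      using Pgt[of x] by (subst inverse_ennreal) (auto simp: field_simps)
    ultimately show ?thesis by (simp add: conj_exponent_def p)
  qed
  define S where "S = (SUP (z::'a, \<rho>)\<in>UNIV \<times> {0<..}.
        inverse (emeasure lebesgue (ball z \<rho>)) *
        var_norm p (\<lambda>x. v x * indicator (ball z \<rho>) x) *
        var_norm (conj_exponent p) (\<lambda>x. inverse (v x) * indicator (ball z \<rho>) x))"
  have "S < \<infinity>" using v by (simp add: A_var_def S_def)
  then obtain K where K: "S = ennreal K" "0 \<le> K" by (cases S) auto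
  show ?thesis
  proof (rule A2I[OF v_meas v_pos])
    fix z :: 'a and r :: real assume r: "0 < r"
    define V where "V = vol TYPE('a) r"
    have V: "0 < V" using r by (simp add: V_def)
    have mV: "emeasure lebesgue (ball z r) = ennreal V" unfolding V_def using r by (intro emeasure_lebesgue_ball) simp
    define E where "E = (if r < exp (-1) then ?e z else e_inf)"
    have E': "(if r < exp (-1) then 1 - ?e z else 1 - e_inf) = 1 - E" by (simp add: E_def)
    let ?a = "var_norm p (\<lambda>x. v x * indicator (ball z r) x)"
    let ?b = "var_norm (conj_exponent p) (\<lambda>x. inverse (v x) * indicator (ball z r) x)"
    have a: "(\<integral>\<^sup>+x\<in>ball z r. v x \<partial>lebesgue) \<le> ennreal (V powr (1 - E) * (1 + K2)) * ?a"
    proof (rule set_integral_le_var_norm[OF v_meas P ball_sets_lebesgue(1) p Pgt])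
      have "(V powr (1 - E)) powr - (P x / (P x - 1)) = V powr - ((1 - E) / (1 - ?e x))" for x
        using Pgt[of x] by (simp add: powr_powr field_simps)
      then show "(\<integral>\<^sup>+x\<in>ball z r. ennreal ((V powr (1 - E)) powr - (P x / (P x - 1))) \<partial>lebesgue) \<le> ennreal K2"
        using K2(2)[OF r, of z] unfolding E' V_def by (simp only:)
    qed (use V K2 in auto)
    have b: "(\<integral>\<^sup>+x\<in>ball z r. inverse (v x) \<partial>lebesgue) \<le> ennreal (V powr E * (1 + K1)) * ?b"
    proof (rule set_integral_le_var_norm[OF _ _ ball_sets_lebesgue(1) conj])
      have "(V powr E) powr - (P x / (P x - 1) / (P x / (P x - 1) - 1)) = V powr - (E / ?e x)" for x
      proof -
        have "P x / (P x - 1) / (P x / (P x - 1) - 1) = P x" using Pgt[of x] by (simp add: field_simps)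
        then show ?thesis by (simp add: powr_powr)
      qed
      then show "(\<integral>\<^sup>+x\<in>ball z r. ennreal ((V powr E) powr - (P x / (P x - 1) / (P x / (P x - 1) - 1))) \<partial>lebesgue) \<le> ennreal K1"
        using K1(2)[OF r, of z] unfolding E_def V_def by (simp only:)
      show "1 < P x / (P x - 1)" for x using Pgt[of x] by (simp add: field_simps)
    qed (use V K1 in auto)
    have "inverse (ennreal V) * ?a * ?b \<le> S"
      unfolding S_def mV[symmetric] by (rule SUP_upper2[of "(z, r)"]) (use r in auto)
    then have "inverse (ennreal V) * ?a * ?b * ennreal V \<le> ennreal K * ennreal V"
      unfolding K(1) by (rule mult_right_mono) simp
    moreover have "inverse (ennreal V) * ?a * ?b * ennreal V = (?a * ?b) / ennreal V * ennreal V"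
      by (simp only: divide_ennreal_def mult_ac)
    ultimately have ab: "?a * ?b \<le> ennreal K * ennreal V"
      by (simp only: ennreal_divide_times_self[OF V])
    have "(\<integral>\<^sup>+x\<in>ball z r. v x \<partial>lebesgue) * (\<integral>\<^sup>+x\<in>ball z r. inverse (v x) \<partial>lebesgue)
       \<le> (ennreal (V powr (1 - E) * (1 + K2)) * ?a) * (ennreal (V powr E * (1 + K1)) * ?b)"
      using a b by (rule mult_mono) auto
    also have "\<dots> = (ennreal (V powr (1 - E) * (1 + K2)) * ennreal (V powr E * (1 + K1))) * (?a * ?b)"
      by (simp only: mult_ac)
    also have "\<dots> \<le> (ennreal (V powr (1 - E) * (1 + K2)) * ennreal (V powr E * (1 + K1))) * (ennreal K * ennreal V)"
      by (rule mult_left_mono[OF ab]) simp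
    also have "\<dots> = ennreal ((V powr (1 - E) * (1 + K2)) * (V powr E * (1 + K1)) * (K * V))"
      using V K K1 K2 by (simp add: ennreal_mult' ennreal_mult'')
    also have "(V powr (1 - E) * (1 + K2)) * (V powr E * (1 + K1)) * (K * V) = ((1 + K1) * (1 + K2) * K) * (V powr (1 - E) * V powr E * V)"
      by (simp only: mult_ac)
    also have "V powr (1 - E) * V powr E * V = V\<^sup>2" using V by (simp add: power2_eq_square flip: powr_add)
    finally show "(\<integral>\<^sup>+x\<in>ball z r. v x \<partial>lebesgue) * (\<integral>\<^sup>+x\<in>ball z r. inverse (v x) \<partial>lebesgue)
       \<le> ennreal ((1 + K1) * (1 + K2) * K * (vol TYPE('a) r)\<^sup>2)" unfolding V_def .
  qed
qed

section \<open>Extrapolation\<close>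

text \<open>
  The weight of the extrapolation argument, for a given integrable \<open>\<Phi>\<close>. A polynomial tail is added to
  \<open>\<Phi>\<close> to bound \<open>\<Psi>\<close> from below at infinity. Writing \<open>\<Psi> = u powr (1 / \<rho>)\<close> with \<open>u\<close> in \<open>A\<^sub>1\<close>, the weight is
  \<open>(w powr \<sigma>) powr (1 - \<rho>) * (u powr b) powr \<rho>\<close> with \<open>\<sigma> = 2 / (\<delta> (1 - \<rho>))\<close> and
  \<open>b = (1 - 2 / P) / (\<delta> \<rho>\<^sup>2)\<close>. Of the three factors \<open>\<rho>\<close> in the bound for \<open>1 - 2 / P\<close>, one pays for the
  interpolation with \<open>w\<close>, one for the passage from \<open>\<Psi>\<close> to \<open>u\<close>, and one remains as the bound for \<open>b\<close>.
\<close>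
lemma extrapolation_weight:
  fixes \<Phi> :: "'a::euclidean_space \<Rightarrow> ennreal" and w P :: "'a \<Rightarrow> real"
  assumes \<Phi> [measurable]: "\<Phi> \<in> borel_measurable lebesgue" and fin: "(\<integral>\<^sup>+x. \<Phi> x \<partial>lebesgue) < \<infinity>"
    and P [measurable]: "P \<in> borel_measurable lebesgue"
    and lh: "log_holder (\<lambda>x. 1 / P x) e_inf C" and C: "0 \<le> C"
    and \<delta>: "0 < \<delta>" and \<rho>: "0 < \<rho>" "\<rho> < 1" and P\<rho>: "\<And>x. \<bar>1 - 2 / P x\<bar> \<le> \<delta> * \<rho> ^ 3"
    and w [measurable]: "w \<in> borel_measurable lebesgue" and w_pos: "\<And>x. 0 < w x"
    and wA2: "(\<lambda>x. ennreal (w x powr (2 / (\<delta> * (1 - \<rho>))))) \<in> A2"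
  obtains \<Psi> :: "'a \<Rightarrow> real" and I :: real
  where "\<Psi> \<in> borel_measurable lebesgue" "\<And>x. 0 < \<Psi> x" "0 < I"
    "(\<integral>\<^sup>+x. ennreal (\<Psi> x) \<partial>lebesgue) \<le> ennreal I"
    "AE x in lebesgue. \<Phi> x \<le> ennreal (\<Psi> x)"
    "(\<lambda>x. ennreal (w x powr (2 / \<delta>) * \<Psi> x powr ((1 - 2 / P x) / \<delta>))) \<in> A2"
proof -
  let ?n = "real DIM('a)"
  have n: "0 < ?n" by simp
  have e1: "1 \<le> exp 1 + norm x" for x :: 'a using exp_ge_add_one_self[of 1] norm_ge_zero[of x] by argo
  define tail where "tail x = ennreal ((exp 1 + norm x) powr - (?n / \<rho>\<^sup>2))" for x :: 'a
  have tail_meas [measurable]: "tail \<in> borel_measurable lebesgue"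
  proof -
    have "tail \<in> borel_measurable borel" unfolding tail_def by measurable
    then show ?thesis by (intro measurable_completion) simp
  qed
  have tail_fin: "(\<integral>\<^sup>+x. tail x \<partial>lebesgue) < \<infinity>"
  proof -
    have "\<rho>\<^sup>2 < 1" using \<rho> by (simp add: power_less_one_iff)
    then have "?n < ?n / \<rho>\<^sup>2" using n \<rho> by (simp add: pos_less_divide_eq)
    then show ?thesis unfolding tail_def by (rule inverse_polynomial_integrable)
  qed
  define \<Phi>' where "\<Phi>' x = \<Phi> x + tail x" for x
  have \<Phi>'_meas [measurable]: "\<Phi>' \<in> borel_measurable lebesgue" unfolding \<Phi>'_def by measurable
  have \<Phi>'_fin: "(\<integral>\<^sup>+x. \<Phi>' x \<partial>lebesgue) < \<infinity>"
    unfolding \<Phi>'_def using fin tail_fin by (subst nn_integral_add) auto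
  obtain u' :: "'a \<Rightarrow> ennreal" and N :: real
    where u'_meas [measurable]: "u' \<in> borel_measurable lebesgue" and N: "0 < N"
    and u'_int: "(\<integral>\<^sup>+x. ennpowr (u' x) (1 / \<rho>) \<partial>lebesgue) < \<infinity>"
    and u'_ge: "\<And>x. ennpowr (\<Phi>' x) \<rho> \<le> u' x"
    and u'_A1: "\<And>z r x. x \<in> ball z r \<Longrightarrow> (\<integral>\<^sup>+y\<in>ball z r. u' y \<partial>lebesgue) \<le> ennreal (N * vol TYPE('a) r) * u' x"
    by (rule A1_majorant[OF \<rho> \<Phi>'_meas \<Phi>'_fin]) blast
  have u'_fin: "AE x in lebesgue. u' x < \<infinity>"
  proof -
    have "AE x in lebesgue. ennpowr (u' x) (1 / \<rho>) \<noteq> \<infinity>"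
      using u'_int by (intro nn_integral_noteq_infinite) auto
    then show ?thesis by eventually_elim (auto simp: ennpowr_def less_top split: if_splits)
  qed
  \<comment> \<open>The value one on the null set where the majorant is infinite respects the lower bound.\<close>
  define u where "u x = (if u' x < \<infinity> then enn2real (u' x) else 1)" for x
  have u_meas [measurable]: "u \<in> borel_measurable lebesgue" unfolding u_def by measurable
  have u_nn: "0 \<le> u x" for x by (simp add: u_def)
  have u_AE: "AE x in lebesgue. u' x = ennreal (u x)"
    using u'_fin by eventually_elim (simp add: u_def ennreal_enn2real)
  have u_low: "(exp 1 + norm x) powr - (?n / \<rho>) \<le> u x" for x
  proof (cases "u' x < \<infinity>")
    case True
    have "ennpowr (tail x) \<rho> \<le> ennpowr (\<Phi>' x) \<rho>" unfolding \<Phi>'_def using \<rho> by (intro ennpowr_mono) auto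
    also have "\<dots> \<le> u' x" by (rule u'_ge)
    also have "ennpowr (tail x) \<rho> = ennreal ((exp 1 + norm x) powr - (?n / \<rho>))"
      unfolding tail_def using \<rho> by (simp add: ennpowr_ennreal powr_powr power2_eq_square)
    also have "u' x = ennreal (u x)" using True by (simp add: u_def ennreal_enn2real)
    finally show ?thesis by (subst (asm) ennreal_le_iff) (auto simp: u_def)
  next
    case False
    have "(exp 1 + norm x) powr - (?n / \<rho>) \<le> (exp 1 + norm x) powr 0" using \<rho> by (intro powr_mono e1) simp
    then show ?thesis using False e1[of x] by (simp add: u_def)
  qed
  obtain I0 where I0: "(\<integral>\<^sup>+x. ennpowr (u' x) (1 / \<rho>) \<partial>lebesgue) = ennreal I0" "0 \<le> I0"
    using u'_int by (cases "\<integral>\<^sup>+x. ennpowr (u' x) (1 / \<rho>) \<partial>lebesgue") auto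
  have u_int: "(\<integral>\<^sup>+x. ennreal (u x powr (1 / \<rho>)) \<partial>lebesgue) \<le> ennreal (I0 + 1)"
  proof -
    have "(\<integral>\<^sup>+x. ennreal (u x powr (1 / \<rho>)) \<partial>lebesgue) = (\<integral>\<^sup>+x. ennpowr (u' x) (1 / \<rho>) \<partial>lebesgue)"
      by (rule nn_integral_cong_AE) (use u_AE in eventually_elim, simp add: ennpowr_ennreal u_nn)
    then show ?thesis using I0 by (simp add: ennreal_leI)
  qed
  interpret A1_weight u \<rho> "max N 1" "I0 + 1"
  proof
    fix z :: 'a and r :: real assume r: "0 < r"
    have "(\<integral>\<^sup>+y\<in>ball z r. ennreal (u y) \<partial>lebesgue) = (\<integral>\<^sup>+y\<in>ball z r. u' y \<partial>lebesgue)"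
      by (rule nn_integral_cong_AE) (use u_AE in eventually_elim, simp)
    moreover have v: "0 < vol TYPE('a) r" using r by simp
    have "AE x in lebesgue. x \<in> ball z r \<longrightarrow> (\<integral>\<^sup>+y\<in>ball z r. u' y \<partial>lebesgue) \<le> ennreal (max N 1 * vol TYPE('a) r * u x)"
      using u_AE
    proof eventually_elim
      case (elim x)
      show ?case
      proof
        assume "x \<in> ball z r"
        then have "(\<integral>\<^sup>+y\<in>ball z r. u' y \<partial>lebesgue) \<le> ennreal (N * vol TYPE('a) r) * ennreal (u x)"
          using u'_A1[of x z r] elim by simp
        also have "\<dots> \<le> ennreal (max N 1 * vol TYPE('a) r) * ennreal (u x)"
          using v by (intro mult_right_mono ennreal_leI) auto
        also have "\<dots> = ennreal (max N 1 * vol TYPE('a) r * u x)"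
          by (intro ennreal_mult''[symmetric]) (simp add: u_def)
        finally show "(\<integral>\<^sup>+y\<in>ball z r. u' y \<partial>lebesgue) \<le> ennreal (max N 1 * vol TYPE('a) r * u x)" .
      qed
    qed
    ultimately show "AE x in lebesgue. x \<in> ball z r \<longrightarrow> (\<integral>\<^sup>+y\<in>ball z r. ennreal (u y) \<partial>lebesgue) \<le> ennreal (max N 1 * vol TYPE('a) r * u x)"
      by (simp only:)
  qed (use \<rho> u_low u_int I0 in auto)
  define b where "b x = (- 2 / (\<delta> * \<rho>\<^sup>2)) * (1 / P x) + 1 / (\<delta> * \<rho>\<^sup>2)" for x
  have b_eq: "b x = (1 - 2 / P x) / (\<delta> * \<rho>\<^sup>2)" for x by (simp add: b_def diff_divide_distrib)
  have b_meas [measurable]: "b \<in> borel_measurable lebesgue" unfolding b_def by measurable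
  have b\<rho>: "\<bar>b x\<bar> \<le> \<rho>" for x
  proof -
    have "\<bar>b x\<bar> = \<bar>1 - 2 / P x\<bar> / (\<delta> * \<rho>\<^sup>2)" using \<delta> \<rho> by (simp add: b_eq abs_mult)
    also have "\<dots> \<le> (\<delta> * \<rho> ^ 3) / (\<delta> * \<rho>\<^sup>2)" using \<delta> \<rho> by (intro divide_right_mono P\<rho>) auto
    also have "\<dots> = \<rho>" using \<delta> \<rho> by (simp add: power2_eq_square power3_eq_cube)
    finally show ?thesis .
  qed
  have lhb: "log_holder b ((- 2 / (\<delta> * \<rho>\<^sup>2)) * e_inf + 1 / (\<delta> * \<rho>\<^sup>2)) (\<bar>- 2 / (\<delta> * \<rho>\<^sup>2)\<bar> * C)"
    unfolding b_def by (rule log_holder_affine[OF lh])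
  have C': "0 \<le> \<bar>- 2 / (\<delta> * \<rho>\<^sup>2)\<bar> * C" using C by simp
  obtain K where K: "\<And>z r. 0 < r \<Longrightarrow> (\<integral>\<^sup>+y\<in>ball z r. ennreal (u y powr b y) \<partial>lebesgue) * (\<integral>\<^sup>+y\<in>ball z r. ennreal (u y powr - b y) \<partial>lebesgue)
       \<le> ennreal (K * (vol TYPE('a) r)\<^sup>2)"
    by (rule variable_power_A2[OF lhb C' b_meas b\<rho>]) blast
  have ub: "0 < u x powr b x" for x using u_pos[of x] by simp
  have uA2: "(\<lambda>x. ennreal (u x powr b x)) \<in> A2"
  proof (rule A2I)
    show "AE x in lebesgue. 0 < ennreal (u x powr b x) \<and> ennreal (u x powr b x) < \<infinity>"
      using ub by (intro AE_I2) (simp only: ennreal_less_zero_iff infinity_ennreal_def ennreal_less_top)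
    have "inverse (ennreal (u x powr b x)) = ennreal (u x powr - b x)" for x
      unfolding powr_minus by (rule inverse_ennreal[OF ub])
    then show "(\<integral>\<^sup>+x\<in>ball z r. ennreal (u x powr b x) \<partial>lebesgue) * (\<integral>\<^sup>+x\<in>ball z r. inverse (ennreal (u x powr b x)) \<partial>lebesgue)
       \<le> ennreal (K * (vol TYPE('a) r)\<^sup>2)" if "0 < r" for z r
      using K[OF that, of z] by (simp only:)
  qed measurable
  show ?thesis
  proof (rule that[of "\<lambda>x. u x powr (1 / \<rho>)" "I0 + 1"])
    show "(\<lambda>x. u x powr (1 / \<rho>)) \<in> borel_measurable lebesgue" by measurable
    show "0 < u x powr (1 / \<rho>)" for x using u_pos[of x] by simp
    show "0 < I0 + 1" using I0 by simp
    show "(\<integral>\<^sup>+x. ennreal (u x powr (1 / \<rho>)) \<partial>lebesgue) \<le> ennreal (I0 + 1)" by (rule u_int)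
    show "AE x in lebesgue. \<Phi> x \<le> ennreal (u x powr (1 / \<rho>))"
      using u_AE
    proof eventually_elim
      case (elim x)
      have "\<Phi> x \<le> ennpowr (ennpowr (\<Phi>' x) \<rho>) (1 / \<rho>)"
        using \<rho> by (simp add: ennpowr_ennpowr \<Phi>'_def)
      also have "\<dots> \<le> ennpowr (u' x) (1 / \<rho>)" using \<rho> by (intro ennpowr_mono u'_ge) simp
      also have "\<dots> = ennreal (u x powr (1 / \<rho>))" using elim by (simp add: ennpowr_ennreal u_nn)
      finally show ?case .
    qed
    have "w x powr (2 / \<delta>) * (u x powr (1 / \<rho>)) powr ((1 - 2 / P x) / \<delta>)
       = (w x powr (2 / (\<delta> * (1 - \<rho>)))) powr (1 - \<rho>) * (u x powr b x) powr \<rho>" for x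
    proof -
      have "2 / (\<delta> * (1 - \<rho>)) * (1 - \<rho>) = 2 / \<delta>" using \<rho> \<delta> by (simp add: field_simps)
      moreover have "1 / \<rho> * ((1 - 2 / P x) / \<delta>) = b x * \<rho>" using \<rho> by (simp add: b_eq power2_eq_square)
      ultimately show ?thesis by (simp only: powr_powr)
    qed
    then show "(\<lambda>x. ennreal (w x powr (2 / \<delta>) * (u x powr (1 / \<rho>)) powr ((1 - 2 / P x) / \<delta>))) \<in> A2"
      by (simp only:) (intro A2_log_convex \<rho> wA2 uA2 ub, auto simp: w_pos less_imp_neq[OF w_pos, symmetric])
  qed
qed

text \<open>
  A level strictly above the norm lies above some admissible level, whether or not the infimum in
  the norm is attained.
\<close>
lemma var_norm_less_imp_modular:
  fixes h :: "'a::euclidean_space \<Rightarrow> ennreal"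
  assumes p: "\<And>x. p x = ennreal (P x)" and P: "\<And>x. 0 \<le> P x" and less: "var_norm p h < ennreal t"
  shows "(\<integral>\<^sup>+x. ennpowr (h x / ennreal t) (P x) \<partial>lebesgue) \<le> 1"
proof -
  obtain s where s: "0 < s" "modular p h s \<le> 1" "ennreal s < ennreal t"
    using less unfolding var_norm_def Inf_less_iff by auto
  then have "s \<le> t" by (simp add: ennreal_less_iff)
  then have "h x / ennreal t \<le> h x / ennreal s" for x
    using s(1) unfolding divide_ennreal_def by (intro mult_left_mono) (auto simp: inverse_ennreal ennreal_leI)
  then have "(\<integral>\<^sup>+x. ennpowr (h x / ennreal t) (P x) \<partial>lebesgue) \<le> (\<integral>\<^sup>+x. ennpowr (h x / ennreal s) (P x) \<partial>lebesgue)"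
    by (intro nn_integral_mono ennpowr_mono P)
  also have "\<dots> = modular p h s" by (rule modular_finite_exponent[OF p P, symmetric])
  finally show ?thesis using s(2) by simp
qed

lemma less_var_norm_imp_modular:
  fixes h :: "'a::euclidean_space \<Rightarrow> ennreal"
  assumes p: "\<And>x. p x = ennreal (P x)" and P: "\<And>x. 0 \<le> P x" and t: "0 < t" and less: "ennreal t < var_norm p h"
  shows "1 < (\<integral>\<^sup>+x. ennpowr (h x / ennreal t) (P x) \<partial>lebesgue)"
proof (rule ccontr)
  assume "\<not> ?thesis"
  then have "modular p h t \<le> 1" unfolding modular_finite_exponent[OF p P] by simp
  then have "var_norm p h \<le> ennreal t" unfolding var_norm_def using t by (intro Inf_lower) auto
  then show False using less by simp
qed

lemma normalise_by_var_norm: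
  fixes h :: "'a::euclidean_space \<Rightarrow> ennreal"
  assumes p: "\<And>x. p x = ennreal (P x)" and P: "\<And>x. 0 < P x"
    and h [measurable]: "h \<in> borel_measurable lebesgue" and Pm [measurable]: "P \<in> borel_measurable lebesgue"
    and t: "0 < t" and less: "var_norm p h < ennreal t"
  shows "AE x in lebesgue. h x = ennreal (t * (enn2real (h x) / t))"
    and "(\<integral>\<^sup>+x. ennreal ((enn2real (h x) / t) powr P x) \<partial>lebesgue) \<le> 1"
proof -
  have mod: "(\<integral>\<^sup>+x. ennpowr (h x / ennreal t) (P x) \<partial>lebesgue) \<le> 1"
    by (rule var_norm_less_imp_modular[OF p less_imp_le[OF P] less])
  then have "(\<integral>\<^sup>+x. ennpowr (h x / ennreal t) (P x) \<partial>lebesgue) \<noteq> \<infinity>"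
    by (auto simp: top_unique)
  then have "AE x in lebesgue. ennpowr (h x / ennreal t) (P x) \<noteq> \<infinity>"
    by (intro nn_integral_noteq_infinite) auto
  then have fin: "AE x in lebesgue. h x < \<infinity>"
    by eventually_elim (metis ennpowr_def ennreal_divide_eq_top_iff ennreal_neq_top infinity_ennreal_def less_top)
  then show eq: "AE x in lebesgue. h x = ennreal (t * (enn2real (h x) / t))"
    using t by (auto elim!: eventually_mono simp: ennreal_enn2real)
  have "(\<integral>\<^sup>+x. ennreal ((enn2real (h x) / t) powr P x) \<partial>lebesgue) = (\<integral>\<^sup>+x. ennpowr (h x / ennreal t) (P x) \<partial>lebesgue)"
  proof (rule nn_integral_cong_AE)
    show "AE x in lebesgue. ennreal ((enn2real (h x) / t) powr P x) = ennpowr (h x / ennreal t) (P x)"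
      using fin
    proof eventually_elim
      case (elim x)
      then obtain a where "h x = ennreal a" "0 \<le> a" by (cases "h x") auto
      then show ?case using t by (simp add: divide_ennreal ennpowr_ennreal)
    qed
  qed
  then show "(\<integral>\<^sup>+x. ennreal ((enn2real (h x) / t) powr P x) \<partial>lebesgue) \<le> 1" using mod by simp
qed

text \<open>
  This replaces duality. In terms of \<open>k = h / \<Psi> powr (1 / P)\<close>, which lies between \<open>0\<close> and \<open>M\<close>, the
  claim is that \<open>k powr P\<close> is at most \<open>\<eta>\<close> plus a multiple of \<open>k\<^sup>2\<close>; this is clear for \<open>k \<le> \<eta>\<close>, and for
  larger \<open>k\<close> one has \<open>k \<le> k\<^sup>2 / \<eta>\<close>. The power of \<open>M\<close> will be outweighed by the smallness of the
  integral of the second summand.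
\<close>
lemma powr_split:
  fixes h \<Psi> P M \<eta> :: real
  assumes h: "0 \<le> h" and \<Psi>: "0 < \<Psi>" and P: "1 \<le> P" "P \<le> p_hi" and M: "1 \<le> M" and le: "h \<le> M * \<Psi> powr (1 / P)" and \<eta>: "0 < \<eta>" "\<eta> \<le> 1"
  shows "h powr P \<le> \<eta> * \<Psi> + M powr p_hi / \<eta> * (h\<^sup>2 * \<Psi> powr (1 - 2 / P))"
proof -
  define k where "k = h / \<Psi> powr (1 / P)"
  have \<Psi>P: "0 < \<Psi> powr (1 / P)" using \<Psi> by simp
  have k: "0 \<le> k" "k \<le> M" using h \<Psi>P le by (auto simp: k_def pos_divide_le_eq)
  have hk: "h = k * \<Psi> powr (1 / P)" using \<Psi>P by (simp add: k_def)
  have hP: "h powr P = k powr P * \<Psi>" using k P \<Psi> by (simp add: hk powr_mult powr_powr)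
  have h2: "h\<^sup>2 * \<Psi> powr (1 - 2 / P) = k\<^sup>2 * \<Psi>"
  proof -
    have "(\<Psi> powr (1 / P))\<^sup>2 * \<Psi> powr (1 - 2 / P) = \<Psi> powr (1 / P + 1 / P + (1 - 2 / P))"
      by (simp only: power2_eq_square powr_add)
    also have "1 / P + 1 / P + (1 - 2 / P) = 1" by simp
    finally show ?thesis using \<Psi> by (simp add: hk power_mult_distrib)
  qed
  have "k powr P \<le> \<eta> + M powr p_hi / \<eta> * k\<^sup>2"
  proof (cases "k \<le> \<eta>")
    case True
    have "k powr P \<le> k powr 1"
      using P(1) by (rule powr_mono') (use k True \<eta> in linarith)+
    also have "\<dots> \<le> \<eta>" using True k by simp
    also have "\<dots> \<le> \<eta> + M powr p_hi / \<eta> * k\<^sup>2" using \<eta> by simp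
    finally show ?thesis .
  next
    case False
    then have k0: "0 < k" using \<eta> by simp
    have "k powr P = k powr 1 * k powr (P - 1)" by (simp only: powr_add[symmetric]) simp
    also have "\<dots> = k * k powr (P - 1)" using k0 by simp
    also have "k powr (P - 1) \<le> M powr (P - 1)" using k P by (intro powr_mono2) auto
    also have "M powr (P - 1) \<le> M powr p_hi" using M P by (intro powr_mono) auto
    finally have "k powr P \<le> k * M powr p_hi" using k by (simp add: mult_left_mono)
    also have "\<dots> \<le> (k * (k / \<eta>)) * M powr p_hi"
    proof -
      have "k * 1 \<le> k * (k / \<eta>)" using False k0 \<eta> by (intro mult_left_mono) auto
      then show ?thesis by (intro mult_right_mono) auto
    qed
    also have "\<dots> = M powr p_hi / \<eta> * k\<^sup>2" by (simp add: power2_eq_square)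
    finally show ?thesis using \<eta> by simp
  qed
  then have "k powr P * \<Psi> \<le> (\<eta> + M powr p_hi / \<eta> * k\<^sup>2) * \<Psi>" using \<Psi> by (intro mult_right_mono) auto
  then show ?thesis unfolding hP h2 by (simp add: algebra_simps)
qed

lemma square_mult: "(a * b)\<^sup>2 * c = a\<^sup>2 * (b * b * c)" for a b c :: real
  by (simp add: power2_eq_square)

text \<open>
  If no constant works, there are pairs \<open>(f k, g k)\<close> for which the norm of \<open>f k\<close> exceeds \<open>B ^ k\<close> times
  that of \<open>g k\<close>. After normalisation their modulars are summed with weights \<open>2 powr - k\<close> to one
  integrable function, and the weight built from it serves all pairs at once. So the hypothesis
  is applied to one weight, with a single constant for the whole sequence. This contradicts the
  ratio of the norms: undoing the factors \<open>2 powr - k\<close> costs only a geometric factor of smaller ratio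
  than \<open>B\<^sup>2\<close>.
\<close>
theorem limited_range_extrapolation:
  fixes F :: "(('a::euclidean_space \<Rightarrow> ennreal) \<times> ('a \<Rightarrow> ennreal)) set"
  assumes meas: "\<forall>(f, g)\<in>F. f \<in> borel_measurable lebesgue \<and> g \<in> borel_measurable lebesgue"
    and \<delta>: "0 < \<delta>"
    and hyp: "\<forall>w\<in>A2. family_le F
          (\<lambda>f. \<integral>\<^sup>+x. f x ^ 2 * ennpowr (w x) \<delta> \<partial>lebesgue)
          (\<lambda>g. \<integral>\<^sup>+x. g x ^ 2 * ennpowr (w x) \<delta> \<partial>lebesgue)"
    and p: "\<And>x. p x = ennreal (P x)" and P [measurable]: "P \<in> borel_measurable lebesgue"
    and P1: "\<And>x. 1 \<le> P x" and P2: "\<And>x. P x \<le> p_hi"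
    and lh: "log_holder (\<lambda>x. 1 / P x) e_inf C" and C: "0 \<le> C"
    and \<rho>: "0 < \<rho>" "\<rho> < 1" and P\<rho>: "\<And>x. \<bar>1 - 2 / P x\<bar> \<le> \<delta> * \<rho> ^ 3"
    and w [measurable]: "w \<in> borel_measurable lebesgue"
    and wA2: "(\<lambda>x. ennpowr (w x) (2 / (\<delta> * (1 - \<rho>)))) \<in> A2"
  shows "family_le F (\<lambda>f. var_norm p (\<lambda>x. f x * w x)) (\<lambda>g. var_norm p (\<lambda>x. g x * w x))"
proof (rule ccontr)
  assume neg: "\<not> ?thesis"
  define \<sigma> where "\<sigma> = 2 / (\<delta> * (1 - \<rho>))"
  have \<sigma>: "0 < \<sigma>" using \<delta> \<rho> by (simp add: \<sigma>_def)
  define L where "L f = var_norm p (\<lambda>x. f x * w x)" for f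
  \<comment> \<open>Chosen such that \<open>2 powr p_hi * 2 * 4 / B\<^sup>2\<close>, the ratio in the final estimate, is at most \<open>1/2\<close>.\<close>
  define B where "B = 4 * 2 powr p_hi"
  have B: "0 < B" by (simp add: B_def)
  have P0: "0 < P x" for x using P1[of x] by linarith
  have "\<exists>fg\<in>F. L (fst fg) < \<infinity> \<and> ennreal (B ^ k) * L (snd fg) < L (fst fg)" for k :: nat
  proof -
    have "\<not> (\<forall>(f, g)\<in>F. L f < \<infinity> \<longrightarrow> L f \<le> ennreal (B ^ k) * L g)"
    proof
      assume "\<forall>(f, g)\<in>F. L f < \<infinity> \<longrightarrow> L f \<le> ennreal (B ^ k) * L g"
      moreover have "0 < B ^ k" using B by simp
      ultimately have "family_le F L L" unfolding family_le_def by blast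
      then show False using neg by (simp add: L_def[abs_def])
    qed
    then obtain a b where "(a, b) \<in> F" "L a < \<infinity>" "\<not> L a \<le> ennreal (B ^ k) * L b" by blast
    then show ?thesis by (intro bexI[of _ "(a, b)"]) (auto simp: not_le)
  qed
  then obtain fg where fg: "\<And>k::nat. fg k \<in> F \<and> L (fst (fg k)) < \<infinity> \<and> ennreal (B ^ k) * L (snd (fg k)) < L (fst (fg k))"
    by metis
  define f g where "f k = fst (fg k)" and "g k = snd (fg k)" for k
  have fgF: "(f k, g k) \<in> F" for k using fg by (simp add: f_def g_def)
  have [measurable]: "f k \<in> borel_measurable lebesgue" "g k \<in> borel_measurable lebesgue" for k
    using meas fgF[of k] by auto
  define \<alpha> where "\<alpha> k = enn2real (L (f k))" for k
  have \<alpha>: "L (f k) = ennreal (\<alpha> k)" for k using fg[of k] by (simp add: \<alpha>_def f_def ennreal_enn2real)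
  have \<alpha>0: "0 < \<alpha> k" for k
  proof -
    have "ennreal (B ^ k) * L (g k) < ennreal (\<alpha> k)" using fg[of k] \<alpha>[of k] by (simp add: f_def g_def)
    then have "0 < ennreal (\<alpha> k)" by (metis le_less_trans zero_le)
    then show ?thesis by (simp only: ennreal_less_zero_iff)
  qed
  have Lg: "L (g k) < ennreal (\<alpha> k / B ^ k)" for k
  proof -
    have "L (g k) * ennreal (B ^ k) < ennreal (\<alpha> k)" using fg[of k] \<alpha>[of k] by (simp add: f_def g_def mult.commute)
    moreover have "0 < B ^ k" using B by simp
    ultimately show ?thesis using \<alpha>0[of k]
      by (cases "L (g k)") (auto simp: ennreal_mult'[symmetric] ennreal_mult''[symmetric] ennreal_less_iff pos_less_divide_eq ennreal_top_mult ennreal_eq_0_iff not_le)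
  qed

  \<comment> \<open>Almost everywhere \<open>w\<close> is positive and finite, so it may be replaced by a real function.\<close>
  have w_pos: "AE x in lebesgue. 0 < w x \<and> w x < \<infinity>"
  proof -
    have "AE x in lebesgue. 0 < ennpowr (w x) \<sigma> \<and> ennpowr (w x) \<sigma> < \<infinity>"
      using wA2 unfolding A2_def \<sigma>_def[symmetric] by blast
    then show ?thesis
    proof eventually_elim
      case (elim x)
      then show ?case using \<sigma> by (cases "w x") (auto simp: ennpowr_def less_le)
    qed
  qed
  define w0 where "w0 x = (if 0 < w x \<and> w x < \<infinity> then enn2real (w x) else 1)" for x
  have w0_meas [measurable]: "w0 \<in> borel_measurable lebesgue" unfolding w0_def by measurable
  have w0_pos: "0 < w0 x" for x by (simp add: w0_def enn2real_positive_iff)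
  have w0_AE: "AE x in lebesgue. w x = ennreal (w0 x)"
    using w_pos by eventually_elim (simp add: w0_def ennreal_enn2real)
  have w0A2: "(\<lambda>x. ennreal (w0 x powr \<sigma>)) \<in> A2"
  proof (rule A2_cong_AE[OF wA2])
    show "AE x in lebesgue. ennpowr (w x) (2 / (\<delta> * (1 - \<rho>))) = ennreal (w0 x powr \<sigma>)"
      using w0_AE by eventually_elim (simp add: ennpowr_ennreal less_imp_le[OF w0_pos] \<sigma>_def)
  qed measurable

  \<comment> \<open>The normalised functions have modular at most one. The factor \<open>2\<close> is the slack that keeps the
    modular of \<open>F0 k\<close> bounded above, and \<open>F0_big\<close> bounds it below.\<close>
  define F0 where "F0 k x = enn2real (f k x * w x) / (2 * \<alpha> k)" for k x
  define G0 where "G0 k x = enn2real (g k x * w x) / (\<alpha> k / B ^ k)" for k x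
  have F0_meas [measurable]: "F0 k \<in> borel_measurable lebesgue" for k unfolding F0_def by measurable
  have G0_meas [measurable]: "G0 k \<in> borel_measurable lebesgue" for k unfolding G0_def by measurable
  have F0_nn: "0 \<le> F0 k x" for k x using \<alpha>0[of k] by (simp add: F0_def)
  have G0_nn: "0 \<le> G0 k x" for k x using \<alpha>0[of k] B by (simp add: G0_def)
  have F0: "AE x in lebesgue. f k x * w x = ennreal (2 * \<alpha> k * F0 k x)"
      "(\<integral>\<^sup>+x. ennreal (F0 k x powr P x) \<partial>lebesgue) \<le> 1" for k
  proof -
    have "var_norm p (\<lambda>x. f k x * w x) < ennreal (2 * \<alpha> k)"
      using \<alpha>[of k] \<alpha>0[of k] by (simp add: L_def ennreal_less_iff del: ennreal_mult ennreal_numeral)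
    then show "AE x in lebesgue. f k x * w x = ennreal (2 * \<alpha> k * F0 k x)"
      "(\<integral>\<^sup>+x. ennreal (F0 k x powr P x) \<partial>lebesgue) \<le> 1"
      unfolding F0_def using \<alpha>0[of k] by (intro normalise_by_var_norm[OF p P0], auto)+
  qed
  have G0: "AE x in lebesgue. g k x * w x = ennreal (\<alpha> k / B ^ k * G0 k x)"
      "(\<integral>\<^sup>+x. ennreal (G0 k x powr P x) \<partial>lebesgue) \<le> 1" for k
  proof -
    have less: "var_norm p (\<lambda>x. g k x * w x) < ennreal (\<alpha> k / B ^ k)" using Lg[of k] by (simp only: L_def)
    have pos: "0 < \<alpha> k / B ^ k" using \<alpha>0[of k] B by simp
    have m: "(\<lambda>x. g k x * w x) \<in> borel_measurable lebesgue" by measurable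
    show "AE x in lebesgue. g k x * w x = ennreal (\<alpha> k / B ^ k * G0 k x)"
      "(\<integral>\<^sup>+x. ennreal (G0 k x powr P x) \<partial>lebesgue) \<le> 1"
      unfolding G0_def by (rule normalise_by_var_norm[OF p P0 m P pos less])+
  qed
  have F0_big: "ennreal (1 / 4 powr p_hi) \<le> (\<integral>\<^sup>+x. ennreal (F0 k x powr P x) \<partial>lebesgue)" for k
  proof -
    have "ennreal (\<alpha> k / 2) < var_norm p (\<lambda>x. f k x * w x)"
      using \<alpha>[of k] \<alpha>0[of k] by (simp only: L_def) (simp add: ennreal_less_iff del: ennreal_half)
    then have "1 < (\<integral>\<^sup>+x. ennpowr (f k x * w x / ennreal (\<alpha> k / 2)) (P x) \<partial>lebesgue)"
      using \<alpha>0[of k] by (intro less_var_norm_imp_modular[OF p less_imp_le[OF P0]]) auto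
    also have "\<dots> \<le> (\<integral>\<^sup>+x. ennreal (4 powr p_hi) * ennreal (F0 k x powr P x) \<partial>lebesgue)"
      using F0(1)[of k]
    proof (intro nn_integral_mono_AE, eventually_elim)
      case (elim x)
      have "f k x * w x / ennreal (\<alpha> k / 2) = ennreal (4 * F0 k x)"
        using elim \<alpha>0[of k] F0_nn[of k x] by (simp add: divide_ennreal)
      then have "ennpowr (f k x * w x / ennreal (\<alpha> k / 2)) (P x) = ennreal ((4 * F0 k x) powr P x)"
        using F0_nn[of k x] by (simp add: ennpowr_ennreal)
      also have "(4 * F0 k x) powr P x = 4 powr P x * F0 k x powr P x" using F0_nn[of k x] by (simp add: powr_mult)
      also have "\<dots> \<le> 4 powr p_hi * F0 k x powr P x" using P2[of x] by (intro mult_right_mono powr_mono) auto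
      also have "ennreal (4 powr p_hi * F0 k x powr P x) = ennreal (4 powr p_hi) * ennreal (F0 k x powr P x)"
        by (simp add: ennreal_mult')
      finally show ?case by (simp add: ennreal_leI)
    qed
    also have "\<dots> = ennreal (4 powr p_hi) * (\<integral>\<^sup>+x. ennreal (F0 k x powr P x) \<partial>lebesgue)"
      by (rule nn_integral_cmult) measurable
    finally have "1 \<le> ennreal (4 powr p_hi) * (\<integral>\<^sup>+x. ennreal (F0 k x powr P x) \<partial>lebesgue)" by simp
    then have "ennreal (1 / 4 powr p_hi) * 1 \<le> ennreal (1 / 4 powr p_hi) * (ennreal (4 powr p_hi) * (\<integral>\<^sup>+x. ennreal (F0 k x powr P x) \<partial>lebesgue))"
      by (rule mult_left_mono) simp
    then show ?thesis by (simp add: mult.assoc[symmetric] ennreal_mult'[symmetric])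
  qed

  define \<Phi> where "\<Phi> x = (\<Sum>k. ennreal ((1 / 2) ^ k) * (ennreal (F0 k x powr P x) + ennreal (G0 k x powr P x)))" for x
  have \<Phi>_meas [measurable]: "\<Phi> \<in> borel_measurable lebesgue" unfolding \<Phi>_def by measurable
  have \<Phi>_fin: "(\<integral>\<^sup>+x. \<Phi> x \<partial>lebesgue) < \<infinity>"
  proof -
    have "(\<integral>\<^sup>+x. \<Phi> x \<partial>lebesgue) = (\<Sum>k. \<integral>\<^sup>+x. ennreal ((1 / 2) ^ k) * (ennreal (F0 k x powr P x) + ennreal (G0 k x powr P x)) \<partial>lebesgue)"
      unfolding \<Phi>_def by (rule nn_integral_suminf) measurable
    also have "\<dots> \<le> (\<Sum>k. ennreal ((1 / 2) ^ k) * 2)"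
    proof (intro suminf_le)
      fix k
      have "(\<integral>\<^sup>+x. ennreal ((1 / 2) ^ k) * (ennreal (F0 k x powr P x) + ennreal (G0 k x powr P x)) \<partial>lebesgue)
         = ennreal ((1 / 2) ^ k) * ((\<integral>\<^sup>+x. ennreal (F0 k x powr P x) \<partial>lebesgue) + (\<integral>\<^sup>+x. ennreal (G0 k x powr P x) \<partial>lebesgue))"
        by (subst nn_integral_cmult, measurable) (subst nn_integral_add, auto)
      also have "\<dots> \<le> ennreal ((1 / 2) ^ k) * (1 + 1)"
        by (intro mult_left_mono add_mono F0(2) G0(2)) simp
      finally show "(\<integral>\<^sup>+x. ennreal ((1 / 2) ^ k) * (ennreal (F0 k x powr P x) + ennreal (G0 k x powr P x)) \<partial>lebesgue) \<le> ennreal ((1 / 2) ^ k) * 2"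
        by simp
    qed auto
    also have "\<dots> = 2 * 2" by (rule suminf_half_powers)
    also have "\<dots> < \<infinity>" by (simp add: ennreal_mult_less_top)
    finally show ?thesis .
  qed
  obtain \<Psi> :: "'a \<Rightarrow> real" and I :: real
    where \<Psi>_meas [measurable]: "\<Psi> \<in> borel_measurable lebesgue" and \<Psi>_pos: "\<And>x. 0 < \<Psi> x" and I: "0 < I"
    and \<Psi>_int: "(\<integral>\<^sup>+x. ennreal (\<Psi> x) \<partial>lebesgue) \<le> ennreal I"
    and \<Psi>_ge: "AE x in lebesgue. \<Phi> x \<le> ennreal (\<Psi> x)"
    and W_A2: "(\<lambda>x. ennreal (w0 x powr (2 / \<delta>) * \<Psi> x powr ((1 - 2 / P x) / \<delta>))) \<in> A2"
    by (rule extrapolation_weight[OF \<Phi>_meas \<Phi>_fin P lh C \<delta> \<rho> P\<rho> w0_meas w0_pos w0A2[unfolded \<sigma>_def]]) (rule that; assumption)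
  define V where "V x = \<Psi> x powr (1 - 2 / P x)" for x
  have V_meas [measurable]: "V \<in> borel_measurable lebesgue" unfolding V_def by measurable
  have V_pos: "0 < V x" for x using \<Psi>_pos[of x] by (simp add: V_def)
  have W_powr: "ennpowr (ennreal (w0 x powr (2 / \<delta>) * \<Psi> x powr ((1 - 2 / P x) / \<delta>))) \<delta> = ennreal ((w0 x)\<^sup>2 * V x)" for x
  proof -
    have "(w0 x powr (2 / \<delta>) * \<Psi> x powr ((1 - 2 / P x) / \<delta>)) powr \<delta> = (w0 x)\<^sup>2 * V x"
    proof -
      have "(w0 x powr (2 / \<delta>)) powr \<delta> = (w0 x)\<^sup>2"
        using \<delta> w0_pos[of x] by (simp add: powr_powr less_imp_le)
      moreover have "(\<Psi> x powr ((1 - 2 / P x) / \<delta>)) powr \<delta> = V x"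
        using \<delta> by (simp add: powr_powr V_def)
      ultimately show ?thesis by (simp add: powr_mult)
    qed
    then show ?thesis by (subst ennpowr_ennreal) auto
  qed
  have "family_le F
          (\<lambda>f. \<integral>\<^sup>+x. f x ^ 2 * ennreal ((w0 x)\<^sup>2 * V x) \<partial>lebesgue)
          (\<lambda>g. \<integral>\<^sup>+x. g x ^ 2 * ennreal ((w0 x)\<^sup>2 * V x) \<partial>lebesgue)"
    using bspec[OF hyp W_A2] unfolding W_powr .
  then obtain C0 where C0: "0 < C0"
    and hypW: "\<And>f g. (f, g) \<in> F \<Longrightarrow> (\<integral>\<^sup>+x. f x ^ 2 * ennreal ((w0 x)\<^sup>2 * V x) \<partial>lebesgue) < \<infinity> \<Longrightarrow>
      (\<integral>\<^sup>+x. f x ^ 2 * ennreal ((w0 x)\<^sup>2 * V x) \<partial>lebesgue) \<le> ennreal C0 * (\<integral>\<^sup>+x. g x ^ 2 * ennreal ((w0 x)\<^sup>2 * V x) \<partial>lebesgue)"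
    unfolding family_le_def by blast
  have weighted: "(\<integral>\<^sup>+x. h x ^ 2 * ennreal ((w0 x)\<^sup>2 * V x) \<partial>lebesgue)
      = ennreal (a\<^sup>2) * (\<integral>\<^sup>+x. ennreal ((H x)\<^sup>2 * V x) \<partial>lebesgue)"
    if eq: "AE x in lebesgue. h x * w x = ennreal (a * H x)" and a: "0 \<le> a" and H: "\<And>x. 0 \<le> H x" and [measurable]: "H \<in> borel_measurable lebesgue"
    for h :: "'a \<Rightarrow> ennreal" and a :: real and H
  proof -
    have "(\<integral>\<^sup>+x. h x ^ 2 * ennreal ((w0 x)\<^sup>2 * V x) \<partial>lebesgue) = (\<integral>\<^sup>+x. ennreal (a\<^sup>2) * ennreal ((H x)\<^sup>2 * V x) \<partial>lebesgue)"
    proof (rule nn_integral_cong_AE)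
      show "AE x in lebesgue. h x ^ 2 * ennreal ((w0 x)\<^sup>2 * V x) = ennreal (a\<^sup>2) * ennreal ((H x)\<^sup>2 * V x)"
        using eq w0_AE
      proof eventually_elim
        case (elim x)
        have "h x ^ 2 * ennreal ((w0 x)\<^sup>2 * V x) = (h x * ennreal (w0 x)) ^ 2 * ennreal (V x)"
          using w0_pos[of x] V_pos[of x] by (simp add: ennreal_mult' power_mult_distrib mult.assoc less_imp_le flip: ennreal_power)
        also have "h x * ennreal (w0 x) = ennreal (a * H x)" using elim by simp
        also have "ennreal (a * H x) ^ 2 * ennreal (V x) = ennreal ((a * H x) ^ 2 * V x)"
        proof -
          have "0 \<le> a * H x" using a H[of x] by simp
          then show ?thesis by (simp only: ennreal_power ennreal_mult'[OF zero_le_power2])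
        qed
        also have "(a * H x) ^ 2 * V x = a\<^sup>2 * ((H x)\<^sup>2 * V x)" by (simp add: power_mult_distrib)
        also have "ennreal (a\<^sup>2 * ((H x)\<^sup>2 * V x)) = ennreal (a\<^sup>2) * ennreal ((H x)\<^sup>2 * V x)"
          by (rule ennreal_mult') simp
        finally show ?case .
      qed
    qed
    also have "\<dots> = ennreal (a\<^sup>2) * (\<integral>\<^sup>+x. ennreal ((H x)\<^sup>2 * V x) \<partial>lebesgue)" by (rule nn_integral_cmult) measurable
    finally show ?thesis .
  qed

  \<comment> \<open>The price for a common majorant of all pairs is the factor \<open>2 ^ k\<close>.\<close>
  have majorised: "AE x in lebesgue. H x \<le> 2 ^ k * \<Psi> x powr (1 / P x)"
    if H: "\<And>x. 0 \<le> H x" and le: "\<And>x. ennreal ((1 / 2) ^ k) * ennreal (H x powr P x) \<le> \<Phi> x" for H :: "'a \<Rightarrow> real" and k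
    using \<Psi>_ge
  proof eventually_elim
    case (elim x)
    have "ennreal ((1 / 2) ^ k * H x powr P x) \<le> ennreal (\<Psi> x)"
      using le[of x] elim by (simp add: ennreal_mult')
    then have "(1 / 2) ^ k * H x powr P x \<le> \<Psi> x" using \<Psi>_pos[of x] by (simp add: ennreal_le_iff)
    then have "H x powr P x \<le> 2 ^ k * \<Psi> x" by (simp add: power_divide field_simps)
    then have "(H x powr P x) powr (1 / P x) \<le> (2 ^ k * \<Psi> x) powr (1 / P x)"
      using P0[of x] by (intro powr_mono2) auto
    then have "H x \<le> (2 ^ k) powr (1 / P x) * \<Psi> x powr (1 / P x)"
      using P0[of x] H[of x] \<Psi>_pos[of x] by (simp add: powr_powr powr_mult)
    also have "(2 ^ k) powr (1 / P x) \<le> (2 ^ k) powr (1::real)" using P1[of x] P0[of x] by (intro powr_mono) auto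
    finally show ?case by (simp add: mult_right_mono)
  qed
  have F0_le: "AE x in lebesgue. F0 k x \<le> 2 ^ k * \<Psi> x powr (1 / P x)" for k
  proof (rule majorised[OF F0_nn])
    fix x
    have "ennreal ((1 / 2) ^ k) * ennreal (F0 k x powr P x) \<le> ennreal ((1 / 2) ^ k) * (ennreal (F0 k x powr P x) + ennreal (G0 k x powr P x))"
      by (intro mult_left_mono) auto
    also have "\<dots> \<le> \<Phi> x" unfolding \<Phi>_def by (rule term_le_suminf)
    finally show "ennreal ((1 / 2) ^ k) * ennreal (F0 k x powr P x) \<le> \<Phi> x" .
  qed
  have G0_le: "AE x in lebesgue. G0 k x \<le> 2 ^ k * \<Psi> x powr (1 / P x)" for k
  proof (rule majorised[OF G0_nn])
    fix x
    have "ennreal ((1 / 2) ^ k) * ennreal (G0 k x powr P x) \<le> ennreal ((1 / 2) ^ k) * (ennreal (F0 k x powr P x) + ennreal (G0 k x powr P x))"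
      by (intro mult_left_mono) auto
    also have "\<dots> \<le> \<Phi> x" unfolding \<Phi>_def by (rule term_le_suminf)
    finally show "ennreal ((1 / 2) ^ k) * ennreal (G0 k x powr P x) \<le> \<Phi> x" .
  qed
  have square_int: "(\<integral>\<^sup>+x. ennreal ((H x)\<^sup>2 * V x) \<partial>lebesgue) \<le> ennreal (4 ^ k * I)"
    if H: "\<And>x. 0 \<le> H x" and le: "AE x in lebesgue. H x \<le> 2 ^ k * \<Psi> x powr (1 / P x)" for H :: "'a \<Rightarrow> real" and k
  proof -
    have "(\<integral>\<^sup>+x. ennreal ((H x)\<^sup>2 * V x) \<partial>lebesgue) \<le> (\<integral>\<^sup>+x. ennreal (4 ^ k) * ennreal (\<Psi> x) \<partial>lebesgue)"
      using le
    proof (intro nn_integral_mono_AE, eventually_elim)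
      case (elim x)
      have "(H x)\<^sup>2 * V x \<le> (2 ^ k * \<Psi> x powr (1 / P x))\<^sup>2 * V x"
        using elim H[of x] V_pos[of x] by (intro mult_right_mono power_mono) auto
      also have "\<dots> = (2 ^ k)\<^sup>2 * (\<Psi> x powr (1 / P x) * \<Psi> x powr (1 / P x) * V x)"
          by (rule square_mult)
      also have "\<Psi> x powr (1 / P x) * \<Psi> x powr (1 / P x) * V x = \<Psi> x powr (1 / P x + 1 / P x + (1 - 2 / P x))"
        unfolding V_def by (simp only: powr_add)
      also have "1 / P x + 1 / P x + (1 - 2 / P x) = 1" by simp
      also have "(2 ^ k)\<^sup>2 * \<Psi> x powr 1 = 4 ^ k * \<Psi> x"
        using \<Psi>_pos[of x] by (simp add: power_mult[symmetric] mult.commute[of k] power_mult)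
      finally show ?case by (simp add: ennreal_mult'[symmetric] ennreal_leI)
    qed
    also have "\<dots> = ennreal (4 ^ k) * (\<integral>\<^sup>+x. ennreal (\<Psi> x) \<partial>lebesgue)" by (rule nn_integral_cmult) measurable
    also have "\<dots> \<le> ennreal (4 ^ k) * ennreal I" by (rule mult_left_mono[OF \<Psi>_int]) simp
    also have "\<dots> = ennreal (4 ^ k * I)" by (rule ennreal_mult'[symmetric]) simp
    finally show ?thesis .
  qed

  have decay: "1 / 4 powr p_hi \<le> (1 / 2) ^ k * (I + C0 * I)" for k
  proof -
    define X where "X = enn2real (\<integral>\<^sup>+x. ennreal ((F0 k x)\<^sup>2 * V x) \<partial>lebesgue)"
    have X_le: "(\<integral>\<^sup>+x. ennreal ((F0 k x)\<^sup>2 * V x) \<partial>lebesgue) \<le> ennreal (4 ^ k * I)"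
      by (rule square_int[OF F0_nn F0_le])
    have X: "(\<integral>\<^sup>+x. ennreal ((F0 k x)\<^sup>2 * V x) \<partial>lebesgue) = ennreal X"
      unfolding X_def using le_less_trans[OF X_le ennreal_less_top] by (intro ennreal_enn2real[symmetric])
    have X0: "0 \<le> X" by (simp add: X_def)
    have f_eq: "(\<integral>\<^sup>+x. f k x ^ 2 * ennreal ((w0 x)\<^sup>2 * V x) \<partial>lebesgue) = ennreal ((2 * \<alpha> k)\<^sup>2 * X)"
      using weighted[OF F0(1) _ F0_nn F0_meas, of k] \<alpha>0[of k] X by (simp add: ennreal_mult')
    have "ennreal ((2 * \<alpha> k)\<^sup>2 * X) \<le> ennreal C0 * (\<integral>\<^sup>+x. g k x ^ 2 * ennreal ((w0 x)\<^sup>2 * V x) \<partial>lebesgue)"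
      using hypW[OF fgF[of k]] unfolding f_eq by simp
    also have "\<dots> = ennreal C0 * (ennreal ((\<alpha> k / B ^ k)\<^sup>2) * (\<integral>\<^sup>+x. ennreal ((G0 k x)\<^sup>2 * V x) \<partial>lebesgue))"
      using \<alpha>0[of k] B by (subst weighted[OF G0(1) _ G0_nn G0_meas]) auto
    also have "\<dots> \<le> ennreal C0 * (ennreal ((\<alpha> k / B ^ k)\<^sup>2) * ennreal (4 ^ k * I))"
      by (intro mult_left_mono square_int[OF G0_nn G0_le]) auto
    also have "\<dots> = ennreal (C0 * ((\<alpha> k / B ^ k)\<^sup>2 * (4 ^ k * I)))"
      using C0 I by (simp add: ennreal_mult')
    finally have "(2 * \<alpha> k)\<^sup>2 * X \<le> C0 * ((\<alpha> k / B ^ k)\<^sup>2 * (4 ^ k * I))"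
      using C0 I by (subst (asm) ennreal_le_iff) auto
    then have "(\<alpha> k)\<^sup>2 * (4 * X) \<le> (\<alpha> k)\<^sup>2 * (C0 * (4 ^ k * I) / (B ^ k)\<^sup>2)"
      by (simp add: power_divide power_mult_distrib mult_ac)
    then have "4 * X \<le> C0 * (4 ^ k * I) / (B ^ k)\<^sup>2"
      by (rule mult_left_le_imp_le) (use \<alpha>0[of k] in simp)
    then have X_small: "X \<le> C0 * (4 ^ k * I) / (B ^ k)\<^sup>2" using X0 by linarith
    let ?\<eta> = "(1 / 2) ^ k :: real" and ?M = "2 ^ k :: real"
    let ?A = "?M powr p_hi / ?\<eta>"
    have "ennreal (1 / 4 powr p_hi) \<le> (\<integral>\<^sup>+x. ennreal (F0 k x powr P x) \<partial>lebesgue)" by (rule F0_big)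
    also have "\<dots> \<le> (\<integral>\<^sup>+x. ennreal ?\<eta> * ennreal (\<Psi> x) + ennreal ?A * ennreal ((F0 k x)\<^sup>2 * V x) \<partial>lebesgue)"
      using F0_le[of k]
    proof (intro nn_integral_mono_AE, eventually_elim)
      case (elim x)
      have "F0 k x powr P x \<le> ?\<eta> * \<Psi> x + ?A * ((F0 k x)\<^sup>2 * V x)"
        unfolding V_def by (rule powr_split[OF F0_nn \<Psi>_pos P1 P2 _ elim(2)]) (auto simp: power_le_one)
      then have "ennreal (F0 k x powr P x) \<le> ennreal (?\<eta> * \<Psi> x + ?A * ((F0 k x)\<^sup>2 * V x))" by (rule ennreal_leI)
      also have "\<dots> = ennreal (?\<eta> * \<Psi> x) + ennreal (?A * ((F0 k x)\<^sup>2 * V x))"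
        using \<Psi>_pos[of x] V_pos[of x] by (intro ennreal_plus) auto
      also have "ennreal (?\<eta> * \<Psi> x) = ennreal ?\<eta> * ennreal (\<Psi> x)" by (rule ennreal_mult') simp
      also have "ennreal (?A * ((F0 k x)\<^sup>2 * V x)) = ennreal ?A * ennreal ((F0 k x)\<^sup>2 * V x)" by (rule ennreal_mult') simp
      finally show ?case .
    qed
    also have "\<dots> = (\<integral>\<^sup>+x. ennreal ?\<eta> * ennreal (\<Psi> x) \<partial>lebesgue) + (\<integral>\<^sup>+x. ennreal ?A * ennreal ((F0 k x)\<^sup>2 * V x) \<partial>lebesgue)"
      by (rule nn_integral_add) measurable
    also have "(\<integral>\<^sup>+x. ennreal ?\<eta> * ennreal (\<Psi> x) \<partial>lebesgue) = ennreal ?\<eta> * (\<integral>\<^sup>+x. ennreal (\<Psi> x) \<partial>lebesgue)"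
      by (rule nn_integral_cmult) measurable
    also have "(\<integral>\<^sup>+x. ennreal ?A * ennreal ((F0 k x)\<^sup>2 * V x) \<partial>lebesgue) = ennreal ?A * ennreal X"
      unfolding X[symmetric] by (rule nn_integral_cmult) measurable
    also have "ennreal ?\<eta> * (\<integral>\<^sup>+x. ennreal (\<Psi> x) \<partial>lebesgue) + ennreal ?A * ennreal X \<le> ennreal ?\<eta> * ennreal I + ennreal ?A * ennreal X"
      by (intro add_right_mono mult_left_mono \<Psi>_int) simp
    also have "\<dots> = ennreal (?\<eta> * I + ?A * X)"
    proof -
      have nn: "0 \<le> ?\<eta>" "0 \<le> ?A" "0 \<le> ?\<eta> * I" "0 \<le> ?A * X" using I X0 by auto
      show ?thesis by (simp only: ennreal_plus[OF nn(3,4)] ennreal_mult'[OF nn(1)] ennreal_mult'[OF nn(2)])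
    qed
    finally have "1 / 4 powr p_hi \<le> ?\<eta> * I + ?A * X"
      using I X0 by (subst (asm) ennreal_le_iff) auto
    also have "\<dots> \<le> ?\<eta> * I + ?A * (C0 * (4 ^ k * I) / (B ^ k)\<^sup>2)"
      using X_small by (intro add_left_mono mult_left_mono) auto
    also have "?A * (C0 * (4 ^ k * I) / (B ^ k)\<^sup>2) = (?A * 4 ^ k / (B ^ k)\<^sup>2) * (C0 * I)" by simp
    also have "?A * 4 ^ k / (B ^ k)\<^sup>2 = (2 powr p_hi * 2 * 4 / B\<^sup>2) ^ k"
    proof -
      have "?M powr p_hi = (2 powr p_hi) ^ k" by (simp add: powr_realpow[symmetric] powr_powr mult.commute)
      moreover have "(B ^ k)\<^sup>2 = (B\<^sup>2) ^ k" by (simp add: power2_eq_square power_mult_distrib)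
      moreover have "(2 :: real) ^ k * 4 ^ k = 8 ^ k" by (simp flip: power_mult_distrib)
      ultimately show ?thesis by (simp add: power_mult_distrib power_divide)
    qed
    also have "2 powr p_hi * 2 * 4 / B\<^sup>2 = 1 / (2 * 2 powr p_hi)" by (simp add: B_def power2_eq_square field_simps)
    also have "(1 / (2 * 2 powr p_hi)) ^ k * (C0 * I) \<le> (1 / 2) ^ k * (C0 * I)"
    proof (intro mult_right_mono power_mono)
      have "1 \<le> 2 powr p_hi" using P0[of undefined] P2[of undefined] by (intro ge_one_powr_ge_zero) auto
      then show "1 / (2 * 2 powr p_hi) \<le> (1 / 2 :: real)" by (simp add: field_simps)
    qed (use C0 I in auto)
    finally show ?thesis by (simp add: distrib_left)
  qed
  have "(\<lambda>k. (1 / 2) ^ k * (I + C0 * I)) \<longlonglongrightarrow> 0 * (I + C0 * I)"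
    by (intro tendsto_mult tendsto_const LIMSEQ_power_zero) simp
  then have "1 / 4 powr p_hi \<le> 0 * (I + C0 * I)"
    by (rule LIMSEQ_le_const) (use decay in blast)
  then show False by simp
qed

text \<open>
  With \<open>\<theta> < 1\<close> such that \<open>|1 - 2 / s| \<le> \<delta> \<theta>\<close> on the given range, \<open>\<rho> = 1 - (1 - \<theta>) / 3\<close> satisfies
  \<open>\<theta> \<le> \<rho> ^ 3\<close> by Bernoulli's inequality.
\<close>
lemma contraction_factor_exists:
  fixes a b \<delta> :: real
  assumes \<delta>: "0 < \<delta>" and a: "2 / (1 + \<delta>) < a" and b: "0 < b" "1 - 2 / b < \<delta>"
  obtains \<rho> where "0 < \<rho>" "\<rho> < 1" "\<And>s. a \<le> s \<Longrightarrow> s \<le> b \<Longrightarrow> \<bar>1 - 2 / s\<bar> \<le> \<delta> * \<rho> ^ 3"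
proof -
  have a0: "0 < a" using a \<delta> by (smt (verit) divide_pos_pos)
  define \<theta> where "\<theta> = max 0 (max (2 / a - 1) (1 - 2 / b) / \<delta>)"
  have "2 / a < 1 + \<delta>" using a a0 \<delta> by (simp add: field_simps)
  then have \<theta>: "0 \<le> \<theta>" "\<theta> < 1" using b \<delta> by (auto simp: \<theta>_def)
  define y where "y = (1 - \<theta>) / 3"
  have y: "0 < y" "y < 1" using \<theta> by (auto simp: y_def)
  have "1 - 3 * y \<le> (1 - y) ^ 3"
  proof -
    have "(1 - y) ^ 3 = 1 - 3 * y + y\<^sup>2 * (3 - y)" by (simp add: power3_eq_cube power2_eq_square algebra_simps)
    then show ?thesis using y by simp
  qed
  moreover have "3 * y = 1 - \<theta>" by (simp add: y_def)
  ultimately have \<rho>3: "\<theta> \<le> (1 - y) ^ 3" by linarith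
  show ?thesis
  proof (rule that[of "1 - y"])
    fix s assume s: "a \<le> s" "s \<le> b"
    have "2 / s \<le> 2 / a" "2 / b \<le> 2 / s" using s a0 by (auto intro!: divide_left_mono mult_pos_pos)
    then have "\<bar>1 - 2 / s\<bar> \<le> max (2 / a - 1) (1 - 2 / b)" by linarith
    also have "\<dots> = \<delta> * (max (2 / a - 1) (1 - 2 / b) / \<delta>)" using \<delta> by simp
    also have "\<dots> \<le> \<delta> * \<theta>" using \<delta> by (intro mult_left_mono) (auto simp: \<theta>_def)
    also have "\<dots> \<le> \<delta> * (1 - y) ^ 3" using \<rho>3 \<delta> by (intro mult_left_mono) auto
    finally show "\<bar>1 - 2 / s\<bar> \<le> \<delta> * (1 - y) ^ 3" .
  qed (use y in auto)
qed

theorem corollary2p18: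
  fixes F :: "(('a::euclidean_space \<Rightarrow> ennreal) \<times> ('a \<Rightarrow> ennreal)) set"
    and \<delta> :: real
  assumes meas: "\<forall>(f, g)\<in>F. f \<in> borel_measurable lebesgue \<and> g \<in> borel_measurable lebesgue"
    and \<delta>: "0 < \<delta>" "\<delta> \<le> 1"
    and hyp: "\<forall>w\<in>A2. family_le F
          (\<lambda>f. \<integral>\<^sup>+x. f x ^ 2 * ennpowr (w x) \<delta> \<partial>lebesgue)
          (\<lambda>g. \<integral>\<^sup>+x. g x ^ 2 * ennpowr (w x) \<delta> \<partial>lebesgue)"
  shows "\<forall>p\<in>LH.
    (let q_minus = 2 / (1 + \<delta>);
         q_plus = (if \<delta> = 1 then \<infinity> else ennreal (2 / (1 - \<delta>)))
     in ennreal q_minus < essinf lebesgue p \<and> essinf lebesgue p \<le> esssup lebesgue p \<and>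
        esssup lebesgue p < q_plus \<longrightarrow>
        family_le F (var_norm p) (var_norm p) \<and>
        (\<exists>p_star::real. q_minus < p_star \<and> ennreal p_star < q_plus \<and>
          (let \<sigma> = p_star * q_minus / (p_star - q_minus)
           in \<exists>c::real. 0 < c \<and> c < 1 \<and>
                (\<lambda>x. p x / ennreal (c * \<sigma>)) \<in> exponents \<and>
                (\<forall>w\<in>weights. (\<lambda>x. ennpowr (w x) \<sigma>) \<in> A_var (\<lambda>x. p x / ennreal (c * \<sigma>)) \<longrightarrow>
                   family_le F (\<lambda>f. var_norm p (\<lambda>x. f x * w x))
                               (\<lambda>g. var_norm p (\<lambda>x. g x * w x))))))"
proof (intro ballI, unfold Let_def, intro impI)
  fix p :: "'a \<Rightarrow> ennreal"
  assume pLH: "p \<in> LH"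
  let ?q_minus = "2 / (1 + \<delta>)" and ?q_plus = "if \<delta> = 1 then \<infinity> else ennreal (2 / (1 - \<delta>))"
  assume range: "ennreal ?q_minus < essinf lebesgue p \<and> essinf lebesgue p \<le> esssup lebesgue p \<and> esssup lebesgue p < ?q_plus"
  define P where "P x = enn2real (p x)" for x
  have p_exp: "p \<in> exponents" and p_fin: "\<And>x. p x \<noteq> \<infinity>" using pLH by (auto simp: LH_def)
  have p_meas [measurable]: "p \<in> borel_measurable lebesgue" and p1: "\<And>x. 1 \<le> p x"
    using p_exp by (auto simp: exponents_def)
  have pP: "p x = ennreal (P x)" for x using p_fin[of x] by (simp add: P_def ennreal_enn2real_if)
  have P_meas [measurable]: "P \<in> borel_measurable lebesgue" unfolding P_def by measurable
  have P1: "1 \<le> P x" for x using p1[of x] unfolding pP by simp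
  obtain p_inf C where C: "0 \<le> C" and lhP: "log_holder P p_inf C"
    using LH_log_holder[OF pLH] unfolding P_def[symmetric] by blast
  have lh: "log_holder (\<lambda>x. 1 / P x) (1 / p_inf) C" by (rule log_holder_inverse[OF lhP P1])

  have q_minus: "1 \<le> ?q_minus" using \<delta> by simp
  obtain a where a: "?q_minus < a" "\<And>x. a \<le> P x"
  proof -
    obtain e where e: "ennreal ?q_minus < e" "AE x in lebesgue. e \<le> p x"
      using range unfolding essinf_eq_AE[OF p_meas] less_Sup_iff by auto
    have "AE x in lebesgue. x \<in> ball (0 :: 'a) 1 \<longrightarrow> e \<le> p x" using e(2) by eventually_elim simp
    then obtain x where "e \<le> p x" using zero_less_one by (rule AE_ballE)
    then have "e \<noteq> \<infinity>" using p_fin[of x] by (auto simp: top_unique)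
    then obtain a where a: "e = ennreal a" "0 \<le> a" by (cases e) auto
    have "AE x in lebesgue. - P x \<le> - a"
      using e(2) by eventually_elim (use P1 a in \<open>simp add: pP ennreal_le_iff order_trans[OF zero_le_one]\<close>)
    then have "- P x \<le> - a" for x by (rule log_holder_AE_le[OF log_holder_uminus[OF lhP] C])
    then have "a \<le> P x" for x by simp
    moreover have "?q_minus < a" using e(1) a q_minus unfolding a(1) by (subst (asm) ennreal_less_iff) (use \<delta> in auto)
    ultimately show ?thesis using that by blast
  qed
  obtain b where b: "\<And>x. P x \<le> b" "1 - 2 / b < \<delta>"
  proof -
    have "esssup lebesgue p < \<infinity>" using range by (metis infinity_ennreal_def less_le_trans top_greatest)
    then obtain b where b: "esssup lebesgue p = ennreal b" "0 \<le> b" by (cases "esssup lebesgue p") auto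
    have "AE x in lebesgue. P x \<le> b"
      using esssup_AE[of p lebesgue] by eventually_elim (use b in \<open>simp add: pP\<close>)
    then have Pb: "P x \<le> b" for x by (rule log_holder_AE_le[OF lhP C])
    then have b0: "0 < b" using P1[of undefined] Pb[of undefined] by linarith
    have "1 - 2 / b < \<delta>"
    proof (cases "\<delta> = 1")
      case False
      then have "ennreal b < ennreal (2 / (1 - \<delta>))" using range b by simp
      then have "b < 2 / (1 - \<delta>)" using b by (simp add: ennreal_less_iff)
      then show ?thesis using False \<delta> b0 by (simp add: field_simps)
    qed (use b0 in simp)
    then show ?thesis using that Pb by blast
  qed
  have b0: "0 < b" using P1[of undefined] b(1)[of undefined] by linarith
  obtain \<rho> where \<rho>: "0 < \<rho>" "\<rho> < 1" and "\<And>s. a \<le> s \<Longrightarrow> s \<le> b \<Longrightarrow> \<bar>1 - 2 / s\<bar> \<le> \<delta> * \<rho> ^ 3"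
    using contraction_factor_exists[OF \<delta>(1) a(1) b0 b(2)] by blast
  then have P\<rho>: "\<bar>1 - 2 / P x\<bar> \<le> \<delta> * \<rho> ^ 3" for x using a(2) b(1) by blast

  define \<sigma> where "\<sigma> = 2 / (\<delta> * (1 - \<rho>))"
  have \<sigma>: "0 < \<sigma>" "1 / \<sigma> = \<delta> * (1 - \<rho>) / 2" using \<delta> \<rho> by (auto simp: \<sigma>_def)
  have extrapolate: "family_le F (\<lambda>f. var_norm p (\<lambda>x. f x * w x)) (\<lambda>g. var_norm p (\<lambda>x. g x * w x))"
    if "w \<in> borel_measurable lebesgue" "(\<lambda>x. ennpowr (w x) \<sigma>) \<in> A2" for w
    by (rule limited_range_extrapolation[OF meas \<delta>(1) hyp pP P_meas P1 b(1) lh C \<rho> P\<rho> that(1) that(2)[unfolded \<sigma>_def]])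

  have unweighted: "family_le F (var_norm p) (var_norm p)"
  proof -
    have "(\<lambda>x::'a. 1 :: ennreal) \<in> A2"
    proof (rule A2I[where K = 1])
      fix z :: 'a and r :: real assume r: "0 < r"
      have "(\<integral>\<^sup>+x\<in>ball z r. 1 \<partial>lebesgue) = ennreal (vol TYPE('a) r)"
        using r by (simp add: emeasure_ball)
      then show "(\<integral>\<^sup>+x\<in>ball z r. 1 \<partial>lebesgue) * (\<integral>\<^sup>+x\<in>ball z r. inverse 1 \<partial>lebesgue) \<le> ennreal (1 * (vol TYPE('a) r)\<^sup>2)"
        using vol_pos[OF r, where 'a = 'a] by (simp add: power2_eq_square flip: ennreal_mult')
    qed auto
    moreover have "ennpowr 1 \<sigma> = 1" by (simp add: ennpowr_def)
    ultimately show ?thesis using extrapolate[of "\<lambda>_. 1"] by simp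
  qed

  \<comment> \<open>This value makes \<open>\<sigma>\<close> the exponent \<open>p_* q_- / (p_* - q_-)\<close>. With \<open>c = 1 / \<sigma>\<close> the exponent \<open>p / (c \<sigma>)\<close>
      is \<open>p\<close> itself.\<close>
  define p_star where "p_star = 2 / (1 + \<delta> * \<rho>)"
  have d\<rho>: "0 < \<delta> * \<rho>" "\<delta> * \<rho> < \<delta>" using \<delta> \<rho> by auto
  have p_star: "?q_minus < p_star"
    unfolding p_star_def using d\<rho> \<delta> by (intro divide_strict_left_mono) auto
  have p_star': "ennreal p_star < ?q_plus"
  proof (cases "\<delta> = 1")
    case False
    then have "1 - \<delta> < 1 + \<delta> * \<rho>" "0 < 1 - \<delta>" using d\<rho> \<delta> by auto
    then have "p_star < 2 / (1 - \<delta>)" unfolding p_star_def using d\<rho> by (intro divide_strict_left_mono) auto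
    moreover have "0 \<le> p_star" using d\<rho> by (simp add: p_star_def)
    ultimately show ?thesis using False by (simp add: ennreal_less_iff)
  qed simp
  have \<sigma>_eq: "p_star * ?q_minus / (p_star - ?q_minus) = \<sigma>"
  proof -
    have pos: "0 < p_star" "0 < ?q_minus" using d\<rho> \<delta> by (auto simp: p_star_def)
    have reciprocal: "1 / (s * t / (s - t)) = 1 / t - 1 / s" if "0 < s" "0 < t" for s t :: real
      using that by (simp add: diff_divide_distrib)
    have inj: "s = t" if "1 / s = 1 / t" for s t :: real using that by simp
    have "1 / (p_star * ?q_minus / (p_star - ?q_minus)) = 1 / ?q_minus - 1 / p_star"
      by (rule reciprocal[OF pos])
    also have "\<dots> = (1 + \<delta>) / 2 - (1 + \<delta> * \<rho>) / 2" by (simp add: p_star_def)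
    also have "\<dots> = \<delta> * (1 - \<rho>) / 2" by (simp add: right_diff_distrib flip: diff_divide_distrib)
    also have "\<dots> = 1 / \<sigma>" by (rule \<sigma>(2)[symmetric])
    finally show ?thesis by (rule inj)
  qed
  have c\<sigma>: "(1 / \<sigma>) * \<sigma> = 1" using \<sigma>(1) by simp
  have p_div: "(\<lambda>x. p x / ennreal ((1 / \<sigma>) * \<sigma>)) = p" unfolding c\<sigma> by (simp add: divide_ennreal_def)
  have P_gt: "1 < a" using a(1) q_minus by linarith
  have c_pos: "0 < 1 / \<sigma>" using \<sigma>(1) by simp
  have c_less: "1 / \<sigma> < 1"
  proof -
    have "\<delta> * (1 - \<rho>) \<le> 1 * 1" using \<delta> \<rho> by (intro mult_mono) auto
    then show ?thesis unfolding \<sigma>(2) by simp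
  qed
  have weighted: "\<forall>w\<in>weights. (\<lambda>x. ennpowr (w x) \<sigma>) \<in> A_var p \<longrightarrow>
      family_le F (\<lambda>f. var_norm p (\<lambda>x. f x * w x)) (\<lambda>g. var_norm p (\<lambda>x. g x * w x))"
  proof (intro ballI impI)
    fix w :: "'a \<Rightarrow> ennreal"
    assume w: "w \<in> weights" and A: "(\<lambda>x. ennpowr (w x) \<sigma>) \<in> A_var p"
    have "(\<lambda>x. ennpowr (w x) \<sigma>) \<in> A2"
      by (rule A_var_imp_A2[OF pP P_meas P_gt a(2) b(1) lh C A])
    then show "family_le F (\<lambda>f. var_norm p (\<lambda>x. f x * w x)) (\<lambda>g. var_norm p (\<lambda>x. g x * w x))"
      using w by (intro extrapolate) (auto simp: weights_def)
  qed
  show "family_le F (var_norm p) (var_norm p) \<and>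
    (\<exists>p_star. ?q_minus < p_star \<and> ennreal p_star < ?q_plus \<and>
      (\<exists>c>0. c < 1 \<and>
        (\<lambda>x. p x / ennreal (c * (p_star * ?q_minus / (p_star - ?q_minus)))) \<in> exponents \<and>
        (\<forall>w\<in>weights.
          (\<lambda>x. ennpowr (w x) (p_star * ?q_minus / (p_star - ?q_minus)))
            \<in> A_var (\<lambda>x. p x / ennreal (c * (p_star * ?q_minus / (p_star - ?q_minus)))) \<longrightarrow>
          family_le F (\<lambda>f. var_norm p (\<lambda>x. f x * w x)) (\<lambda>g. var_norm p (\<lambda>x. g x * w x)))))"
    by (rule conjI[OF unweighted], rule exI[of _ p_star], rule conjI[OF p_star], rule conjI[OF p_star'],
        rule exI[of _ "1 / \<sigma>"], unfold \<sigma>_eq p_div, intro conjI c_pos c_less p_exp weighted)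
qed

end
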